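(* Let $\Gamma$ be a countable group and assume that $L(\Gamma)'\cap L(\Gamma)^\omega=Z(L(\Gamma))^\omega$, where $\omega\in\beta\mathbb N\setminus\mathbb N$ is a free ultrafilter. Let $G\leq\mathrm{Aut}(\Gamma)$ be a non-trivial finite subgroup. The following holds. (1) $\mathcal U:=\{\lambda_sL(\Gamma)^G\lambda_s^*:s\in\Gamma\}$ is a discrete exotic URA. (2) If $\Gamma$ is i.c.c. then $\mathcal U$ has infinite cardinality.
   Context: $L(\Gamma)$ is the group von Neumann algebra with canonical unitaries $\lambda_s$, $s\in\Gamma$, and canonical trace $\tau$; $Z(L(\Gamma))$ is its center. For a finite von Neumann algebra $(M,\tau)$, $M^\omega$ is the tracial ultrapower: the quotient of $\ell^\infty(\mathbb N,M)$ by the ideal $\{(x_n)_n:\lim_{n\to\omega}\|x_n\|_2=0\}$, with $M\subset M^\omega$ embedded as constant sequences. Every $\phi\in\mathrm{Aut}(\Gamma)$ extends to a trace-preserving automorphism of $L(\Gamma)$ with $\phi(\lambda_s)=\lambda_{\phi(s)}$, and $L(\Gamma)^G=\{x\in L(\Gamma):\phi(x)=x\ \forall\phi\in G\}$. $\mathrm{Sub}(L(\Gamma))$ is the set of unital von Neumann subalgebras with the Effros–Maréchal topology: the smallest topology for which all maps $N\mapsto E_N(x)\in \mathrm{L}^2(L(\Gamma),\tau)$, $x\in L(\Gamma)$, are norm continuous, $E_N$ being the $\tau$-preserving conditional expectation onto $N$. $\Gamma$ acts on it by $s\cdot N=\lambda_sN\lambda_s^*$. A URA is a minimal (non-empty)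 closed $\Gamma$-invariant subset; it is discrete if discrete in the subspace topology, and exotic if it is not of the form $\{L(H):H\in Y\}$ for a URS $Y$ of $\Gamma$, where a URS is a minimal (non-empty) closed conjugation-invariant subset of the space $\mathrm{Sub}(\Gamma)\subset\{0,1\}^\Gamma$ of subgroups of $\Gamma$ with the Chabauty (product) topology. $\Gamma$ is i.c.c. if every non-trivial conjugacy class is infinite (and $\Gamma$ is non-trivial). *)

theory Defs
  imports
    "HOL-Analysis.Analysis"
    "HOL-Algebra.Bij"
    "HOL-Algebra.Coset"
    "HOL-Algebra.QuotRing"
begin

section \<open>The complex Hilbert space of square-summable functions\<close>

typedef 'a ell2 = "{f :: 'a \<Rightarrow> complex. (\<lambda>x. (cmod (f x))\<^sup>2) summable_on UNIV}"
  morphisms coord Abs_ell2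
  by (rule exI[of _ "\<lambda>_. 0"]) simp

setup_lifting type_definition_ell2

lemma coord_summable: "(\<lambda>x. (cmod (coord f x))\<^sup>2) summable_on UNIV"
  using coord[of f] by simp

lemma coord_eqI: "(\<And>x. coord f x = coord g x) \<Longrightarrow> f = g"
  by (metis coord_inject ext)

lemma cmod_add_square_le: "(cmod (a + b))\<^sup>2 \<le> 2 * (cmod a)\<^sup>2 + 2 * (cmod b)\<^sup>2"
proof -
  have "(cmod (a + b))\<^sup>2 \<le> (cmod a + cmod b)\<^sup>2"
    by (simp add: norm_triangle_ineq power_mono)
  also have "\<dots> \<le> 2 * (cmod a)\<^sup>2 + 2 * (cmod b)\<^sup>2"
    using sum_squares_bound[of "cmod a" "cmod b"] by (simp add: power2_sum)
  finally show ?thesis .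
qed

lemma square_summable_add:
  fixes f g :: "'a \<Rightarrow> complex"
  assumes "(\<lambda>x. (cmod (f x))\<^sup>2) summable_on S" "(\<lambda>x. (cmod (g x))\<^sup>2) summable_on S"
  shows "(\<lambda>x. (cmod (f x + g x))\<^sup>2) summable_on S"
proof (rule summable_on_comparison_test)
  show "(\<lambda>x. 2 * (cmod (f x))\<^sup>2 + 2 * (cmod (g x))\<^sup>2) summable_on S"
    by (intro summable_on_add summable_on_cmult_right assms)
qed (auto intro: cmod_add_square_le)

lemma square_summable_scale:
  fixes f :: "'a \<Rightarrow> complex"
  assumes "(\<lambda>x. (cmod (f x))\<^sup>2) summable_on S"
  shows "(\<lambda>x. (cmod (c * f x))\<^sup>2) summable_on S"
  by (simp add: norm_mult power_mult_distrib summable_on_cmult_right assms)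

instantiation ell2 :: (type) real_vector
begin

lift_definition zero_ell2 :: "'a ell2" is "\<lambda>_. 0"
  by simp

lift_definition plus_ell2 :: "'a ell2 \<Rightarrow> 'a ell2 \<Rightarrow> 'a ell2" is "\<lambda>f g x. f x + g x"
  by (rule square_summable_add)

lift_definition uminus_ell2 :: "'a ell2 \<Rightarrow> 'a ell2" is "\<lambda>f x. - f x"
  by simp

definition minus_ell2 :: "'a ell2 \<Rightarrow> 'a ell2 \<Rightarrow> 'a ell2" where
  "minus_ell2 f g = f + (- g)"

lift_definition scaleR_ell2 :: "real \<Rightarrow> 'a ell2 \<Rightarrow> 'a ell2" is "\<lambda>r f x. complex_of_real r * f x"
  by (rule square_summable_scale)

instance
  by standard (auto simp: minus_ell2_def intro!: coord_eqI
      simp: plus_ell2.rep_eq zero_ell2.rep_eq uminus_ell2.rep_eq scaleR_ell2.rep_eq algebra_simps)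

end

lift_definition scaleC :: "complex \<Rightarrow> 'a ell2 \<Rightarrow> 'a ell2" (infixr \<open>*\<^sub>C\<close> 75)
  is "\<lambda>c f x. c * f x"
  by (rule square_summable_scale)

definition cinner :: "'a ell2 \<Rightarrow> 'a ell2 \<Rightarrow> complex" where
  "cinner f g = (\<Sum>\<^sub>\<infinity>x. cnj (coord f x) * coord g x)"

lemma cinner_summable: "(\<lambda>x. cnj (coord f x) * coord g x) summable_on UNIV"
proof (rule abs_summable_summable, rule summable_on_comparison_test)
  show "(\<lambda>x. (cmod (coord f x))\<^sup>2 + (cmod (coord g x))\<^sup>2) summable_on UNIV"
    by (intro summable_on_add coord_summable)
  fix x
  show "cmod (cnj (coord f x) * coord g x) \<le> (cmod (coord f x))\<^sup>2 + (cmod (coord g x))\<^sup>2"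
    using sum_squares_bound[of "cmod (coord f x)" "cmod (coord g x)"]
      mult_nonneg_nonneg[OF norm_ge_zero norm_ge_zero, of "coord f x" "coord g x"]
    unfolding norm_mult complex_mod_cnj mult.assoc by linarith
qed auto

lemma cinner_add_left: "cinner (f + g) h = cinner f h + cinner g h"
  unfolding cinner_def plus_ell2.rep_eq
  by (simp add: ring_distribs infsum_add cinner_summable)

lemma cinner_scaleR_left: "cinner (r *\<^sub>R f) h = complex_of_real r * cinner f h"
  unfolding cinner_def scaleR_ell2.rep_eq
  by (simp add: mult.assoc infsum_cmult_right')

lemma cinner_commute: "cinner f g = cnj (cinner g f)"
  unfolding cinner_def by (simp flip: infsum_cnj add: mult.commute)

lemma cinner_self: "cinner f f = complex_of_real (\<Sum>\<^sub>\<infinity>x. (cmod (coord f x))\<^sup>2)"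
proof -
  have "cinner f f = (\<Sum>\<^sub>\<infinity>x. complex_of_real ((cmod (coord f x))\<^sup>2))"
    unfolding cinner_def
    by (intro infsum_cong) (metis complex_norm_square mult.commute)
  moreover have "((\<lambda>x. complex_of_real ((cmod (coord f x))\<^sup>2)) has_sum
      complex_of_real (\<Sum>\<^sub>\<infinity>x. (cmod (coord f x))\<^sup>2)) UNIV"
    unfolding has_sum_of_real_iff by (rule has_sum_infsum[OF coord_summable])
  ultimately show ?thesis
    by (simp only: infsumI)
qed

instantiation ell2 :: (type) real_inner
begin

definition inner_ell2 :: "'a ell2 \<Rightarrow> 'a ell2 \<Rightarrow> real" where
  "inner_ell2 f g = Re (cinner f g)"

definition norm_ell2 :: "'a ell2 \<Rightarrow> real" where
  "norm_ell2 f = sqrt (inner f f)"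

definition sgn_ell2 :: "'a ell2 \<Rightarrow> 'a ell2" where
  "sgn_ell2 f = f /\<^sub>R norm f"

definition dist_ell2 :: "'a ell2 \<Rightarrow> 'a ell2 \<Rightarrow> real" where
  "dist_ell2 f g = norm (f - g)"

definition uniformity_ell2 :: "('a ell2 \<times> 'a ell2) filter" where
  "uniformity_ell2 = (INF e\<in>{0<..}. principal {(x, y). dist x y < e})"

definition open_ell2 :: "'a ell2 set \<Rightarrow> bool" where
  "open_ell2 U \<longleftrightarrow> (\<forall>x\<in>U. \<forall>\<^sub>F (x', y) in uniformity. x' = x \<longrightarrow> y \<in> U)"

instance
proof
  fix f g h :: "'a ell2" and r :: real
  show "inner f g = inner g f"
    unfolding inner_ell2_def by (subst cinner_commute) simp
  show "inner (f + g) h = inner f h + inner g h"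
    by (simp add: inner_ell2_def cinner_add_left)
  show "inner (r *\<^sub>R f) g = r * inner f g"
    by (simp add: inner_ell2_def cinner_scaleR_left)
  show "0 \<le> inner f f"
    by (simp add: inner_ell2_def cinner_self infsum_nonneg)
  show "inner f f = 0 \<longleftrightarrow> f = 0"
  proof
    assume "inner f f = 0"
    then have "(\<Sum>\<^sub>\<infinity>x. (cmod (coord f x))\<^sup>2) = 0"
      by (simp add: inner_ell2_def cinner_self)
    then have "(cmod (coord f x))\<^sup>2 = 0" for x
      using nonneg_infsum_le_0D[of "\<lambda>x. (cmod (coord f x))\<^sup>2" UNIV x] coord_summable[of f] by simp
    then show "f = 0"
      by (intro coord_eqI) (simp add: zero_ell2.rep_eq)
  qed (simp add: inner_ell2_def cinner_self zero_ell2.rep_eq)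
qed (simp_all add: norm_ell2_def sgn_ell2_def dist_ell2_def uniformity_ell2_def open_ell2_def)

end

lemma norm_ell2_infsum: "norm f = sqrt (\<Sum>\<^sub>\<infinity>x. (cmod (coord f x))\<^sup>2)"
  by (simp add: norm_ell2_def inner_ell2_def cinner_self)

lift_definition ket :: "'a \<Rightarrow> 'a ell2" is "\<lambda>s t. if t = s then 1 else 0"
proof -
  fix s :: 'a
  have "(\<lambda>t. (cmod (if t = s then 1 else 0))\<^sup>2) summable_on {s}"
    by simp
  then show "(\<lambda>t. (cmod (if t = s then 1 else 0))\<^sup>2) summable_on UNIV"
    by (rule summable_on_cong_neutral[THEN iffD1, rotated -1]) auto
qed

section \<open>Operators\<close>

type_synonym 'a ell2_op = "'a ell2 \<Rightarrow>\<^sub>L 'a ell2"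

lemma norm_scaleC: "norm (c *\<^sub>C f) = cmod c * norm f"
  by (simp add: norm_ell2_infsum scaleC.rep_eq norm_mult power_mult_distrib infsum_cmult_right'
      real_sqrt_mult)

lemma bounded_linear_scaleC_comp:
  fixes T :: "'b :: real_normed_vector \<Rightarrow> 'a ell2"
  assumes "bounded_linear T"
  shows "bounded_linear (\<lambda>f. c *\<^sub>C T f)"
proof -
  have "bounded_linear (\<lambda>f :: 'a ell2. c *\<^sub>C f)"
    by (rule bounded_linear_intro[where K = "cmod c"])
      (auto intro!: coord_eqI simp: scaleC.rep_eq plus_ell2.rep_eq scaleR_ell2.rep_eq
        algebra_simps norm_scaleC)
  then show ?thesis
    using assms bounded_linear_compose by blast
qed

definition scaleC_op :: "complex \<Rightarrow> 'a ell2_op \<Rightarrow> 'a ell2_op" where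
  "scaleC_op c T = Blinfun (\<lambda>f. c *\<^sub>C blinfun_apply T f)"

lemma scaleC_op_apply: "blinfun_apply (scaleC_op c T) f = c *\<^sub>C blinfun_apply T f"
  by (simp add: scaleC_op_def bounded_linear_Blinfun_apply bounded_linear_scaleC_comp
      blinfun.bounded_linear_right)

definition adj :: "'a ell2_op \<Rightarrow> 'a ell2_op" where
  "adj T = (THE S. \<forall>f g. cinner (blinfun_apply S f) g = cinner f (blinfun_apply T g))"

lemma square_summable_restrict:
  assumes "(\<lambda>x. (cmod (f x))\<^sup>2) summable_on UNIV"
  shows "(\<lambda>x. (cmod (if x \<in> S then f x else 0))\<^sup>2) summable_on UNIV"
  by (rule summable_on_comparison_test[OF assms]) auto

lift_definition restrict_ell2 :: "'a set \<Rightarrow> 'a ell2 \<Rightarrow> 'a ell2"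
  is "\<lambda>S f x. if x \<in> S then f x else 0"
  by (rule square_summable_restrict)

lemma norm_restrict_ell2: "norm (restrict_ell2 S f) \<le> norm f"
  unfolding norm_ell2_infsum real_sqrt_le_iff restrict_ell2.rep_eq
  by (intro infsum_mono square_summable_restrict coord_summable) auto

text \<open>The orthogonal projection of \<open>\<ell>\<^sup>2('a)\<close> onto \<open>\<ell>\<^sup>2(S)\<close>.\<close>

definition ell2_proj :: "'a set \<Rightarrow> 'a ell2_op" where
  "ell2_proj S = Blinfun (restrict_ell2 S)"

lemma ell2_proj_apply: "blinfun_apply (ell2_proj S) f = restrict_ell2 S f"
proof -
  have "bounded_linear (restrict_ell2 S)"
    by (rule bounded_linear_intro[where K = 1])
      (auto intro!: coord_eqI simp: restrict_ell2.rep_eq plus_ell2.rep_eq scaleR_ell2.rep_eq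
        norm_restrict_ell2)
  then show ?thesis
    by (simp add: ell2_proj_def bounded_linear_Blinfun_apply)
qed

text \<open>
  A group \<open>\<Gamma>\<close> may have a carrier that is smaller than its type, so \<open>B(\<ell>\<^sup>2(S))\<close> for a set \<open>S\<close> is
  represented by the corner \<open>p B(\<ell>\<^sup>2('a)) p\<close> with \<open>p = ell2_proj S\<close>: operators on \<open>\<ell>\<^sup>2(S)\<close> are extended
  by zero on the orthogonal complement. In particular its unit is \<open>ell2_proj S\<close>. The elements of the
  type \<^typ>\<open>'a ell2_op\<close> are only real-linear, so complex linearity is required separately; the real
  and complex operator norms agree.
\<close>

definition bounded_ops :: "'a set \<Rightarrow> 'a ell2_op set" where
  "bounded_ops S =
    {T. (\<forall>c f. blinfun_apply T (c *\<^sub>C f) = c *\<^sub>C blinfun_apply T f) \<and>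
        ell2_proj S o\<^sub>L T = T \<and> T o\<^sub>L ell2_proj S = T}"

definition commutant :: "'a set \<Rightarrow> 'a ell2_op set \<Rightarrow> 'a ell2_op set" where
  "commutant S A = {T \<in> bounded_ops S. \<forall>a\<in>A. T o\<^sub>L a = a o\<^sub>L T}"

definition positive_op :: "'a ell2_op \<Rightarrow> bool" where
  "positive_op T \<longleftrightarrow> (\<forall>f. cinner f (blinfun_apply T f) \<in> \<real>\<^sub>\<ge>\<^sub>0)"

definition von_neumann_algebra :: "'a set \<Rightarrow> 'a ell2_op set \<Rightarrow> bool" where
  "von_neumann_algebra S N \<longleftrightarrow>
    N \<subseteq> bounded_ops S \<and> ell2_proj S \<in> N \<and>
    (\<forall>x\<in>N. \<forall>y\<in>N. x + y \<in> N \<and> x o\<^sub>L y \<in> N) \<and>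
    (\<forall>x\<in>N. \<forall>c. scaleC_op c x \<in> N) \<and>
    (\<forall>x\<in>N. adj x \<in> N) \<and>
    commutant S (commutant S N) = N"

section \<open>The group von Neumann algebra\<close>

text \<open>
  The left regular representation, \<open>(\<lambda>\<^sub>s f)(t) = f(s\<^sup>-\<^sup>1 t)\<close>, so \<open>\<lambda>\<^sub>s \<delta>\<^sub>t = \<delta>\<^sub>s\<^sub>t\<close>. Both \<^const>\<open>Abs_ell2\<close> and
  \<^const>\<open>Blinfun\<close> are applied within their domains when \<open>\<Gamma>\<close> is a group and \<open>s\<close> is in its carrier:
  see the lemmas that follow.
\<close>

definition left_reg :: "('a, 'b) monoid_scheme \<Rightarrow> 'a \<Rightarrow> 'a ell2_op" where
  "left_reg \<Gamma> s = Blinfun (\<lambda>f. Abs_ell2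
     (\<lambda>t. if t \<in> carrier \<Gamma> then coord f (inv\<^bsub>\<Gamma>\<^esub> s \<otimes>\<^bsub>\<Gamma>\<^esub> t) else 0))"

lemma left_translate_summable:
  assumes "group \<Gamma>" "s \<in> carrier \<Gamma>"
  shows "(\<lambda>t. (cmod (if t \<in> carrier \<Gamma> then coord f (inv\<^bsub>\<Gamma>\<^esub> s \<otimes>\<^bsub>\<Gamma>\<^esub> t) else 0))\<^sup>2) summable_on UNIV"
    and "(\<Sum>\<^sub>\<infinity>t. (cmod (if t \<in> carrier \<Gamma> then coord f (inv\<^bsub>\<Gamma>\<^esub> s \<otimes>\<^bsub>\<Gamma>\<^esub> t) else 0))\<^sup>2)
          \<le> (\<Sum>\<^sub>\<infinity>t. (cmod (coord f t))\<^sup>2)"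
proof -
  interpret group \<Gamma> by fact
  let ?m = "\<lambda>t. inv\<^bsub>\<Gamma>\<^esub> s \<otimes>\<^bsub>\<Gamma>\<^esub> t"
  let ?F = "\<lambda>t. (cmod (if t \<in> carrier \<Gamma> then coord f (?m t) else 0))\<^sup>2"
  let ?c = "\<lambda>t. (cmod (coord f t))\<^sup>2"
  have inj: "inj_on ?m (carrier \<Gamma>)"
    using assms(2) by (auto simp: inj_on_def)
  have sub: "?c summable_on (?m ` carrier \<Gamma>)"
    by (rule summable_on_subset_banach[OF coord_summable]) simp
  then have S: "(?c \<circ> ?m) summable_on carrier \<Gamma>"
    using summable_on_reindex[OF inj, of ?c] by blast
  show "?F summable_on UNIV"
    by (rule summable_on_cong_neutral[THEN iffD1, OF _ _ _ S]) auto
  have "infsum ?F UNIV = infsum (?c \<circ> ?m) (carrier \<Gamma>)"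
    by (rule infsum_cong_neutral) auto
  also have "\<dots> = infsum ?c (?m ` carrier \<Gamma>)"
    by (simp add: infsum_reindex[OF inj])
  also have "\<dots> \<le> infsum ?c UNIV"
    by (rule infsum_mono_neutral) (use sub coord_summable in auto)
  finally show "infsum ?F UNIV \<le> infsum ?c UNIV" .
qed

lemma coord_left_reg:
  assumes "group \<Gamma>" "s \<in> carrier \<Gamma>"
  shows "coord (blinfun_apply (left_reg \<Gamma> s) f) t =
           (if t \<in> carrier \<Gamma> then coord f (inv\<^bsub>\<Gamma>\<^esub> s \<otimes>\<^bsub>\<Gamma>\<^esub> t) else 0)"
proof -
  let ?T = "\<lambda>f. Abs_ell2 (\<lambda>t. if t \<in> carrier \<Gamma> then coord f (inv\<^bsub>\<Gamma>\<^esub> s \<otimes>\<^bsub>\<Gamma>\<^esub> t) else 0)"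
  have coord_T: "coord (?T f) = (\<lambda>t. if t \<in> carrier \<Gamma> then coord f (inv\<^bsub>\<Gamma>\<^esub> s \<otimes>\<^bsub>\<Gamma>\<^esub> t) else 0)" for f
    by (rule Abs_ell2_inverse) (use left_translate_summable(1)[OF assms] in blast)
  have "bounded_linear ?T"
  proof (rule bounded_linear_intro[where K = 1])
    show "norm (?T f) \<le> norm f * 1" for f
      unfolding norm_ell2_infsum coord_T
      using left_translate_summable(2)[OF assms, of f] by simp
  qed (auto intro!: coord_eqI simp: coord_T plus_ell2.rep_eq scaleR_ell2.rep_eq)
  then show ?thesis
    by (simp add: left_reg_def bounded_linear_Blinfun_apply coord_T)
qed

lemma left_reg_ket:
  assumes "group \<Gamma>" "s \<in> carrier \<Gamma>" "t \<in> carrier \<Gamma>"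
  shows "blinfun_apply (left_reg \<Gamma> s) (ket t) = ket (s \<otimes>\<^bsub>\<Gamma>\<^esub> t)"
proof -
  interpret group \<Gamma> by fact
  show ?thesis
    using assms by (intro coord_eqI) (auto simp: coord_left_reg ket.rep_eq inv_solve_left')
qed

definition subgroup_vNa :: "('a, 'b) monoid_scheme \<Rightarrow> 'a set \<Rightarrow> 'a ell2_op set" where
  "subgroup_vNa \<Gamma> H =
    commutant (carrier \<Gamma>) (commutant (carrier \<Gamma>) (left_reg \<Gamma> ` H))"

abbreviation group_vNa :: "('a, 'b) monoid_scheme \<Rightarrow> 'a ell2_op set" where
  "group_vNa \<Gamma> \<equiv> subgroup_vNa \<Gamma> (carrier \<Gamma>)"

definition center_vNa :: "('a, 'b) monoid_scheme \<Rightarrow> 'a ell2_op set" where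
  "center_vNa \<Gamma> = group_vNa \<Gamma> \<inter> commutant (carrier \<Gamma>) (group_vNa \<Gamma>)"

definition vN_trace :: "('a, 'b) monoid_scheme \<Rightarrow> 'a ell2_op \<Rightarrow> complex" where
  "vN_trace \<Gamma> x = cinner (ket \<one>\<^bsub>\<Gamma>\<^esub>) (blinfun_apply x (ket \<one>\<^bsub>\<Gamma>\<^esub>))"

definition norm2 :: "('a, 'b) monoid_scheme \<Rightarrow> 'a ell2_op \<Rightarrow> real" where
  "norm2 \<Gamma> x = sqrt (Re (vN_trace \<Gamma> (adj x o\<^sub>L x)))"

definition trace_preserving_automorphism ::
  "('a, 'b) monoid_scheme \<Rightarrow> ('a ell2_op \<Rightarrow> 'a ell2_op) \<Rightarrow> bool" where
  "trace_preserving_automorphism \<Gamma> \<alpha> \<longleftrightarrow>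
    bij_betw \<alpha> (group_vNa \<Gamma>) (group_vNa \<Gamma>) \<and>
    (\<forall>x\<in>group_vNa \<Gamma>. \<forall>y\<in>group_vNa \<Gamma>. \<alpha> (x + y) = \<alpha> x + \<alpha> y \<and> \<alpha> (x o\<^sub>L y) = \<alpha> x o\<^sub>L \<alpha> y) \<and>
    (\<forall>x\<in>group_vNa \<Gamma>. \<forall>c. \<alpha> (scaleC_op c x) = scaleC_op c (\<alpha> x)) \<and>
    (\<forall>x\<in>group_vNa \<Gamma>. \<alpha> (adj x) = adj (\<alpha> x)) \<and>
    (\<forall>x\<in>group_vNa \<Gamma>. vN_trace \<Gamma> (\<alpha> x) = vN_trace \<Gamma> x)"

text \<open>
  The extension of \<open>\<phi> \<in> Aut(\<Gamma>)\<close> to \<open>L(\<Gamma>)\<close>; extensionality (on \<open>L(\<Gamma>)\<close>) makes it unique as a function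
  on the whole type.
\<close>

definition vNa_extension ::
  "('a, 'b) monoid_scheme \<Rightarrow> ('a \<Rightarrow> 'a) \<Rightarrow> 'a ell2_op \<Rightarrow> 'a ell2_op" where
  "vNa_extension \<Gamma> \<phi> = (THE \<alpha>. \<alpha> \<in> extensional (group_vNa \<Gamma>) \<and>
     trace_preserving_automorphism \<Gamma> \<alpha> \<and>
     (\<forall>s\<in>carrier \<Gamma>. \<alpha> (left_reg \<Gamma> s) = left_reg \<Gamma> (\<phi> s)))"

definition fixed_vNa :: "('a, 'b) monoid_scheme \<Rightarrow> ('a \<Rightarrow> 'a) set \<Rightarrow> 'a ell2_op set" where
  "fixed_vNa \<Gamma> G = {x \<in> group_vNa \<Gamma>. \<forall>\<phi>\<in>G. vNa_extension \<Gamma> \<phi> x = x}"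

section \<open>Tracial ultrapowers\<close>

definition free_ultrafilter :: "nat filter \<Rightarrow> bool" where
  "free_ultrafilter \<omega> \<longleftrightarrow>
    \<omega> \<noteq> bot \<and>
    (\<forall>P. eventually P \<omega> \<or> eventually (\<lambda>n. \<not> P n) \<omega>) \<and>
    (\<forall>m. eventually (\<lambda>n. n \<noteq> m) \<omega>)"

definition bounded_sequences :: "('a, 'b) monoid_scheme \<Rightarrow> 'a ell2_op set \<Rightarrow> (nat \<Rightarrow> 'a ell2_op) ring" where
  "bounded_sequences \<Gamma> M =
    \<lparr>carrier = {x. range x \<subseteq> M \<and> bounded (range x)},
     mult = (\<lambda>x y n. x n o\<^sub>L y n),
     one = (\<lambda>_. ell2_proj (carrier \<Gamma>)),
     zero = (\<lambda>_. 0),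
     add = (\<lambda>x y n. x n + y n)\<rparr>"

definition null_sequences ::
  "('a, 'b) monoid_scheme \<Rightarrow> nat filter \<Rightarrow> (nat \<Rightarrow> 'a ell2_op) set" where
  "null_sequences \<Gamma> \<omega> =
    {x \<in> carrier (bounded_sequences \<Gamma> (group_vNa \<Gamma>)). ((\<lambda>n. norm2 \<Gamma> (x n)) \<longlongrightarrow> 0) \<omega>}"

definition ultrapower ::
  "('a, 'b) monoid_scheme \<Rightarrow> nat filter \<Rightarrow> (nat \<Rightarrow> 'a ell2_op) set ring" where
  "ultrapower \<Gamma> \<omega> = bounded_sequences \<Gamma> (group_vNa \<Gamma>) Quot null_sequences \<Gamma> \<omega>"

definition ultra_class ::
  "('a, 'b) monoid_scheme \<Rightarrow> nat filter \<Rightarrow> (nat \<Rightarrow> 'a ell2_op) \<Rightarrow> (nat \<Rightarrow> 'a ell2_op) set" where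
  "ultra_class \<Gamma> \<omega> x = null_sequences \<Gamma> \<omega> +>\<^bsub>bounded_sequences \<Gamma> (group_vNa \<Gamma>)\<^esub> x"

text \<open>\<open>L(\<Gamma>)' \<inter> L(\<Gamma>)\<^sup>\<omega>\<close>\<close>

definition commutant_in_ultrapower ::
  "('a, 'b) monoid_scheme \<Rightarrow> nat filter \<Rightarrow> (nat \<Rightarrow> 'a ell2_op) set set" where
  "commutant_in_ultrapower \<Gamma> \<omega> =
    {X \<in> carrier (ultrapower \<Gamma> \<omega>). \<forall>a\<in>group_vNa \<Gamma>.
       X \<otimes>\<^bsub>ultrapower \<Gamma> \<omega>\<^esub> ultra_class \<Gamma> \<omega> (\<lambda>_. a) = ultra_class \<Gamma> \<omega> (\<lambda>_. a) \<otimes>\<^bsub>ultrapower \<Gamma> \<omega>\<^esub> X}"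

text \<open>\<open>Z(L(\<Gamma>))\<^sup>\<omega>\<close>, with its canonical embedding into \<open>L(\<Gamma>)\<^sup>\<omega>\<close>\<close>

definition ultrapower_of_center ::
  "('a, 'b) monoid_scheme \<Rightarrow> nat filter \<Rightarrow> (nat \<Rightarrow> 'a ell2_op) set set" where
  "ultrapower_of_center \<Gamma> \<omega> =
    ultra_class \<Gamma> \<omega> ` carrier (bounded_sequences \<Gamma> (center_vNa \<Gamma>))"

section \<open>The space of von Neumann subalgebras\<close>

definition Sub_vNa :: "('a, 'b) monoid_scheme \<Rightarrow> 'a ell2_op set set" where
  "Sub_vNa \<Gamma> = {N. N \<subseteq> group_vNa \<Gamma> \<and> von_neumann_algebra (carrier \<Gamma>) N}"

definition is_cond_exp ::
  "('a, 'b) monoid_scheme \<Rightarrow> 'a ell2_op set \<Rightarrow> ('a ell2_op \<Rightarrow> 'a ell2_op) \<Rightarrow> bool" where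
  "is_cond_exp \<Gamma> N E \<longleftrightarrow>
    E ` group_vNa \<Gamma> \<subseteq> N \<and>
    (\<forall>x\<in>group_vNa \<Gamma>. \<forall>y\<in>group_vNa \<Gamma>. E (x + y) = E x + E y) \<and>
    (\<forall>x\<in>group_vNa \<Gamma>. \<forall>c. E (scaleC_op c x) = scaleC_op c (E x)) \<and>
    (\<forall>x\<in>group_vNa \<Gamma>. positive_op x \<longrightarrow> positive_op (E x)) \<and>
    (\<forall>x\<in>N. E x = x) \<and>
    (\<forall>x\<in>group_vNa \<Gamma>. \<forall>a\<in>N. \<forall>b\<in>N. E (a o\<^sub>L x o\<^sub>L b) = a o\<^sub>L E x o\<^sub>L b) \<and>
    (\<forall>x\<in>group_vNa \<Gamma>. vN_trace \<Gamma> (E x) = vN_trace \<Gamma> x)"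

definition cond_exp ::
  "('a, 'b) monoid_scheme \<Rightarrow> 'a ell2_op set \<Rightarrow> 'a ell2_op \<Rightarrow> 'a ell2_op" where
  "cond_exp \<Gamma> N = (THE E. E \<in> extensional (group_vNa \<Gamma>) \<and> is_cond_exp \<Gamma> N E)"

text \<open>
  The Effros-Marechal topology. Here \<open>L\<^sup>2(L(\<Gamma>), \<tau>)\<close> is identified with \<open>\<ell>\<^sup>2(\<Gamma>)\<close> through
  \<open>x \<mapsto> x \<delta>\<^sub>1\<close>, so that the \<open>L\<^sup>2\<close>-vector of \<open>E\<^sub>N(x)\<close> is \<open>E\<^sub>N(x) \<delta>\<^sub>1\<close>.
\<close>

definition EM_topology :: "('a, 'b) monoid_scheme \<Rightarrow> 'a ell2_op set topology" where
  "EM_topology \<Gamma> = topology_generated_by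
    {{N \<in> Sub_vNa \<Gamma>. blinfun_apply (cond_exp \<Gamma> N x) (ket \<one>\<^bsub>\<Gamma>\<^esub>) \<in> U} | x U.
       x \<in> group_vNa \<Gamma> \<and> open U}"

definition conj_vNa :: "('a, 'b) monoid_scheme \<Rightarrow> 'a \<Rightarrow> 'a ell2_op set \<Rightarrow> 'a ell2_op set" where
  "conj_vNa \<Gamma> s N = (\<lambda>x. left_reg \<Gamma> s o\<^sub>L x o\<^sub>L adj (left_reg \<Gamma> s)) ` N"

definition minimal_closed_invariant ::
  "'p topology \<Rightarrow> 's set \<Rightarrow> ('s \<Rightarrow> 'p \<Rightarrow> 'p) \<Rightarrow> 'p set \<Rightarrow> bool" where
  "minimal_closed_invariant T S act Y \<longleftrightarrow>
    (let P = (\<lambda>Z. Z \<noteq> {} \<and> closedin T Z \<and> (\<forall>s\<in>S. \<forall>z\<in>Z. act s z \<in> Z))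
     in P Y \<and> (\<forall>Z. Z \<subseteq> Y \<and> P Z \<longrightarrow> Z = Y))"

definition URA :: "('a, 'b) monoid_scheme \<Rightarrow> 'a ell2_op set set \<Rightarrow> bool" where
  "URA \<Gamma> = minimal_closed_invariant (EM_topology \<Gamma>) (carrier \<Gamma>) (conj_vNa \<Gamma>)"

definition chabauty_topology :: "('a, 'b) monoid_scheme \<Rightarrow> 'a set topology" where
  "chabauty_topology \<Gamma> = pullback_topology {H. subgroup H \<Gamma>} (\<lambda>H. \<lambda>s\<in>carrier \<Gamma>. s \<in> H)
     (product_topology (\<lambda>_. discrete_topology (UNIV :: bool set)) (carrier \<Gamma>))"

definition URS :: "('a, 'b) monoid_scheme \<Rightarrow> 'a set set \<Rightarrow> bool" where
  "URS \<Gamma> = minimal_closed_invariant (chabauty_topology \<Gamma>) (carrier \<Gamma>)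
     (\<lambda>s H. s <#\<^bsub>\<Gamma>\<^esub> H #>\<^bsub>\<Gamma>\<^esub> inv\<^bsub>\<Gamma>\<^esub> s)"

definition discrete_URA :: "('a, 'b) monoid_scheme \<Rightarrow> 'a ell2_op set set \<Rightarrow> bool" where
  "discrete_URA \<Gamma> U \<longleftrightarrow> URA \<Gamma> U \<and> subtopology (EM_topology \<Gamma>) U = discrete_topology U"

definition exotic_URA :: "('a, 'b) monoid_scheme \<Rightarrow> 'a ell2_op set set \<Rightarrow> bool" where
  "exotic_URA \<Gamma> U \<longleftrightarrow> URA \<Gamma> U \<and> \<not> (\<exists>Y. URS \<Gamma> Y \<and> U = {subgroup_vNa \<Gamma> H | H. H \<in> Y})"

definition icc :: "('a, 'b) monoid_scheme \<Rightarrow> bool" where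
  "icc \<Gamma> \<longleftrightarrow> carrier \<Gamma> \<noteq> {\<one>\<^bsub>\<Gamma>\<^esub>} \<and>
    (\<forall>s\<in>carrier \<Gamma> - {\<one>\<^bsub>\<Gamma>\<^esub>}. infinite {t \<otimes>\<^bsub>\<Gamma>\<^esub> s \<otimes>\<^bsub>\<Gamma>\<^esub> inv\<^bsub>\<Gamma>\<^esub> t | t. t \<in> carrier \<Gamma>})"

end

theory Submission
  imports Defs
begin

text \<open>
  Write \<open>N s = \<lambda>\<^sub>s L(\<Gamma>)\<^sup>G \<lambda>\<^sub>s\<^sup>*\<close>. Since \<open>Ad(\<lambda>\<^sub>s)\<close> extends the inner automorphism \<open>Inn(s)\<close>, this is the fixed-point
  algebra of the finite group \<open>Inn(s) G Inn(s)\<^sup>-\<^sup>1\<close> (\<open>conj_fixed\<close>), and the conditional expectation onto it is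
  the average over that group (\<open>cond_exp_fixed\<close>). Thus \<open>E(\<lambda>\<^sub>t)\<close> is an average of group elements
  \<open>Inn(s) \<phi> Inn(s)\<^sup>-\<^sup>1 (t)\<close>, each with coefficient at least \<open>1/\<bar>G\<bar>\<close>: convergence in the Effros-Marechal
  topology can only happen if these group elements stay in finite sets. This turns the topological
  question about the orbit into a combinatorial one about \<open>\<Gamma>\<close>.

  The hypothesis on the ultrapower enters once, through a consequence for \<open>\<Gamma>\<close>: there is a finite set \<open>F\<close>
  whose centralizer is the centre of \<open>\<Gamma>\<close> (\<open>ex_finite_set_with_central_centralizer\<close>). Otherwise non-central
  elements \<open>g\<^sub>n\<close> that commute with larger and larger parts of \<open>\<Gamma>\<close> would give a central sequence of \<open>L(\<Gamma>)\<close>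
  that stays away from \<open>Z(L(\<Gamma>))\<close>. As \<open>Inn(s) \<phi> Inn(s)\<^sup>-\<^sup>1 = Inn(s \<phi>(s)\<^sup>-\<^sup>1) \<phi>\<close>, the values of these conjugates on \<open>F\<close>
  determine them completely (\<open>conj_aut_determined\<close>). Hence every subalgebra has a neighbourhood that
  meets the orbit in a finite set (\<open>ex_neighbourhood_meeting_orbit_finitely\<close>), and since the topology is T1
  the orbit is closed and discrete. A single orbit is minimal as an invariant set.

  The orbit is exotic because \<open>L(\<Gamma>)\<^sup>G = L(H)\<close> would make \<open>G\<close> fix \<open>H\<close> pointwise, while the support of the
  averaged \<open>\<lambda>\<^sub>t\<close>, the \<open>G\<close>-orbit of \<open>t\<close>, would have to lie in \<open>H\<close> (\<open>fixed_ne_subgroup_vNa\<close>). If \<open>\<Gamma>\<close> is i.c.c. and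
  the orbit were finite, the same finiteness argument shows that \<open>s \<phi>(s)\<^sup>-\<^sup>1\<close> takes finitely many values,
  and \<open>t\<^sup>-\<^sup>1 \<phi>(t)\<close> would have a finite conjugacy class (\<open>infinite_orbit\<close>).

  Closedness of the orbit and the T1 property require the trace-preserving conditional expectation onto
  an arbitrary von Neumann subalgebra \<open>P\<close>, because \<^const>\<open>cond_exp\<close> is a definite description. Its value at
  \<open>x\<close> is left convolution by \<open>e x \<delta>\<close>, with \<open>e\<close> the projection onto the closure of \<open>P \<delta>\<close>. Boundedness and
  positivity rest on two facts: \<open>e L(\<Gamma>) e\<close> and \<open>e R(\<Gamma>) e\<close> commute (\<open>compressions_commute\<close>), and a product of
  commuting positive operators is positive (\<open>positive_op_compose\<close>). That the result belongs to \<open>L(\<Gamma>)\<close> is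
  the commutation theorem \<open>group_vNa_eq_commutant_R\<close>.
\<close>

section \<open>The geometry of \<open>\<ell>\<^sup>2\<close>\<close>

lemma coord_zero [simp]: "coord 0 x = 0"
  by (simp add: zero_ell2.rep_eq)

lemma coord_add [simp]: "coord (f + g) x = coord f x + coord g x"
  by (simp add: plus_ell2.rep_eq)

lemma coord_uminus [simp]: "coord (- f) x = - coord f x"
  by (simp add: uminus_ell2.rep_eq)

lemma coord_diff [simp]: "coord (f - g) x = coord f x - coord g x"
  using coord_add[of f "- g" x] by simp

lemma coord_scaleR [simp]: "coord (r *\<^sub>R f) x = complex_of_real r * coord f x"
  by (simp add: scaleR_ell2.rep_eq)

lemma coord_scaleC [simp]: "coord (c *\<^sub>C f) x = c * coord f x"
  by (simp add: scaleC.rep_eq)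

lemma coord_ket: "coord (ket s) t = (if t = s then 1 else 0)"
  by (simp add: ket.rep_eq)

lemma coord_restrict [simp]: "coord (restrict_ell2 S f) x = (if x \<in> S then coord f x else 0)"
  by (simp add: restrict_ell2.rep_eq)

lemma coord_sum [simp]: "coord (sum f A) x = (\<Sum>i\<in>A. coord (f i) x)"
  by (induction A rule: infinite_finite_induct) auto

lemma scaleC_simps [simp]:
  "c *\<^sub>C (0::'a ell2) = 0" "0 *\<^sub>C f = 0" "1 *\<^sub>C f = f" "a *\<^sub>C b *\<^sub>C f = (a * b) *\<^sub>C f"
  by (auto intro!: coord_eqI)

lemma scaleC_add_right: "c *\<^sub>C (f + g) = c *\<^sub>C f + c *\<^sub>C g"
  and scaleC_diff_right: "c *\<^sub>C (f - g) = c *\<^sub>C f - c *\<^sub>C g"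
  and scaleC_minus_one: "(-1) *\<^sub>C f = - f"
  and scaleR_scaleC: "r *\<^sub>R f = complex_of_real r *\<^sub>C f"
  by (auto intro!: coord_eqI simp: algebra_simps)

lemma scaleC_sum_right: "c *\<^sub>C (sum f A) = (\<Sum>i\<in>A. c *\<^sub>C f i)"
  by (auto intro!: coord_eqI simp: sum_distrib_left)

lemma bounded_linear_scaleC: "bounded_linear ((*\<^sub>C) c)"
  using bounded_linear_scaleC_comp[OF bounded_linear_ident] .

lemma cinner_add_right: "cinner h (f + g) = cinner h f + cinner h g"
  by (subst (1 2 3) cinner_commute) (simp add: cinner_add_left)

lemma cinner_scaleC_right: "cinner f (c *\<^sub>C g) = c * cinner f g"
proof -
  have "cinner f (c *\<^sub>C g) = (\<Sum>\<^sub>\<infinity>x. c * (cnj (coord f x) * coord g x))"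
    unfolding cinner_def by (intro infsum_cong) (simp add: algebra_simps)
  then show ?thesis
    unfolding cinner_def by (simp add: infsum_cmult_right')
qed

lemma cinner_scaleC_left: "cinner (c *\<^sub>C f) g = cnj c * cinner f g"
  by (subst (1 2) cinner_commute) (simp add: cinner_scaleC_right)

lemma cinner_uminus_right [simp]: "cinner f (- g) = - cinner f g"
  using cinner_scaleC_right[of f "-1" g] by (simp add: scaleC_minus_one)

lemma cinner_uminus_left [simp]: "cinner (- f) g = - cinner f g"
  using cinner_scaleC_left[of "-1" f g] by (simp add: scaleC_minus_one)

lemma cinner_diff_right: "cinner h (f - g) = cinner h f - cinner h g"
  using cinner_add_right[of h f "- g"] by simp

lemma cinner_diff_left: "cinner (f - g) h = cinner f h - cinner g h"
  using cinner_add_left[of f "- g" h] by simp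

lemma cinner_scaleR_right: "cinner f (r *\<^sub>R g) = complex_of_real r * cinner f g"
  by (simp add: scaleR_scaleC cinner_scaleC_right)

lemma cinner_zero [simp]: "cinner f 0 = 0" "cinner 0 f = 0"
  by (simp_all add: cinner_def)

lemma cinner_sum_right: "cinner f (sum g A) = (\<Sum>i\<in>A. cinner f (g i))"
  by (induction A rule: infinite_finite_induct) (auto simp: cinner_add_right)

lemma cinner_sum_left: "cinner (sum g A) f = (\<Sum>i\<in>A. cinner (g i) f)"
  by (induction A rule: infinite_finite_induct) (auto simp: cinner_add_left)

lemma cinner_self_norm: "cinner f f = complex_of_real ((norm f)\<^sup>2)"
proof -
  have "Im (cinner f f) = 0"
    by (simp add: cinner_self)
  moreover have "Re (cinner f f) = (norm f)\<^sup>2"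
    by (simp add: power2_norm_eq_inner inner_ell2_def)
  ultimately show ?thesis
    by (simp add: complex_eq_iff)
qed

lemma cmod_cinner_le: "cmod (cinner f g) \<le> norm f * norm g"
proof (cases "cinner f g = 0")
  case False
  let ?z = "cinner f g"
  let ?u = "cnj ?z / cmod ?z"
  have "cmod ?u = 1"
    using False by (simp add: norm_divide)
  have "?u * ?z = cmod ?z"
    using False complex_norm_square[of ?z] by (simp add: field_simps power2_eq_square)
  then have "cmod ?z = Re (cinner f (?u *\<^sub>C g))"
    by (metis Re_complex_of_real cinner_scaleC_right)
  also have "\<dots> = inner f (?u *\<^sub>C g)"
    by (simp add: inner_ell2_def)
  also have "\<dots> \<le> norm f * norm (?u *\<^sub>C g)"
    by (rule norm_cauchy_schwarz)
  finally show ?thesis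
    using \<open>cmod ?u = 1\<close> by (simp add: norm_scaleC)
qed simp

lemma bounded_linear_cinner_right: "bounded_linear (cinner f)"
  by (rule bounded_linear_intro[where K = "norm f"])
    (auto simp: cinner_add_right cinner_scaleR_right scaleR_conv_of_real
      cmod_cinner_le mult.commute[of "norm _" "norm f"])

lemma bounded_linear_cinner_left: "bounded_linear (\<lambda>f. cinner f g)"
  by (rule bounded_linear_intro[where K = "norm g"])
    (auto simp: cinner_add_left cinner_scaleR_left cmod_cinner_le scaleR_conv_of_real)

lemmas tendsto_cinner_right = bounded_linear.tendsto[OF bounded_linear_cinner_right]
lemmas tendsto_cinner_left = bounded_linear.tendsto[OF bounded_linear_cinner_left]

lemma tendsto_cinner:
  fixes f g :: "'b \<Rightarrow> 'a ell2"
  assumes "(f \<longlongrightarrow> a) F" "(g \<longlongrightarrow> b) F"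
  shows "((\<lambda>x. cinner (f x) (g x)) \<longlongrightarrow> cinner a b) F"
proof -
  have Re: "Re (cinner h k) = inner h k" and Im: "Im (cinner h k) = inner (\<i> *\<^sub>C h) k" for h k :: "'a ell2"
    by (simp_all add: inner_ell2_def cinner_scaleC_left)
  show ?thesis
    unfolding tendsto_complex_iff Re Im
    by (intro conjI tendsto_inner bounded_linear.tendsto[OF bounded_linear_scaleC] assms)
qed

lemma cinner_ket_left: "cinner (ket s) f = coord f s"
proof -
  have "cinner (ket s) f = infsum (\<lambda>x. cnj (coord (ket s) x) * coord f x) {s}"
    unfolding cinner_def by (rule infsum_cong_neutral) (auto simp: coord_ket)
  then show ?thesis
    by (simp add: coord_ket)
qed

lemma cinner_ket_right: "cinner f (ket s) = cnj (coord f s)"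
  by (subst cinner_commute) (simp add: cinner_ket_left)

lemma norm_ket [simp]: "norm (ket s) = 1"
  using cinner_self_norm[of "ket s"]
  by (simp add: cinner_ket_left coord_ket abs_square_eq_1 flip: of_real_power)

lemma cmod_coord_le: "cmod (coord f s) \<le> norm f"
  using cmod_cinner_le[of "ket s" f] by (simp add: cinner_ket_left)

lemma norm_square_infsum: "(norm f)\<^sup>2 = (\<Sum>\<^sub>\<infinity>x. (cmod (coord f x))\<^sup>2)"
  unfolding norm_ell2_infsum by (simp add: infsum_nonneg)

lemma sum_coord_le_norm: "finite A \<Longrightarrow> (\<Sum>x\<in>A. (cmod (coord f x))\<^sup>2) \<le> (norm f)\<^sup>2"
  unfolding norm_square_infsum using coord_summable
  by (intro finite_sum_le_infsum) auto

text \<open>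
  This is where analysis turns into finiteness: a vector that carries a fixed weight at certain group
  elements leaves only finitely many candidates for them.
\<close>

lemma finite_large_coords:
  assumes "e > 0" shows "finite {x. cmod (coord f x) \<ge> e}"
proof (rule ccontr)
  assume inf: "infinite {x. cmod (coord f x) \<ge> e}"
  obtain n :: nat where n: "real n * e\<^sup>2 > (norm f)\<^sup>2"
    using reals_Archimedean3[of "e\<^sup>2"] assms by auto
  obtain A where A: "A \<subseteq> {x. cmod (coord f x) \<ge> e}" "card A = n" "finite A"
    using infinite_arbitrarily_large[OF inf, of n] by auto
  have "real n * e\<^sup>2 = (\<Sum>x\<in>A. e\<^sup>2)"
    using A by simp
  also have "\<dots> \<le> (\<Sum>x\<in>A. (cmod (coord f x))\<^sup>2)"
    using A assms by (intro sum_mono power_mono) auto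
  also have "\<dots> \<le> (norm f)\<^sup>2"
    by (rule sum_coord_le_norm) fact
  finally show False
    using n by simp
qed

text \<open>Bounded finite sections are how vectors given by their coordinates are recognized below.\<close>

lemma coord_Abs_ell2:
  assumes "\<And>A. finite A \<Longrightarrow> (\<Sum>x\<in>A. (cmod (f x))\<^sup>2) \<le> B"
  shows "coord (Abs_ell2 f) = f"
    and "(norm (Abs_ell2 f))\<^sup>2 \<le> B"
proof -
  have S: "(\<lambda>x. (cmod (f x))\<^sup>2) summable_on UNIV"
    by (rule nonneg_bdd_above_summable_on) (use assms in \<open>auto intro!: bdd_aboveI[of _ B]\<close>)
  then show 1: "coord (Abs_ell2 f) = f"
    by (simp add: Abs_ell2_inverse)
  show "(norm (Abs_ell2 f))\<^sup>2 \<le> B"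
    unfolding norm_square_infsum 1 using S assms
    by (intro infsum_le_finite_sums) auto
qed

lemma restrict_ell2_sum_ket:
  "finite A \<Longrightarrow> restrict_ell2 A f = (\<Sum>t\<in>A. coord f t *\<^sub>C ket t)"
  by (intro coord_eqI) (simp add: coord_ket if_distrib cong: if_cong)

text \<open>
  The squared distance is the tail of a convergent series. All density arguments below go through
  this limit along finite sets.
\<close>

lemma tendsto_restrict_ell2:
  "((\<lambda>A. restrict_ell2 A f) \<longlongrightarrow> f) (finite_subsets_at_top UNIV)"
proof -
  let ?c = "\<lambda>x. (cmod (coord f x))\<^sup>2"
  have "(sum ?c \<longlongrightarrow> infsum ?c UNIV) (finite_subsets_at_top UNIV)"
    using infsum_tendsto[OF coord_summable] .
  then have "((\<lambda>A. infsum ?c UNIV - sum ?c A) \<longlongrightarrow> 0) (finite_subsets_at_top UNIV)"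
    using tendsto_diff[OF tendsto_const[of "infsum ?c UNIV"]] by fastforce
  moreover have "\<forall>\<^sub>F A in finite_subsets_at_top UNIV.
      infsum ?c UNIV - sum ?c A = (norm (restrict_ell2 A f - f))\<^sup>2"
  proof (rule eventually_finite_subsets_at_top_weakI)
    fix A :: "'a set" assume "finite A"
    have "(norm (restrict_ell2 A f - f))\<^sup>2 = infsum ?c (UNIV - A)"
      unfolding norm_square_infsum by (rule infsum_cong_neutral) auto
    also have "\<dots> = infsum ?c UNIV - infsum ?c A"
      by (rule infsum_Diff) (auto intro: summable_on_finite[OF \<open>finite A\<close>] coord_summable)
    finally show "infsum ?c UNIV - sum ?c A = (norm (restrict_ell2 A f - f))\<^sup>2"
      using \<open>finite A\<close> by simp
  qed
  ultimately have "((\<lambda>A. (norm (restrict_ell2 A f - f))\<^sup>2) \<longlongrightarrow> 0) (finite_subsets_at_top UNIV)"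
    by (rule Lim_transform_eventually)
  then have "((\<lambda>A. sqrt ((norm (restrict_ell2 A f - f))\<^sup>2)) \<longlongrightarrow> sqrt 0) (finite_subsets_at_top UNIV)"
    by (rule tendsto_real_sqrt)
  then have "((\<lambda>A. norm (restrict_ell2 A f - f)) \<longlongrightarrow> 0) (finite_subsets_at_top UNIV)"
    by (simp only: real_sqrt_abs abs_norm_cancel real_sqrt_zero)
  then have "((\<lambda>A. restrict_ell2 A f - f) \<longlongrightarrow> 0) (finite_subsets_at_top UNIV)"
    by (rule tendsto_norm_zero_cancel)
  then show ?thesis
    by (rule LIM_zero_cancel)
qed

text \<open>
  The limit of a Cauchy sequence is taken coordinatewise; its distance to the sequence is controlled on
  finite sections, where coordinatewise convergence can be used.
\<close>

instance ell2 :: (type) banach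
proof
  fix X :: "nat \<Rightarrow> 'a ell2"
  assume X: "Cauchy X"
  have "Cauchy (\<lambda>n. coord (X n) x)" for x
    using bounded_linear.Cauchy[OF bounded_linear_cinner_right X, of "ket x"]
    by (simp add: cinner_ket_left)
  then have "\<exists>l. (\<lambda>n. coord (X n) x) \<longlonglongrightarrow> l" for x
    by (simp add: Cauchy_convergent_iff convergent_def)
  then obtain l where l: "\<And>x. (\<lambda>n. coord (X n) x) \<longlonglongrightarrow> l x"
    by metis
  have bound: "(\<Sum>x\<in>A. (cmod (coord (X m) x - l x))\<^sup>2) \<le> e\<^sup>2"
    if "finite A" and N: "\<forall>n\<ge>N. \<forall>m\<ge>N. norm (X m - X n) < e" and "m \<ge> N" for A m N e
  proof (rule LIMSEQ_le_const2)
    show "(\<lambda>n. \<Sum>x\<in>A. (cmod (coord (X m) x - coord (X n) x))\<^sup>2)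
        \<longlonglongrightarrow> (\<Sum>x\<in>A. (cmod (coord (X m) x - l x))\<^sup>2)"
      by (intro tendsto_intros l)
    have "(\<Sum>x\<in>A. (cmod (coord (X m) x - coord (X n) x))\<^sup>2) \<le> e\<^sup>2" if "n \<ge> N" for n
    proof -
      have "(norm (X m - X n))\<^sup>2 \<le> e\<^sup>2"
        using N \<open>m \<ge> N\<close> \<open>n \<ge> N\<close> by (intro power_mono) (auto intro: less_imp_le)
      then show ?thesis
        using sum_coord_le_norm[OF \<open>finite A\<close>, of "X m - X n"] by simp
    qed
    then show "\<exists>K. \<forall>n\<ge>K. (\<Sum>x\<in>A. (cmod (coord (X m) x - coord (X n) x))\<^sup>2) \<le> e\<^sup>2"
      by blast
  qed
  obtain N where N: "\<forall>n\<ge>N. \<forall>m\<ge>N. norm (X m - X n) < 1"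
    using X unfolding Cauchy_iff by (metis zero_less_one)
  define d where "d = Abs_ell2 (\<lambda>x. coord (X N) x - l x)"
  have d: "coord d x = coord (X N) x - l x" for x
    unfolding d_def by (subst coord_Abs_ell2[where B = 1]) (use bound[OF _ N] in auto)
  define L where "L = X N - d"
  have L: "coord L = l"
    by (auto simp: L_def d)
  have "X \<longlonglongrightarrow> L"
  proof (rule LIMSEQ_I)
    fix e :: real assume "e > 0"
    then obtain N where N: "\<forall>n\<ge>N. \<forall>m\<ge>N. norm (X m - X n) < e / 2"
      using X unfolding Cauchy_iff by (metis half_gt_zero)
    have "norm (X m - L) < e" if "m \<ge> N" for m
    proof -
      have "(norm (X m - L))\<^sup>2 \<le> (e / 2)\<^sup>2"
        unfolding norm_square_infsum using bound[OF _ N that] coord_summable[of "X m - L"]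
        by (intro infsum_le_finite_sums) (auto simp: L)
      then have "norm (X m - L) \<le> e / 2"
        using \<open>e > 0\<close> by (simp add: power2_le_iff_abs_le)
      then show ?thesis
        using \<open>e > 0\<close> by simp
    qed
    then show "\<exists>N. \<forall>m\<ge>N. norm (X m - L) < e"
      by blast
  qed
  then show "convergent X"
    by (auto simp: convergent_def)
qed

section \<open>Orthogonal projections\<close>

text \<open>The parallelogram law makes a minimizing sequence for the distance Cauchy.\<close>

lemma ex_orthogonal_projection:
  fixes V :: "'v :: {real_inner, complete_space} set"
  assumes V: "subspace V" and "closed V"
  shows "\<exists>v\<in>V. \<forall>w\<in>V. inner (f - v) w = 0"
proof -
  let ?D = "(\<lambda>v. (norm (f - v))\<^sup>2) ` V"
  define d where "d = Inf ?D"
  have "0 \<in> V"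
    using V by (rule subspace_0)
  have bdd: "bdd_below ?D"
    by (auto intro: bdd_belowI[of _ 0])
  have d_le: "d \<le> (norm (f - v))\<^sup>2" if "v \<in> V" for v
    unfolding d_def using bdd that by (auto intro: cInf_lower)
  have "\<exists>v\<in>V. (norm (f - v))\<^sup>2 < d + 1 / real (Suc n)" for n
  proof -
    have "d < d + 1 / real (Suc n)"
      by simp
    then show ?thesis
      unfolding d_def using cInf_less_iff[OF _ bdd] \<open>0 \<in> V\<close> by blast
  qed
  then obtain v where vV: "\<And>n. v n \<in> V" and v: "\<And>n. (norm (f - v n))\<^sup>2 < d + 1 / real (Suc n)"
    by metis
  have close: "(norm (v n - v m))\<^sup>2 \<le> 2 / real (Suc n) + 2 / real (Suc m)" for n m
  proof -
    have "(1/2) *\<^sub>R (v n + v m) \<in> V"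
      using V vV by (simp add: subspace_add subspace_scale)
    then have "4 * d \<le> 4 * (norm (f - (1/2) *\<^sub>R (v n + v m)))\<^sup>2"
      using d_le by simp
    moreover have "(norm (v n - v m))\<^sup>2 + 4 * (norm (f - (1/2) *\<^sub>R (v n + v m)))\<^sup>2
        = 2 * (norm (f - v n))\<^sup>2 + 2 * (norm (f - v m))\<^sup>2"
      unfolding power2_norm_eq_inner by (simp add: inner_simps inner_commute field_simps)
    ultimately show ?thesis
      using v[of n] v[of m] by simp
  qed
  have "Cauchy v"
  proof (rule CauchyI)
    fix e :: real assume "e > 0"
    obtain N where N: "4 / e\<^sup>2 < real (Suc N)"
      using reals_Archimedean2 less_trans by (metis lessI of_nat_less_iff)
    have "norm (v n - v m) < e" if "n \<ge> N" "m \<ge> N" for n m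
    proof -
      have "2 / real (Suc k) < e\<^sup>2 / 2" if "k \<ge> N" for k
      proof -
        have "4 / e\<^sup>2 < real (Suc k)"
          using N that by simp
        then show ?thesis
          using \<open>e > 0\<close> by (simp add: field_simps)
      qed
      from this[OF that(1)] this[OF that(2)] have "(norm (v n - v m))\<^sup>2 < e\<^sup>2"
        using close[of n m] by linarith
      then show ?thesis
        using \<open>e > 0\<close> by (simp add: power2_less_imp_less)
    qed
    then show "\<exists>M. \<forall>m\<ge>M. \<forall>n\<ge>M. norm (v m - v n) < e"
      by blast
  qed
  then obtain l where l: "v \<longlonglongrightarrow> l"
    using Cauchy_convergent_iff convergent_def by blast
  then have "l \<in> V"
    using \<open>closed V\<close> vV closed_sequentially by blast
  have "(norm (f - l))\<^sup>2 \<le> d"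
  proof (rule LIMSEQ_le)
    show "(\<lambda>n. (norm (f - v n))\<^sup>2) \<longlonglongrightarrow> (norm (f - l))\<^sup>2"
      by (intro tendsto_intros l)
    show "(\<lambda>n. d + 1 / real (Suc n)) \<longlonglongrightarrow> d"
      using tendsto_add[OF tendsto_const LIMSEQ_inverse_real_of_nat, of d]
      by (simp add: inverse_eq_divide)
    show "\<exists>N. \<forall>n\<ge>N. (norm (f - v n))\<^sup>2 \<le> d + 1 / real (Suc n)"
      using v less_imp_le by blast
  qed
  have "inner (f - l) w = 0" if "w \<in> V" for w
  proof (cases "w = 0")
    case False
    \<comment> \<open>moving \<open>l\<close> along \<open>w\<close> by the optimal amount must not decrease the distance\<close>
    let ?t = "inner (f - l) w / (norm w)\<^sup>2"
    have "l + ?t *\<^sub>R w \<in> V"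
      using V \<open>l \<in> V\<close> that by (simp add: subspace_add subspace_scale)
    then have "(norm (f - l))\<^sup>2 \<le> (norm ((f - l) - ?t *\<^sub>R w))\<^sup>2"
      using d_le[of "l + ?t *\<^sub>R w"] \<open>(norm (f - l))\<^sup>2 \<le> d\<close> unfolding diff_diff_eq by linarith
    also have "\<dots> = (norm (f - l))\<^sup>2 - 2 * ?t * inner (f - l) w + ?t\<^sup>2 * (norm w)\<^sup>2"
      unfolding power2_norm_eq_inner
      by (simp add: inner_diff_left inner_diff_right inner_commute power2_eq_square)
    also have "\<dots> = (norm (f - l))\<^sup>2 - (inner (f - l) w)\<^sup>2 / (norm w)\<^sup>2"
      using False by (simp add: field_simps power2_eq_square)
    finally have "(inner (f - l) w)\<^sup>2 / (norm w)\<^sup>2 \<le> 0"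
      by simp
    then show ?thesis
      using False by (simp add: divide_le_0_iff)
  qed simp
  then show ?thesis
    using \<open>l \<in> V\<close> by blast
qed

section \<open>Complex-linear operators and their adjoints\<close>

definition clinear :: "'a ell2_op \<Rightarrow> bool" where
  "clinear T \<longleftrightarrow> (\<forall>c f. T (c *\<^sub>C f) = c *\<^sub>C T f)"

lemma clinearD: "clinear T \<Longrightarrow> T (c *\<^sub>C f) = c *\<^sub>C T f"
  by (simp add: clinear_def)

lemma clinear_simps [simp]:
  "clinear 0" "clinear S \<Longrightarrow> clinear T \<Longrightarrow> clinear (S + T)"
  "clinear S \<Longrightarrow> clinear T \<Longrightarrow> clinear (S - T)"
  "clinear S \<Longrightarrow> clinear T \<Longrightarrow> clinear (S o\<^sub>L T)"
  "clinear S \<Longrightarrow> clinear (scaleC_op c S)"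
  "clinear S \<Longrightarrow> clinear (r *\<^sub>R S)"
  "clinear (ell2_proj A)"
  "clinear id_blinfun"
  by (auto simp: clinear_def blinfun.add_left blinfun.diff_left blinfun.scaleR_left
      scaleC_add_right scaleC_diff_right scaleC_op_apply scaleR_scaleC mult.commute ell2_proj_apply
      intro!: coord_eqI)

lemma clinear_sum [simp]: "(\<And>i. i \<in> I \<Longrightarrow> clinear (T i)) \<Longrightarrow> clinear (sum T I)"
  by (induction I rule: infinite_finite_induct) auto

lemma bounded_linear_eq_on_kets:
  assumes "bounded_linear \<phi>" "bounded_linear \<psi>"
    and eq: "\<And>c t. \<phi> (c *\<^sub>C ket t) = \<psi> (c *\<^sub>C ket t)"
  shows "\<phi> f = \<psi> f"
proof (rule tendsto_unique)
  show "((\<lambda>A. \<phi> (restrict_ell2 A f)) \<longlongrightarrow> \<phi> f) (finite_subsets_at_top UNIV)"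
    by (rule bounded_linear.tendsto[OF assms(1) tendsto_restrict_ell2])
  have "((\<lambda>A. \<psi> (restrict_ell2 A f)) \<longlongrightarrow> \<psi> f) (finite_subsets_at_top UNIV)"
    by (rule bounded_linear.tendsto[OF assms(2) tendsto_restrict_ell2])
  moreover have "\<psi> (restrict_ell2 A f) = \<phi> (restrict_ell2 A f)" if "finite A" for A
    using that eq
    by (simp add: restrict_ell2_sum_ket linear_sum[OF bounded_linear.linear] assms(1,2))
  ultimately show "((\<lambda>A. \<phi> (restrict_ell2 A f)) \<longlongrightarrow> \<psi> f) (finite_subsets_at_top UNIV)"
    by (elim Lim_transform_eventually) (auto intro: eventually_finite_subsets_at_top_weakI)
qed simp

lemma op_eq_on_kets:
  fixes S T :: "'a ell2_op"
  assumes "clinear S" "clinear T" "\<And>t. S (ket t) = T (ket t)"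
  shows "S = T"
proof (rule blinfun_eqI)
  show "S f = T f" for f
    by (rule bounded_linear_eq_on_kets)
      (use assms in \<open>auto simp: clinearD blinfun.bounded_linear_right\<close>)
qed

text \<open>
  With \<open>c\<^sub>t = \<langle>v\<^sub>t, g\<rangle>\<close> on a finite set, \<open>\<Sum>\<bar>c\<^sub>t\<bar>\<^sup>2 = \<langle>\<Sum> c\<^sub>t v\<^sub>t, g\<rangle> \<le> B \<parallel>c\<parallel> \<parallel>g\<parallel>\<close>, so the coordinates
  \<open>\<langle>v\<^sub>t, g\<rangle>\<close> are square-summable. Adjoints and operators with prescribed columns are both obtained
  from this.
\<close>

lemma ex_op_of_rows:
  assumes "B \<ge> 0" and "\<And>A c. finite A \<Longrightarrow>
    norm (\<Sum>t\<in>A. c t *\<^sub>C v t) \<le> B * norm (\<Sum>t\<in>A. c t *\<^sub>C ket t)"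
  shows "\<exists>S. clinear S \<and> (\<forall>g t. coord (S g) t = cinner (v t) g)"
proof -
  have bound: "(\<Sum>t\<in>A. (cmod (cinner (v t) g))\<^sup>2) \<le> (B * norm g)\<^sup>2" if "finite A" for A g
  proof -
    let ?c = "\<lambda>t. cinner (v t) g"
    let ?k = "\<Sum>t\<in>A. ?c t *\<^sub>C ket t"
    let ?s = "\<Sum>t\<in>A. (cmod (?c t))\<^sup>2"
    have s: "complex_of_real ?s = (\<Sum>t\<in>A. cnj (?c t) * ?c t)"
      by (simp add: complex_norm_square mult.commute del: of_real_power)
    have "cinner ?k ?k = complex_of_real ?s"
      using that unfolding s
      by (simp add: cinner_sum_left cinner_scaleC_left cinner_ket_left coord_ket if_distrib
          cong: if_cong)
    then have k: "(norm ?k)\<^sup>2 = ?s"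
      unfolding cinner_self_norm of_real_eq_iff .
    have eq: "complex_of_real ?s = cinner (\<Sum>t\<in>A. ?c t *\<^sub>C v t) g"
      unfolding s by (simp add: cinner_sum_left cinner_scaleC_left)
    have "?s = cmod (complex_of_real ?s)"
      unfolding norm_of_real by (simp add: sum_nonneg)
    also have "\<dots> \<le> norm (\<Sum>t\<in>A. ?c t *\<^sub>C v t) * norm g"
      unfolding eq by (rule cmod_cinner_le)
    also have "\<dots> \<le> (B * norm ?k) * norm g"
      using assms(2)[OF that] by (rule mult_right_mono) simp
    also have "\<dots> = norm ?k * (B * norm g)"
      by (simp only: mult_ac)
    finally have "norm ?k * norm ?k \<le> norm ?k * (B * norm g)"
      unfolding k[symmetric] power2_eq_square[of "norm ?k"] .
    then have "norm ?k \<le> B * norm g"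
      using \<open>B \<ge> 0\<close> by (cases "norm ?k = 0") (auto simp: mult_le_cancel_left)
    then show ?thesis
      unfolding k[symmetric] by (intro power_mono) auto
  qed
  define S where "S g = Abs_ell2 (\<lambda>t. cinner (v t) g)" for g
  have S: "coord (S g) t = cinner (v t) g" for g t
    unfolding S_def by (subst coord_Abs_ell2[OF bound]) auto
  have "(norm (S g))\<^sup>2 \<le> (B * norm g)\<^sup>2" for g
    unfolding S_def by (rule coord_Abs_ell2[OF bound])
  then have norm_S: "norm (S g) \<le> norm g * B" for g
    using \<open>B \<ge> 0\<close> by (simp add: power2_le_iff_abs_le mult.commute)
  have "bounded_linear S"
    by (rule bounded_linear_intro[OF _ _ norm_S])
      (auto intro!: coord_eqI simp: S cinner_add_right cinner_scaleR_right)
  then have "Blinfun S g = S g" for g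
    by (simp add: bounded_linear_Blinfun_apply)
  then have "clinear (Blinfun S) \<and> (\<forall>g t. coord (Blinfun S g) t = cinner (v t) g)"
    by (auto simp: clinear_def S cinner_scaleC_right intro!: coord_eqI)
  then show ?thesis
    by blast
qed

lemma ex_adj:
  assumes "clinear T"
  shows "\<exists>S. clinear S \<and> (\<forall>f g. cinner (S f) g = cinner f (T g))"
proof -
  have "norm (\<Sum>t\<in>A. c t *\<^sub>C T (ket t)) \<le> norm T * norm (\<Sum>t\<in>A. c t *\<^sub>C ket t)" for A c
    using norm_blinfun[of T "\<Sum>t\<in>A. c t *\<^sub>C ket t"] assms by (simp add: blinfun.sum_right clinearD)
  then obtain S where S: "clinear S" "\<And>g t. coord (S g) t = cinner (T (ket t)) g"
    using ex_op_of_rows[of "norm T" "\<lambda>t. T (ket t)"] norm_ge_zero by blast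
  have "cinner (S f) g = cinner f (T g)" for f g
  proof (rule bounded_linear_eq_on_kets[of "cinner (S f)" "\<lambda>g. cinner f (T g)"])
    show "bounded_linear (\<lambda>g. cinner f (T g))"
      by (rule bounded_linear_compose[OF bounded_linear_cinner_right blinfun.bounded_linear_right])
    show "cinner (S f) (c *\<^sub>C ket t) = cinner f (T (c *\<^sub>C ket t))" for c t
      using assms cinner_commute[of f "T (ket t)"]
      by (simp add: cinner_scaleC_right clinearD cinner_ket_right S)
  qed (rule bounded_linear_cinner_right)
  with S(1) show ?thesis
    by (intro exI[of _ S]) simp
qed

lemma cinner_left_eqI:
  assumes "\<And>g. cinner f g = cinner f' g" shows "f = f'"
proof (rule coord_eqI)
  show "coord f x = coord f' x" for x
    using assms[of "ket x"] by (simp add: cinner_ket_right)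
qed

lemma adj_eqI:
  fixes S T :: "'a ell2_op"
  assumes "\<And>f g. cinner (S f) g = cinner f (T g)"
  shows "adj T = S"
  unfolding adj_def
proof (rule the_equality)
  show "S' = S" if "\<forall>f g. cinner (S' f) g = cinner f (T g)" for S' :: "'a ell2_op"
    by (rule blinfun_eqI, rule cinner_left_eqI) (simp add: that assms)
qed (use assms in blast)

lemma adj:
  assumes "clinear T"
  shows clinear_adj: "clinear (adj T)"
    and cinner_adj_left: "cinner (adj T f) g = cinner f (T g)"
    and cinner_adj_right: "cinner f (adj T g) = cinner (T f) g"
proof -
  obtain S where S: "clinear S" "\<And>f g. cinner (S f) g = cinner f (T g)"
    using ex_adj[OF assms] by blast
  then have "adj T = S"
    by (intro adj_eqI)
  with S show 1: "clinear (adj T)" "cinner (adj T f) g = cinner f (T g)"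
    by auto
  have "cinner f (adj T g) = cnj (cinner (adj T g) f)"
    by (rule cinner_commute)
  also have "\<dots> = cnj (cinner g (T f))"
    unfolding \<open>adj T = S\<close> S(2) ..
  finally show "cinner f (adj T g) = cinner (T f) g"
    by (simp flip: cinner_commute)
qed

lemma adj_adj: "clinear T \<Longrightarrow> adj (adj T) = T"
  by (rule adj_eqI) (simp add: cinner_adj_right)

lemma adj_compose: "clinear S \<Longrightarrow> clinear T \<Longrightarrow> adj (S o\<^sub>L T) = adj T o\<^sub>L adj S"
  by (rule adj_eqI) (simp add: cinner_adj_left)

lemma adj_add: "clinear S \<Longrightarrow> clinear T \<Longrightarrow> adj (S + T) = adj S + adj T"
  by (rule adj_eqI) (simp add: cinner_adj_left blinfun.add_left cinner_add_left cinner_add_right)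

lemma cinner_restrict: "cinner (restrict_ell2 S f) g = cinner f (restrict_ell2 S g)"
  unfolding cinner_def by (rule infsum_cong) auto

text \<open>
  The adjoint of the operator with rows \<open>v\<^sub>t\<close> has these vectors as columns.
\<close>

lemma ex_op_of_columns:
  assumes "B \<ge> 0" and "\<And>A c. finite A \<Longrightarrow>
    norm (\<Sum>t\<in>A. c t *\<^sub>C v t) \<le> B * norm (\<Sum>t\<in>A. c t *\<^sub>C ket t)"
  shows "\<exists>T. clinear T \<and> (\<forall>t. T (ket t) = v t)"
proof -
  obtain S where S: "clinear S" "\<And>g t. coord (S g) t = cinner (v t) g"
    using ex_op_of_rows[OF assms] by blast
  have "adj S (ket t) = v t" for t
    by (rule cinner_left_eqI) (simp add: cinner_adj_left S cinner_ket_left)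
  with clinear_adj[OF S(1)] show ?thesis
    by (intro exI[of _ "adj S"]) simp
qed

text \<open>
  Orthogonality for the real inner product upgrades to the complex one because \<open>V\<close> is invariant under
  multiplication by \<open>\<i>\<close>.
\<close>

lemma ex_projection_op:
  assumes V: "subspace V" "closed V" and scale: "\<And>c f. f \<in> V \<Longrightarrow> c *\<^sub>C f \<in> V"
  obtains e where "clinear e" "\<And>f. e f \<in> V" "\<And>f w. w \<in> V \<Longrightarrow> cinner w (e f) = cinner w f"
proof -
  have "\<exists>v\<in>V. \<forall>w\<in>V. cinner w v = cinner w f" for f
  proof -
    obtain v where v: "v \<in> V" "\<And>w. w \<in> V \<Longrightarrow> inner (f - v) w = 0"
      using ex_orthogonal_projection[OF V] by blast
    have "cinner (f - v) w = 0" if "w \<in> V" for w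
    proof -
      have "Re (cinner (f - v) w) = 0"
        using v(2)[OF that] by (simp add: inner_ell2_def)
      moreover have "Re (cinner (f - v) (\<i> *\<^sub>C w)) = 0"
        using v(2)[OF scale[OF that]] by (simp add: inner_ell2_def)
      ultimately show ?thesis
        by (simp add: cinner_scaleC_right complex_eq_iff)
    qed
    then have "cinner w v = cinner w f" if "w \<in> V" for w
      using that by (subst (1 2) cinner_commute) (simp add: cinner_diff_left)
    then show ?thesis
      using v(1) by blast
  qed
  then obtain p where p: "\<And>f. p f \<in> V" "\<And>f w. w \<in> V \<Longrightarrow> cinner w (p f) = cinner w f"
    by metis
  have uniq: "v = p f" if "v \<in> V" "\<And>w. w \<in> V \<Longrightarrow> cinner w v = cinner w f" for v f
  proof -
    have "v - p f \<in> V"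
      using V that(1) p(1) by (simp add: subspace_diff)
    then have "cinner (v - p f) (v - p f) = 0"
      using that(2) p(2) by (simp add: cinner_diff_right)
    then show ?thesis
      by (simp add: cinner_self_norm)
  qed
  have p_scale: "p (c *\<^sub>C f) = c *\<^sub>C p f" for c f
    by (rule uniq[symmetric]) (auto simp: p scale cinner_scaleC_right)
  have "bounded_linear p"
  proof (rule bounded_linear_intro[where K = 1])
    show "p (f + g) = p f + p g" for f g
      by (rule uniq[symmetric]) (auto simp: p V subspace_add cinner_add_right)
    show "p (r *\<^sub>R f) = r *\<^sub>R p f" for r f
      by (simp add: scaleR_scaleC p_scale)
    show "norm (p f) \<le> norm f * 1" for f
    proof -
      have eq: "complex_of_real ((norm (p f))\<^sup>2) = cinner (p f) f"
        using p(2)[OF p(1), of f f] unfolding cinner_self_norm .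
      have "norm (p f) * norm (p f) = cmod (complex_of_real ((norm (p f))\<^sup>2))"
        unfolding norm_of_real by (simp add: power2_eq_square)
      also have "\<dots> \<le> norm (p f) * norm f"
        unfolding eq by (rule cmod_cinner_le)
      finally have "norm (p f) * norm (p f) \<le> norm (p f) * norm f" .
      then show ?thesis
        by (cases "norm (p f) = 0") (auto simp: mult_le_cancel_left)
    qed
  qed
  then have "Blinfun p f = p f" for f
    by (simp add: bounded_linear_Blinfun_apply)
  then show thesis
    using p p_scale by (intro that[of "Blinfun p"]) (auto simp: clinear_def)
qed

section \<open>Positive operators\<close>

lemma positive_op_iff: "positive_op T \<longleftrightarrow> (\<forall>f. 0 \<le> Re (cinner f (T f)) \<and> Im (cinner f (T f)) = 0)"
  by (simp add: positive_op_def complex_nonneg_Reals_iff)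

lemma Re_cinner_self: "Re (cinner f f) = (norm f)\<^sup>2"
  unfolding cinner_self_norm Re_complex_of_real ..

text \<open>\<open>\<langle>h, T h\<rangle>\<close> is real; taking \<open>h = f + g\<close> and \<open>h = f + \<i> g\<close> compares the two sides.\<close>

lemma positive_op_selfadjoint:
  assumes "clinear T" "positive_op T"
  shows "cinner (T f) g = cinner f (T g)"
proof -
  have im: "Im (cinner h (T h)) = 0" for h
    using assms(2) by (simp add: positive_op_iff)
  have "Im (cinner f (T g)) + Im (cinner g (T f)) = 0"
    using im[of "f + g"] im[of f] im[of g]
    by (simp add: blinfun.add_right cinner_add_left cinner_add_right)
  moreover have "Re (cinner f (T g)) - Re (cinner g (T f)) = 0"
    using im[of "f + \<i> *\<^sub>C g"] im[of f] im[of g] assms(1)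
    by (simp add: blinfun.add_right cinner_add_left cinner_add_right clinearD cinner_scaleC_left
        cinner_scaleC_right)
  ultimately show ?thesis
    by (subst cinner_commute) (simp add: complex_eq_iff)
qed

text \<open>
  A series argument that replaces square roots. After scaling,
  \<open>0 \<le> w \<le> 1\<close>, and the recursion \<open>w\<^sub>k\<^sub>+\<^sub>1 = w\<^sub>k - w\<^sub>k\<^sup>2\<close> stays between \<open>0\<close> and \<open>1\<close>. Since
  \<open>w = w\<^sub>0\<^sup>2 + \<dots> + w\<^sub>n\<^sub>-\<^sub>1\<^sup>2 + w\<^sub>n\<close>, the series \<open>\<Sum>\<parallel>w\<^sub>k f\<parallel>\<^sup>2\<close> converges, so \<open>w\<^sub>n f \<longlonglongrightarrow> 0\<close>, while
  \<open>\<langle>f, c w f\<rangle> = \<Sum>\<langle>w\<^sub>k f, c w\<^sub>k f\<rangle> + \<langle>f, c w\<^sub>n f\<rangle>\<close>.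
\<close>

lemma positive_op_compose:
  assumes c: "clinear c" "positive_op c" and w: "clinear w" "positive_op w"
    and comm: "\<And>f. c (w f) = w (c f)"
  shows "positive_op (c o\<^sub>L w)"
proof -
  \<comment> \<open>the summand \<open>1\<close> only avoids division by zero\<close>
  define r where "r = 1 / (norm w + 1)"
  have "r > 0"
    by (simp add: r_def add_nonneg_pos)
  define v :: "nat \<Rightarrow> 'a ell2_op" where "v = rec_nat (r *\<^sub>R w) (\<lambda>_ u. u - (u o\<^sub>L u))"
  have v0: "v 0 = r *\<^sub>R w" and vS: "v (Suc n) = v n - (v n o\<^sub>L v n)" for n
    by (simp_all add: v_def)
  have lin: "clinear (v n)" for n
    by (induction n) (simp_all add: v0 vS w)
  have commv: "c (v n f) = v n (c f)" for n f
    by (induction n arbitrary: f)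
      (simp_all add: v0 vS blinfun.scaleR_left blinfun.scaleR_right comm blinfun.diff_left blinfun.diff_right)
  have sa0: "cinner (v 0 f) g = cinner f (v 0 g)" for f g
    by (simp add: v0 blinfun.scaleR_left cinner_scaleR_left cinner_scaleR_right
        positive_op_selfadjoint[OF w])
  have sa: "cinner (v n f) g = cinner f (v n g)" for n f g
    by (induction n arbitrary: f g)
      (simp_all add: sa0 vS blinfun.diff_left cinner_diff_left cinner_diff_right)
  have pos: "0 \<le> Re (cinner f (v n f)) \<and> Re (cinner f (v n f)) \<le> (norm f)\<^sup>2" for n f
  proof (induction n arbitrary: f)
    case 0
    have "Re (cinner f (w f)) \<le> norm f * norm (w f)"
      using complex_Re_le_cmod cmod_cinner_le order_trans by blast
    also have "\<dots> \<le> norm f * (norm w * norm f)"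
      by (intro mult_left_mono norm_blinfun) auto
    finally have "Re (cinner f (w f)) \<le> norm f * (norm w * norm f)" .
    moreover have "norm f * (norm w * norm f) \<le> (norm w + 1) * (norm f)\<^sup>2"
      by (simp add: power2_eq_square algebra_simps)
    ultimately have "Re (cinner f (w f)) \<le> (norm w + 1) * (norm f)\<^sup>2"
      by linarith
    then have "r * Re (cinner f (w f)) \<le> r * ((norm w + 1) * (norm f)\<^sup>2)"
      using \<open>r > 0\<close> by (intro mult_left_mono) auto
    also have "\<dots> = (norm f)\<^sup>2"
      using norm_ge_zero[of w] by (simp add: r_def) (simp add: add_nonneg_eq_0_iff)
    finally show ?case
      using w(2) \<open>r > 0\<close> by (simp add: v0 blinfun.scaleR_left cinner_scaleR_right positive_op_iff)
  next
    case (Suc n)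
    let ?v = "v n"
    have n2: "Re (cinner f (?v (?v f))) = (norm (?v f))\<^sup>2"
      by (simp flip: sa add: cinner_self_norm)
    let ?g = "f - ?v f"
    \<comment> \<open>\<open>v - v\<^sup>2 = v (1 - v) v + (1 - v) v (1 - v)\<close>\<close>
    have "cinner f (v (Suc n) f) = (cinner (?v f) (?v f) - cinner (?v f) (?v (?v f))) + cinner ?g (?v ?g)"
      by (simp add: vS blinfun.diff_left blinfun.diff_right cinner_diff_left cinner_diff_right sa)
    moreover have "0 \<le> Re (cinner (?v f) (?v f) - cinner (?v f) (?v (?v f)))"
      using Suc.IH[of "?v f"] by (simp add: cinner_self_norm)
    moreover have "0 \<le> Re (cinner ?g (?v ?g))"
      using Suc.IH[of ?g] by simp
    ultimately have "0 \<le> Re (cinner f (v (Suc n) f))"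
      by simp
    moreover have "Re (cinner f (v (Suc n) f)) \<le> (norm f)\<^sup>2"
      using Suc.IH[of f] n2 by (simp add: vS blinfun.diff_left cinner_diff_right)
        (smt (verit) zero_le_power2)
    ultimately show ?case
      by blast
  qed
  have pos_c: "0 \<le> Re (cinner f (c f))" for f
    using c(2) by (simp add: positive_op_iff)
  have main: "0 \<le> Re (cinner f (c (w f)))" for f
  proof -
    have step1: "(norm (v n f))\<^sup>2 = Re (cinner f (v n f)) - Re (cinner f (v (Suc n) f))" for n
      using Re_cinner_self[of "v n f"]
      by (simp add: sa vS blinfun.diff_left cinner_diff_right)
    have "(\<Sum>k<n. (norm (v k f))\<^sup>2) = Re (cinner f (v 0 f)) - Re (cinner f (v n f))" for n
      by (induction n) (simp_all add: step1)
    then have "(\<Sum>k<n. (norm (v k f))\<^sup>2) \<le> Re (cinner f (v 0 f))" for n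
      using pos[of f n] by simp
    then have "summable (\<lambda>k. (norm (v k f))\<^sup>2)"
      by (intro summableI_nonneg_bounded[where x = "Re (cinner f (v 0 f))"]) auto
    then have "(\<lambda>k. sqrt ((norm (v k f))\<^sup>2)) \<longlonglongrightarrow> sqrt 0"
      by (intro tendsto_real_sqrt summable_LIMSEQ_zero)
    then have "(\<lambda>k. v k f) \<longlonglongrightarrow> 0"
      by (simp add: tendsto_norm_zero_iff)
    then have "(\<lambda>k. c (v k f)) \<longlonglongrightarrow> c 0"
      by (rule bounded_linear.tendsto[OF blinfun.bounded_linear_right])
    then have "(\<lambda>k. Re (cinner f (c (v k f)))) \<longlonglongrightarrow> Re (cinner f (c 0))"
      by (intro tendsto_Re tendsto_cinner_right)
    then have lim: "(\<lambda>k. Re (cinner f (c (v k f)))) \<longlonglongrightarrow> 0"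
      by (simp add: blinfun.zero_right)
    have step2: "Re (cinner (v n f) (c (v n f))) = Re (cinner f (c (v n f))) - Re (cinner f (c (v (Suc n) f)))" for n
      by (simp add: vS blinfun.diff_left blinfun.diff_right cinner_diff_right sa commv)
    have "Re (cinner f (c (v (Suc n) f))) \<le> Re (cinner f (c (v n f)))" for n
      using step2[of n] pos_c[of "v n f"] by simp
    then have "decseq (\<lambda>n. Re (cinner f (c (v n f))))"
      by (rule decseq_SucI)
    then have "0 \<le> Re (cinner f (c (v 0 f)))"
      using decseq_ge lim by blast
    then show ?thesis
      using \<open>r > 0\<close>
      by (simp add: v0 blinfun.scaleR_left blinfun.scaleR_right cinner_scaleR_right zero_le_mult_iff)
  qed
  moreover have "Im (cinner f (c (w f))) = 0" for f
  proof -
    have "cinner f (c (w f)) = cinner (c (w f)) f"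
      using positive_op_selfadjoint[OF c] positive_op_selfadjoint[OF w] comm by metis
    then show ?thesis
      by (subst (asm) (2) cinner_commute) (simp add: complex_eq_iff)
  qed
  ultimately show ?thesis
    by (simp add: positive_op_iff)
qed

section \<open>Operator algebras on \<open>\<ell>\<^sup>2(S)\<close>\<close>

lemma blinfun_eq_pointwise:
  fixes T T' :: "'a ell2_op" shows "T = T' \<longleftrightarrow> (\<forall>f. T f = T' f)"
  by (auto intro: blinfun_eqI)

lemma bounded_ops_iff:
  "T \<in> bounded_ops S \<longleftrightarrow>
    clinear T \<and> (\<forall>f. restrict_ell2 S (T f) = T f) \<and> (\<forall>f. T (restrict_ell2 S f) = T f)"
  by (auto simp: bounded_ops_def clinear_def blinfun_eq_pointwise ell2_proj_apply)

lemma bounded_ops_clinear: "T \<in> bounded_ops S \<Longrightarrow> clinear T"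
  by (simp add: bounded_ops_iff)

lemma bounded_ops_restrict:
  "T \<in> bounded_ops S \<Longrightarrow> restrict_ell2 S (T f) = T f"
  "T \<in> bounded_ops S \<Longrightarrow> T (restrict_ell2 S f) = T f"
  by (simp_all add: bounded_ops_iff)

lemma restrict_ell2_eq_iff: "restrict_ell2 S f = f \<longleftrightarrow> (\<forall>x. x \<notin> S \<longrightarrow> coord f x = 0)"
  by (metis (mono_tags, lifting) coord_eqI coord_restrict)

lemma coord_bounded_ops_outside: "T \<in> bounded_ops S \<Longrightarrow> x \<notin> S \<Longrightarrow> coord (T f) x = 0"
  by (metis bounded_ops_restrict(1) restrict_ell2_eq_iff)

lemma bounded_ops_ket_outside: "T \<in> bounded_ops S \<Longrightarrow> x \<notin> S \<Longrightarrow> T (ket x) = 0"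
proof -
  assume T: "T \<in> bounded_ops S" "x \<notin> S"
  have "restrict_ell2 S (ket x) = 0"
    using T by (intro coord_eqI) (simp add: coord_ket)
  then show ?thesis
    using bounded_ops_restrict(2)[OF T(1), of "ket x"] by (simp add: blinfun.zero_right)
qed

lemma restrict_restrict [simp]: "restrict_ell2 S (restrict_ell2 S f) = restrict_ell2 S f"
  by (intro coord_eqI) simp

lemma bounded_opsI:
  assumes lin: "clinear T"
    and "\<And>t. t \<notin> S \<Longrightarrow> T (ket t) = 0"
    and "\<And>s t. t \<in> S \<Longrightarrow> s \<notin> S \<Longrightarrow> coord (T (ket t)) s = 0"
  shows "T \<in> bounded_ops S"
proof -
  have r: "restrict_ell2 S (ket t) = (if t \<in> S then ket t else 0)" for t
    by (intro coord_eqI) (auto simp: coord_ket)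
  have "T o\<^sub>L ell2_proj S = T"
    by (rule op_eq_on_kets) (auto simp: lin assms ell2_proj_apply r blinfun.zero_right)
  moreover have "ell2_proj S o\<^sub>L T = T"
  proof (rule op_eq_on_kets)
    show "(ell2_proj S o\<^sub>L T) (ket t) = T (ket t)" for t
      using assms(2,3)[of t] by (cases "t \<in> S") (auto simp: ell2_proj_apply restrict_ell2_eq_iff)
  qed (auto simp: lin)
  ultimately show ?thesis
    using lin by (auto simp: bounded_ops_def clinear_def)
qed

lemma restrict_ell2_add: "restrict_ell2 S (f + g) = restrict_ell2 S f + restrict_ell2 S g"
  and restrict_ell2_scaleC: "restrict_ell2 S (c *\<^sub>C f) = c *\<^sub>C restrict_ell2 S f"
  by (auto intro!: coord_eqI)

lemma bounded_ops_add: "T \<in> bounded_ops S \<Longrightarrow> T' \<in> bounded_ops S \<Longrightarrow> T + T' \<in> bounded_ops S"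
  by (auto simp: bounded_ops_iff blinfun.add_left restrict_ell2_add)

lemma bounded_ops_compose: "T \<in> bounded_ops S \<Longrightarrow> T' \<in> bounded_ops S \<Longrightarrow> T o\<^sub>L T' \<in> bounded_ops S"
  by (auto simp: bounded_ops_iff)

lemma bounded_ops_scaleC: "T \<in> bounded_ops S \<Longrightarrow> scaleC_op c T \<in> bounded_ops S"
  by (auto simp: bounded_ops_iff scaleC_op_apply restrict_ell2_scaleC)

lemma bounded_ops_adj:
  assumes T: "T \<in> bounded_ops S" shows "adj T \<in> bounded_ops S"
proof -
  have lin: "clinear T"
    using T by (rule bounded_ops_clinear)
  have "restrict_ell2 S (adj T f) = adj T f" for f
    by (rule cinner_left_eqI) (simp add: cinner_restrict cinner_adj_left lin bounded_ops_restrict[OF T])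
  moreover have "adj T (restrict_ell2 S f) = adj T f" for f
    by (rule cinner_left_eqI) (simp add: cinner_restrict cinner_adj_left lin bounded_ops_restrict[OF T])
  ultimately show ?thesis
    unfolding bounded_ops_iff by (simp add: clinear_adj lin)
qed

lemmas bounded_ops_closed =
  bounded_ops_add bounded_ops_compose bounded_ops_scaleC bounded_ops_adj

lemma ell2_proj_bounded_ops: "ell2_proj S \<in> bounded_ops S"
  by (simp add: bounded_ops_iff ell2_proj_apply)

lemma commutant_iff:
  "T \<in> commutant S A \<longleftrightarrow> T \<in> bounded_ops S \<and> (\<forall>a\<in>A. \<forall>f. T (a f) = a (T f))"
  by (auto simp: commutant_def blinfun_eq_pointwise)

lemma commutant_subset_bounded_ops: "commutant S A \<subseteq> bounded_ops S"
  by (auto simp: commutant_def)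

lemma commutant_antimono: "A \<subseteq> B \<Longrightarrow> commutant S B \<subseteq> commutant S A"
  by (auto simp: commutant_def)

lemma subset_double_commutant: "A \<subseteq> bounded_ops S \<Longrightarrow> A \<subseteq> commutant S (commutant S A)"
  by (auto simp: commutant_def)

lemma triple_commutant:
  "A \<subseteq> bounded_ops S \<Longrightarrow> commutant S (commutant S (commutant S A)) = commutant S A"
  by (meson commutant_antimono commutant_subset_bounded_ops subset_antisym subset_double_commutant)

text \<open>
  \<open>L(\<Gamma>)\<close> and the fixed-point algebras are obtained in this way; their double commutant condition is an
  instance of the purely algebraic identity \<open>A''' = A'\<close>.
\<close>

lemma von_neumann_algebra_commutant:
  assumes A: "A \<subseteq> bounded_ops S" and adjA: "\<And>a. a \<in> A \<Longrightarrow> adj a \<in> A"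
  shows "von_neumann_algebra S (commutant S A)"
proof -
  have lin: "clinear a" if "a \<in> A" for a
    using that A bounded_ops_clinear by blast
  have "adj T \<in> commutant S A" if T: "T \<in> commutant S A" for T
  proof -
    have Tb: "T \<in> bounded_ops S"
      using T commutant_subset_bounded_ops by blast
    then have Tl: "clinear T"
      by (rule bounded_ops_clinear)
    have "adj T (a f) = a (adj T f)" if a: "a \<in> A" for a f
    proof (rule cinner_left_eqI)
      fix g
      have "cinner (adj T (a f)) g = cinner f (adj a (T g))"
        by (simp add: cinner_adj_left cinner_adj_right Tl lin[OF a])
      also have "\<dots> = cinner f (T (adj a g))"
        using T adjA[OF a] by (simp add: commutant_iff)
      also have "\<dots> = cinner (a (adj T f)) g"
        using cinner_adj_right[OF lin[OF a], of "adj T f" g]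
        by (simp add: cinner_adj_left Tl)
      finally show "cinner (adj T (a f)) g = cinner (a (adj T f)) g" .
    qed
    then show ?thesis
      using bounded_ops_adj[OF Tb] by (simp add: commutant_iff)
  qed
  moreover have "ell2_proj S \<in> commutant S A"
    using A
    by (auto simp: commutant_iff ell2_proj_bounded_ops ell2_proj_apply subset_iff bounded_ops_restrict)
  moreover have "x + y \<in> commutant S A \<and> x o\<^sub>L y \<in> commutant S A"
    if "x \<in> commutant S A" "y \<in> commutant S A" for x y
    using that by (auto simp: bounded_ops_closed commutant_iff blinfun.add_left blinfun.add_right)
  moreover have "scaleC_op c x \<in> commutant S A" if "x \<in> commutant S A" for x c
    using that by (auto simp: bounded_ops_closed commutant_iff scaleC_op_apply clinearD lin)
  ultimately show ?thesis
    using commutant_subset_bounded_ops[of S A] triple_commutant[OF A]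
    by (simp add: von_neumann_algebra_def)
qed

section \<open>Permutation operators\<close>

lemma norm_sum_kets: "finite A \<Longrightarrow> (norm (\<Sum>t\<in>A. c t *\<^sub>C ket t))\<^sup>2 = (\<Sum>t\<in>A. (cmod (c t))\<^sup>2)"
proof -
  assume "finite A"
  then have "(norm (\<Sum>t\<in>A. c t *\<^sub>C ket t))\<^sup>2
      = (\<Sum>\<^sub>\<infinity>x\<in>A. (cmod (coord (\<Sum>t\<in>A. c t *\<^sub>C ket t) x))\<^sup>2)"
    unfolding norm_square_infsum
    by (intro infsum_cong_neutral) (auto simp: coord_ket if_distrib cong: if_cong)
  then show ?thesis
    using \<open>finite A\<close> by (simp add: coord_ket if_distrib cong: if_cong)
qed

lemma ex_perm_op:
  assumes "inj_on \<pi> S"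
  shows "\<exists>T. clinear T \<and> (\<forall>t. T (ket t) = (if t \<in> S then ket (\<pi> t) else 0))"
proof (rule ex_op_of_columns[where B = 1])
  fix A :: "'a set" and c
  assume A: "finite A"
  let ?v = "\<lambda>t. if t \<in> S then ket (\<pi> t) else 0"
  have inj: "inj_on \<pi> (A \<inter> S)"
    using assms by (auto simp: inj_on_def)
  have "(\<Sum>t\<in>A. c t *\<^sub>C ?v t) = (\<Sum>t\<in>A \<inter> S. c t *\<^sub>C ket (\<pi> t))"
    using A by (intro sum.mono_neutral_cong_right) auto
  also have "\<dots> = (\<Sum>u\<in>\<pi> ` (A \<inter> S). c (inv_into (A \<inter> S) \<pi> u) *\<^sub>C ket u)"
    by (simp add: sum.reindex[OF inj] inv_into_f_f[OF inj])
  finally have "(norm (\<Sum>t\<in>A. c t *\<^sub>C ?v t))\<^sup>2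
      = (\<Sum>u\<in>\<pi> ` (A \<inter> S). (cmod (c (inv_into (A \<inter> S) \<pi> u)))\<^sup>2)"
    using norm_sum_kets[of "\<pi> ` (A \<inter> S)" "\<lambda>u. c (inv_into (A \<inter> S) \<pi> u)"] A by simp
  also have "\<dots> = (\<Sum>t\<in>A \<inter> S. (cmod (c t))\<^sup>2)"
    by (simp add: sum.reindex[OF inj] inv_into_f_f[OF inj])
  also have "\<dots> \<le> (norm (\<Sum>t\<in>A. c t *\<^sub>C ket t))\<^sup>2"
    unfolding norm_sum_kets[OF A] using A by (intro sum_mono2) auto
  finally show "norm (\<Sum>t\<in>A. c t *\<^sub>C ?v t) \<le> 1 * norm (\<Sum>t\<in>A. c t *\<^sub>C ket t)"
    by (simp add: power2_le_iff_abs_le)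
qed simp

text \<open>
  The operator is chosen by its values on the basis because the left and right translations and the
  action of automorphisms are all of this form, extended by zero outside \<open>S\<close>.
\<close>

definition perm_op :: "'a set \<Rightarrow> ('a \<Rightarrow> 'a) \<Rightarrow> 'a ell2_op" where
  "perm_op S \<pi> = (SOME T. clinear T \<and> (\<forall>t. T (ket t) = (if t \<in> S then ket (\<pi> t) else 0)))"

lemma perm_op:
  assumes "inj_on \<pi> S"
  shows clinear_perm_op: "clinear (perm_op S \<pi>)"
    and perm_op_ket: "perm_op S \<pi> (ket t) = (if t \<in> S then ket (\<pi> t) else 0)"
  unfolding perm_op_def using someI_ex[OF ex_perm_op[OF assms]] by auto

lemma perm_op_bounded_ops:
  assumes "bij_betw \<pi> S S" shows "perm_op S \<pi> \<in> bounded_ops S"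
proof (rule bounded_opsI)
  show "coord (perm_op S \<pi> (ket t)) s = 0" if "t \<in> S" "s \<notin> S" for s t
    using that assms bij_betwE[OF assms] by (auto simp: perm_op_ket bij_betw_imp_inj_on coord_ket)
qed (auto simp: perm_op clinear_perm_op bij_betw_imp_inj_on[OF assms] perm_op_ket)

lemma perm_op_eqI:
  assumes "inj_on \<pi> S" "clinear T" "\<And>t. t \<in> S \<Longrightarrow> T (ket t) = ket (\<pi> t)"
    "\<And>t. t \<notin> S \<Longrightarrow> T (ket t) = 0"
  shows "T = perm_op S \<pi>"
  by (rule op_eq_on_kets) (auto simp: assms perm_op)

lemma perm_op_compose:
  assumes "bij_betw \<pi> S S" "bij_betw \<sigma> S S"
  shows "perm_op S \<pi> o\<^sub>L perm_op S \<sigma> = perm_op S (\<lambda>t. \<pi> (\<sigma> t))"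
proof (rule perm_op_eqI)
  show "inj_on (\<lambda>t. \<pi> (\<sigma> t)) S"
    using bij_betw_trans[OF assms(2,1)] by (simp add: bij_betw_def comp_def)
qed (use assms bij_betwE[OF assms(2)] in
    \<open>auto simp: perm_op bij_betw_imp_inj_on blinfun.zero_right\<close>)

lemma perm_op_cong: "(\<And>t. t \<in> S \<Longrightarrow> \<pi> t = \<sigma> t) \<Longrightarrow> perm_op S \<pi> = perm_op S \<sigma>"
  unfolding perm_op_def by (metis (no_types, lifting))

lemma perm_op_id: "(\<And>t. t \<in> S \<Longrightarrow> \<pi> t = t) \<Longrightarrow> perm_op S \<pi> = ell2_proj S"
  by (rule perm_op_eqI[symmetric])
    (auto simp: inj_on_def ell2_proj_apply coord_ket intro!: coord_eqI)

lemma coord_adj_ket: "clinear T \<Longrightarrow> coord (adj T (ket s)) t = cnj (coord (T (ket t)) s)"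
  using cinner_adj_right[of T "ket t" "ket s"] by (simp add: cinner_ket_left cinner_ket_right)

lemma adj_perm_op:
  assumes \<pi>: "bij_betw \<pi> S S" and \<sigma>: "bij_betw \<sigma> S S" and inv: "\<And>t. t \<in> S \<Longrightarrow> \<sigma> (\<pi> t) = t"
  shows "adj (perm_op S \<pi>) = perm_op S \<sigma>"
proof (rule op_eq_on_kets)
  fix s
  have inv': "\<pi> (\<sigma> s) = s" if "s \<in> S"
    using that inv \<pi> by (metis (full_types) bij_betw_iff_bijections)
  have "s = \<pi> t \<longleftrightarrow> t = \<sigma> s" if "t \<in> S" "s \<in> S" for t
    using that inv inv' by metis
  then show "adj (perm_op S \<pi>) (ket s) = perm_op S \<sigma> (ket s)"
    using bij_betwE[OF \<pi>] bij_betwE[OF \<sigma>]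
    by (intro coord_eqI)
      (auto simp: coord_adj_ket perm_op bij_betw_imp_inj_on[OF \<pi>] bij_betw_imp_inj_on[OF \<sigma>]
        coord_ket)
qed (auto simp: perm_op clinear_adj bij_betw_imp_inj_on[OF \<pi>] bij_betw_imp_inj_on[OF \<sigma>])

lemma coord_perm_op:
  assumes \<pi>: "bij_betw \<pi> S S" and "t \<in> S"
  shows "coord (perm_op S \<pi> f) (\<pi> t) = coord f t"
proof -
  have "coord (perm_op S \<pi> f) (\<pi> t) = cinner (adj (perm_op S \<pi>) (ket (\<pi> t))) f"
    by (simp add: cinner_adj_left perm_op bij_betw_imp_inj_on[OF \<pi>] cinner_ket_left)
  also have "adj (perm_op S \<pi>) = perm_op S (inv_into S \<pi>)"
    by (rule adj_perm_op) (auto simp: \<pi> bij_betw_inv_into bij_betw_inv_into_left[OF \<pi>])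
  finally show ?thesis
    using assms bij_betwE[OF \<pi>] bij_betw_imp_inj_on[OF bij_betw_inv_into[OF \<pi>]]
    by (simp add: perm_op bij_betw_inv_into_left cinner_ket_left)
qed

lemma coord_op_apply:
  assumes "clinear T"
  shows "coord (T f) s = (\<Sum>\<^sub>\<infinity>u. coord (T (ket u)) s * coord f u)"
proof -
  have "coord (T f) s = cinner (adj T (ket s)) f"
    by (simp add: cinner_adj_left assms cinner_ket_left)
  also have "\<dots> = (\<Sum>\<^sub>\<infinity>u. coord (T (ket u)) s * coord f u)"
    unfolding cinner_def
  proof (rule infsum_cong)
    fix u
    show "cnj (coord (adj T (ket s)) u) * coord f u = coord (T (ket u)) s * coord f u"
      by (simp add: coord_adj_ket assms)
  qed
  finally show ?thesis .
qed

section \<open>The group von Neumann algebra as a commutant\<close>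

lemma bounded_ops_eq_on_kets:
  assumes "S' \<in> bounded_ops A" "T \<in> bounded_ops A" "\<And>t. t \<in> A \<Longrightarrow> S' (ket t) = T (ket t)"
  shows "S' = T"
  by (rule op_eq_on_kets) (use assms in \<open>metis bounded_ops_clinear bounded_ops_ket_outside\<close>)+

locale discrete_group = group \<Gamma> for \<Gamma> :: "('a, 'b) monoid_scheme" (structure)
begin

abbreviation "S \<equiv> carrier \<Gamma>"
abbreviation "M \<equiv> group_vNa \<Gamma>"
abbreviation "\<delta> \<equiv> ket \<one>"
abbreviation "L \<equiv> left_reg \<Gamma>"

definition right_reg :: "'a \<Rightarrow> 'a ell2_op" where
  "right_reg g = perm_op S (\<lambda>t. t \<otimes> inv g)"

abbreviation "R \<equiv> right_reg"

lemma bij_left: "g \<in> S \<Longrightarrow> bij_betw (\<lambda>t. g \<otimes> t) S S"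
  by (rule bij_betwI[where g = "\<lambda>t. inv g \<otimes> t"]) (auto simp flip: m_assoc)

lemma bij_right: "g \<in> S \<Longrightarrow> bij_betw (\<lambda>t. t \<otimes> g) S S"
  by (rule bij_betwI[where g = "\<lambda>t. t \<otimes> inv g"]) (auto simp: m_assoc)

lemma bij_inv: "bij_betw (\<lambda>t. inv t) S S"
  by (rule bij_betwI[where g = "\<lambda>t. inv t"]) auto

lemma R_bij: "g \<in> S \<Longrightarrow> bij_betw (\<lambda>t. t \<otimes> inv g) S S"
  by (simp add: bij_right)

lemma R_ket: "g \<in> S \<Longrightarrow> t \<in> S \<Longrightarrow> R g (ket t) = ket (t \<otimes> inv g)"
  unfolding right_reg_def by (subst perm_op_ket) (use bij_betw_imp_inj_on[OF R_bij] in auto)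

lemma R_bounded_ops: "g \<in> S \<Longrightarrow> R g \<in> bounded_ops S"
  unfolding right_reg_def by (rule perm_op_bounded_ops[OF R_bij])

lemma clinear_R: "g \<in> S \<Longrightarrow> clinear (R g)"
  using R_bounded_ops bounded_ops_clinear by blast

lemma R_compose: "g \<in> S \<Longrightarrow> h \<in> S \<Longrightarrow> R g o\<^sub>L R h = R (g \<otimes> h)"
  unfolding right_reg_def
  by (subst perm_op_compose) (auto simp: R_bij m_assoc inv_mult_group intro!: perm_op_cong)

lemma adj_R: "g \<in> S \<Longrightarrow> adj (R g) = R (inv g)"
  unfolding right_reg_def by (rule adj_perm_op) (auto simp: bij_right m_assoc)

lemma R_one: "R \<one> = ell2_proj S"
  unfolding right_reg_def by (rule perm_op_id) auto

lemma left_reg_eq_perm_op: "g \<in> S \<Longrightarrow> L g = perm_op S (\<lambda>t. g \<otimes> t)"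
proof (rule perm_op_eqI)
  assume g: "g \<in> S"
  show "inj_on (\<lambda>t. g \<otimes> t) S"
    using bij_betw_imp_inj_on[OF bij_left[OF g]] .
  show "clinear (L g)"
    using coord_left_reg[OF is_group g] by (auto simp: clinear_def intro!: coord_eqI)
  show "L g (ket t) = ket (g \<otimes> t)" if "t \<in> S" for t
    by (rule left_reg_ket[OF is_group g that])
  show "L g (ket t) = 0" if "t \<notin> S" for t
    using that g coord_left_reg[OF is_group g] by (auto simp: coord_ket intro!: coord_eqI)
qed

lemma L_ket: "g \<in> S \<Longrightarrow> t \<in> S \<Longrightarrow> L g (ket t) = ket (g \<otimes> t)"
  by (rule left_reg_ket[OF is_group])

lemma L_bounded_ops: "g \<in> S \<Longrightarrow> L g \<in> bounded_ops S"
  by (simp add: left_reg_eq_perm_op perm_op_bounded_ops bij_left)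

lemma adj_L: "g \<in> S \<Longrightarrow> adj (L g) = L (inv g)"
  by (simp add: left_reg_eq_perm_op) (rule adj_perm_op, auto simp: bij_left simp flip: m_assoc)

lemma L_compose: "g \<in> S \<Longrightarrow> h \<in> S \<Longrightarrow> L g o\<^sub>L L h = L (g \<otimes> h)"
  by (simp add: left_reg_eq_perm_op perm_op_compose bij_left m_assoc cong: perm_op_cong)

lemma L_one: "L \<one> = ell2_proj S"
  by (simp add: left_reg_eq_perm_op) (rule perm_op_id, auto)

lemma R_in_commutant_L: "g \<in> S \<Longrightarrow> R g \<in> commutant S (L ` S)"
  unfolding commutant_def
proof (clarsimp simp: R_bounded_ops)
  fix h assume gh: "g \<in> S" "h \<in> S"
  show "R g o\<^sub>L L h = L h o\<^sub>L R g"
    by (rule bounded_ops_eq_on_kets[where A = S])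
      (use gh in \<open>auto simp: bounded_ops_closed R_bounded_ops L_bounded_ops R_ket L_ket m_assoc\<close>)
qed

text \<open>
  The commutation theorem \<open>L(\<Gamma>) = R(\<Gamma>)'\<close>: in matrix form, an operator commuting with right
  translations is the convolution \<open>x(s,u) = \<xi>(s u\<^sup>-\<^sup>1)\<close> and one commuting with left translations is
  \<open>T(u,t) = \<eta>(t\<^sup>-\<^sup>1 u)\<close>; the substitution \<open>u \<mapsto> s u\<^sup>-\<^sup>1 t\<close> exchanges the two matrix products.
\<close>

lemma commute_R_ket:
  assumes x: "x \<in> bounded_ops S" "\<And>g f. g \<in> S \<Longrightarrow> x (R g f) = R g (x f)" and "u \<in> S"
  shows "x (ket u) = R (inv u) (x \<delta>)"
  using x(2)[of "inv u" \<delta>] \<open>u \<in> S\<close> by (simp add: R_ket)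

lemma coord_R: "g \<in> S \<Longrightarrow> t \<in> S \<Longrightarrow> coord (R g f) t = coord f (t \<otimes> g)"
  unfolding right_reg_def using coord_perm_op[OF R_bij, of g "t \<otimes> g" f] by (simp add: m_assoc)

lemma coord_L: "g \<in> S \<Longrightarrow> t \<in> S \<Longrightarrow> coord (L g f) t = coord f (inv g \<otimes> t)"
  by (simp add: coord_left_reg[OF is_group])

theorem group_vNa_eq_commutant_R: "M = commutant S (R ` S)"
proof
  show "M \<subseteq> commutant S (R ` S)"
    unfolding subgroup_vNa_def by (rule commutant_antimono) (auto simp: R_in_commutant_L)
  show "commutant S (R ` S) \<subseteq> M"
  proof
    fix x assume x: "x \<in> commutant S (R ` S)"
    then have xb: "x \<in> bounded_ops S" and xR: "\<And>g f. g \<in> S \<Longrightarrow> x (R g f) = R g (x f)"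
      by (auto simp: commutant_iff)
    have "x o\<^sub>L T = T o\<^sub>L x" if T: "T \<in> commutant S (L ` S)" for T
    proof (rule bounded_ops_eq_on_kets[where A = S])
      have Tb: "T \<in> bounded_ops S" and TL: "\<And>g f. g \<in> S \<Longrightarrow> T (L g f) = L g (T f)"
        using T by (auto simp: commutant_iff)
      show "x o\<^sub>L T \<in> bounded_ops S" "T o\<^sub>L x \<in> bounded_ops S"
        by (simp_all add: bounded_ops_closed xb Tb)
      fix t assume t: "t \<in> S"
      define \<xi> where "\<xi> = coord (x \<delta>)"
      define \<eta> where "\<eta> = coord (T \<delta>)"
      have X: "coord (x (ket u)) s = \<xi> (s \<otimes> inv u)" if "u \<in> S" "s \<in> S" for u s
        using that unfolding \<xi>_def by (subst commute_R_ket[OF xb xR]) (simp_all add: coord_R)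
      have TT: "coord (T (ket u)) s = \<eta> (inv u \<otimes> s)" if "u \<in> S" "s \<in> S" for u s
        using TL[of u \<delta>] that by (simp add: L_ket coord_L \<eta>_def)
      have "coord (x (T (ket t))) s = coord (T (x (ket t))) s" if s: "s \<in> S" for s
      proof -
        let ?h = "\<lambda>u. s \<otimes> (inv u \<otimes> t)"
        have h: "bij_betw ?h S S"
          using bij_betw_trans[OF bij_betw_trans[OF bij_inv bij_right[OF t]] bij_left[OF s]]
          unfolding comp_def .
        have "coord (x (T (ket t))) s
            = (\<Sum>\<^sub>\<infinity>u\<in>S. \<xi> (s \<otimes> inv u) * \<eta> (inv t \<otimes> u))"
          unfolding coord_op_apply[OF bounded_ops_clinear[OF xb], of "T (ket t)"]
          by (rule infsum_cong_neutral)
            (use s t in \<open>auto simp: X TT bounded_ops_ket_outside[OF xb]\<close>)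
        also have "\<dots> = (\<Sum>\<^sub>\<infinity>u\<in>S. \<eta> (inv (?h u) \<otimes> s) * \<xi> (?h u \<otimes> inv t))"
        proof (rule infsum_cong)
          fix u assume u: "u \<in> S"
          have "inv (?h u) \<otimes> s = inv t \<otimes> u" "?h u \<otimes> inv t = s \<otimes> inv u"
            using s t u by (simp_all add: inv_mult_group m_assoc)
          then show "\<xi> (s \<otimes> inv u) * \<eta> (inv t \<otimes> u)
              = \<eta> (inv (?h u) \<otimes> s) * \<xi> (?h u \<otimes> inv t)"
            by simp
        qed
        also have "\<dots> = (\<Sum>\<^sub>\<infinity>u\<in>S. \<eta> (inv u \<otimes> s) * \<xi> (u \<otimes> inv t))"
          by (rule infsum_reindex_bij_betw[OF h])
        also have "\<dots> = coord (T (x (ket t))) s"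
          unfolding coord_op_apply[OF bounded_ops_clinear[OF Tb], of "x (ket t)"]
          by (rule infsum_cong_neutral)
            (use s t in \<open>auto simp: X TT bounded_ops_ket_outside[OF Tb]\<close>)
        finally show ?thesis .
      qed
      then show "(x o\<^sub>L T) (ket t) = (T o\<^sub>L x) (ket t)"
        using coord_bounded_ops_outside[OF xb] coord_bounded_ops_outside[OF Tb]
        by (metis blinfun_apply_blinfun_compose coord_eqI)
    qed
    then show "x \<in> M"
      unfolding subgroup_vNa_def commutant_def[of S "commutant S (L ` S)"] using xb by blast
  qed
qed

lemma von_neumann_algebra_group_vNa: "von_neumann_algebra S M"
  unfolding group_vNa_eq_commutant_R
  by (rule von_neumann_algebra_commutant) (auto simp: R_bounded_ops adj_R)

lemma M_iff: "x \<in> M \<longleftrightarrow> x \<in> bounded_ops S \<and> (\<forall>g\<in>S. \<forall>f. x (R g f) = R g (x f))"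
  unfolding group_vNa_eq_commutant_R commutant_iff by auto

lemma M_bounded_ops: "x \<in> M \<Longrightarrow> x \<in> bounded_ops S"
  and M_clinear: "x \<in> M \<Longrightarrow> clinear x"
  and M_R: "x \<in> M \<Longrightarrow> g \<in> S \<Longrightarrow> x (R g f) = R g (x f)"
  by (auto simp: M_iff bounded_ops_clinear)

lemma M_closed:
  "x \<in> M \<Longrightarrow> y \<in> M \<Longrightarrow> x + y \<in> M" "x \<in> M \<Longrightarrow> y \<in> M \<Longrightarrow> x o\<^sub>L y \<in> M"
  "x \<in> M \<Longrightarrow> scaleC_op c x \<in> M" "x \<in> M \<Longrightarrow> adj x \<in> M" "ell2_proj S \<in> M"
  using von_neumann_algebra_group_vNa by (auto simp: von_neumann_algebra_def)

lemma L_in_M: "g \<in> S \<Longrightarrow> L g \<in> M"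
  unfolding subgroup_vNa_def using subset_double_commutant[of "L ` S" S] L_bounded_ops by blast

lemma M_ket: "x \<in> M \<Longrightarrow> u \<in> S \<Longrightarrow> x (ket u) = R (inv u) (x \<delta>)"
  by (intro commute_R_ket) (auto simp: M_iff)

lemma coord_M: "x \<in> M \<Longrightarrow> u \<in> S \<Longrightarrow> s \<in> S \<Longrightarrow> coord (x (ket u)) s = coord (x \<delta>) (s \<otimes> inv u)"
  by (subst M_ket) (simp_all add: coord_R)

text \<open>
  Since \<open>x \<delta>\<^sub>u = R(u\<^sup>-\<^sup>1) x \<delta>\<close>, the vector \<open>x \<delta>\<close> contains the whole matrix of \<open>x\<close>. Identities in \<open>L(\<Gamma>)\<close> are
  therefore checked on \<open>\<delta>\<close> only.
\<close>

lemma M_eqI: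
  assumes "x \<in> M" "y \<in> M" "x \<delta> = y \<delta>" shows "x = y"
proof (rule bounded_ops_eq_on_kets[where A = S])
  show "x (ket t) = y (ket t)" if "t \<in> S" for t
    using M_ket[OF assms(1) that] M_ket[OF assms(2) that] assms(3) by simp
qed (use assms in \<open>auto simp: M_bounded_ops\<close>)

lemma coord_adj: "x \<in> M \<Longrightarrow> s \<in> S \<Longrightarrow> coord (adj x \<delta>) s = cnj (coord (x \<delta>) (inv s))"
proof -
  assume x: "x \<in> M" and s: "s \<in> S"
  show ?thesis
    using coord_M[OF x s one_closed] s by (simp add: coord_adj_ket M_clinear[OF x])
qed

lemma trace_eq_cinner: "x \<in> M \<Longrightarrow> vN_trace \<Gamma> (x o\<^sub>L y) = cinner (adj x \<delta>) (y \<delta>)"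
  by (simp add: vN_trace_def cinner_adj_left M_clinear)

text \<open>
  With Fourier coefficients \<open>x \<delta> = \<Sum>\<xi>(s) \<delta>\<^sub>s\<close> and \<open>y \<delta> = \<Sum>\<eta>(s) \<delta>\<^sub>s\<close> the trace of \<open>x y\<close> is
  \<open>\<Sum>\<xi>(s\<^sup>-\<^sup>1) \<eta>(s)\<close>, which is symmetric under \<open>s \<mapsto> s\<^sup>-\<^sup>1\<close>.
\<close>

lemma trace_commute:
  assumes x: "x \<in> M" and y: "y \<in> M"
  shows "vN_trace \<Gamma> (x o\<^sub>L y) = vN_trace \<Gamma> (y o\<^sub>L x)"
proof -
  have tr: "vN_trace \<Gamma> (x o\<^sub>L y) = (\<Sum>\<^sub>\<infinity>s\<in>S. coord (x \<delta>) (inv s) * coord (y \<delta>) s)"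
    if "x \<in> M" "y \<in> M" for x y
    unfolding trace_eq_cinner[OF that(1)] cinner_def
    by (rule infsum_cong_neutral)
      (auto simp: coord_adj that coord_bounded_ops_outside[OF M_bounded_ops])
  have "vN_trace \<Gamma> (x o\<^sub>L y) = (\<Sum>\<^sub>\<infinity>s\<in>S. coord (x \<delta>) (inv (inv s)) * coord (y \<delta>) (inv s))"
    unfolding tr[OF x y] by (rule infsum_reindex_bij_betw[OF bij_inv, symmetric])
  also have "\<dots> = vN_trace \<Gamma> (y o\<^sub>L x)"
    unfolding tr[OF y x] by (rule infsum_cong) auto
  finally show ?thesis .
qed

lemma norm_adj_delta: "x \<in> M \<Longrightarrow> norm (adj x \<delta>) = norm (x \<delta>)"
proof -
  assume x: "x \<in> M"
  have "cinner (adj x \<delta>) (adj x \<delta>) = cinner (x \<delta>) (x \<delta>)"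
    using trace_commute[OF x M_closed(4)[OF x]] trace_eq_cinner[OF x]
      trace_eq_cinner[OF M_closed(4)[OF x]]
    by (simp add: adj_adj M_clinear x)
  then show ?thesis
    unfolding cinner_self_norm of_real_eq_iff by simp
qed

lemma norm2_eq: "x \<in> M \<Longrightarrow> norm2 \<Gamma> x = norm (x \<delta>)"
  unfolding norm2_def
  by (subst trace_eq_cinner) (simp_all add: M_closed adj_adj M_clinear Re_cinner_self)

end

section \<open>Conditional expectations\<close>

lemma subspace_closure_normed:
  fixes V :: "'v :: real_normed_vector set"
  assumes V: "subspace V"
  shows "subspace (closure V)"
proof (rule subspaceI)
  show "0 \<in> closure V"
    using subspace_0[OF V] closure_subset by blast
  show "u + v \<in> closure V" if uv: "u \<in> closure V" "v \<in> closure V" for u v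
  proof -
    obtain x y where "\<forall>n. x n \<in> V" "x \<longlonglongrightarrow> u" "\<forall>n. y n \<in> V" "y \<longlonglongrightarrow> v"
      using uv unfolding closure_sequential by blast
    then have "\<forall>n. x n + y n \<in> V" "(\<lambda>n. x n + y n) \<longlonglongrightarrow> u + v"
      by (auto intro: subspace_add[OF V] tendsto_add)
    then show ?thesis
      unfolding closure_sequential by (intro exI[of _ "\<lambda>n. x n + y n"]) simp
  qed
  show "r *\<^sub>R u \<in> closure V" if u: "u \<in> closure V" for r u
  proof -
    obtain x where "\<forall>n. x n \<in> V" "x \<longlonglongrightarrow> u"
      using u unfolding closure_sequential by blast
    then have "\<forall>n. r *\<^sub>R x n \<in> V" "(\<lambda>n. r *\<^sub>R x n) \<longlonglongrightarrow> r *\<^sub>R u"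
      by (auto intro: subspace_scale[OF V] tendsto_scaleR)
    then show ?thesis
      unfolding closure_sequential by (intro exI[of _ "\<lambda>n. r *\<^sub>R x n"]) simp
  qed
qed

context discrete_group
begin

abbreviation L2_space :: "'a ell2_op set \<Rightarrow> 'a ell2 set" where
  "L2_space P \<equiv> closure ((\<lambda>b. blinfun_apply b \<delta>) ` P)"

text \<open>The trace property in the form used throughout: a factor on the right moves across the inner product.\<close>

lemma trace_shift:
  assumes "a \<in> M" "x \<in> M" "d \<in> M"
  shows "cinner (a \<delta>) (x (d \<delta>)) = cinner (a (adj d \<delta>)) (x \<delta>)"
proof -
  have "cinner (a \<delta>) (x (d \<delta>)) = vN_trace \<Gamma> ((adj a o\<^sub>L x) o\<^sub>L d)"
    using assms by (simp add: vN_trace_def cinner_adj_right M_clinear)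
  also have "\<dots> = vN_trace \<Gamma> (d o\<^sub>L (adj a o\<^sub>L x))"
    using assms by (intro trace_commute) (auto simp: M_closed)
  also have "\<dots> = cinner (a (adj d \<delta>)) (x \<delta>)"
    using assms cinner_adj_left[of d \<delta> "adj a (x \<delta>)"] by (simp add: vN_trace_def cinner_adj_right M_clinear)
  finally show ?thesis .
qed

lemma M_diff: "x \<in> M \<Longrightarrow> y \<in> M \<Longrightarrow> x - y \<in> M"
proof -
  assume "x \<in> M" "y \<in> M"
  then have "x + scaleC_op (-1) y \<in> M"
    by (intro M_closed)
  moreover have "x - y = x + scaleC_op (-1) y"
    by (rule blinfun_eqI) (simp add: blinfun.diff_left blinfun.add_left scaleC_op_apply scaleC_minus_one)
  ultimately show ?thesis
    by (simp only:)
qed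

lemma norm_adj_diff:
  assumes "x \<in> M" "y \<in> M"
  shows "norm (adj x \<delta> - adj y \<delta>) = norm (x \<delta> - y \<delta>)"
proof -
  have "adj x = adj (x - y) + adj y"
    using assms by (subst adj_add[symmetric]) (auto simp: M_clinear M_diff)
  then have "adj x \<delta> - adj y \<delta> = adj (x - y) \<delta>"
    by (simp add: blinfun.add_left)
  then show ?thesis
    using norm_adj_delta[OF M_diff[OF assms]] by (simp add: blinfun.diff_left)
qed

text \<open>Traciality makes the adjoint an isometry for the \<open>L\<^sup>2\<close>-norm.\<close>

lemma tendsto_adj:
  assumes "\<And>n. c n \<in> M" "y \<in> M" "(\<lambda>n. c n \<delta>) \<longlonglongrightarrow> y \<delta>"
  shows "(\<lambda>n. adj (c n) \<delta>) \<longlonglongrightarrow> adj y \<delta>"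
proof -
  have "(\<lambda>n. norm (adj (c n) \<delta> - adj y \<delta>)) \<longlonglongrightarrow> 0"
    using assms(3) by (subst norm_adj_diff) (auto simp: assms tendsto_norm_zero LIM_zero)
  then show ?thesis
    by (rule LIM_zero_cancel[OF tendsto_norm_zero_cancel])
qed

lemma Sub_vNa_D:
  assumes "P \<in> Sub_vNa \<Gamma>"
  shows "x \<in> P \<Longrightarrow> x \<in> M" "x \<in> P \<Longrightarrow> y \<in> P \<Longrightarrow> x + y \<in> P" "x \<in> P \<Longrightarrow> y \<in> P \<Longrightarrow> x o\<^sub>L y \<in> P"
    "x \<in> P \<Longrightarrow> scaleC_op c x \<in> P" "x \<in> P \<Longrightarrow> adj x \<in> P" "ell2_proj S \<in> P"
    "commutant S (commutant S P) = P"
  using assms by (auto simp: Sub_vNa_def von_neumann_algebra_def)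

lemma R_R: "g \<in> S \<Longrightarrow> h \<in> S \<Longrightarrow> R g (R h f) = R (g \<otimes> h) f"
  using R_compose[of g h] by (metis blinfun_apply_blinfun_compose)

lemma restrict_delta [simp]: "restrict_ell2 S \<delta> = \<delta>"
  by (intro coord_eqI) (auto simp: coord_ket)

end

text \<open>
  A von Neumann subalgebra \<open>P\<close> of \<open>L(\<Gamma>)\<close> with the orthogonal projection \<open>e\<close> onto \<open>L\<^sup>2(P)\<close>, the
  closure of \<open>P \<delta>\<close>.
\<close>

locale projected_subalgebra = discrete_group +
  fixes P :: "'a ell2_op set" and e :: "'a ell2_op"
  assumes P: "P \<in> Sub_vNa \<Gamma>" and e_clinear: "clinear e"
    and e_in: "e f \<in> L2_space P"
    and cinner_e: "w \<in> L2_space P \<Longrightarrow> cinner w (e f) = cinner w f"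
begin

abbreviation "K \<equiv> L2_space P"


lemmas P_simps = Sub_vNa_D(2-6)[OF P]
lemmas P_M = Sub_vNa_D(1)[OF P]

lemma P_delta: "b \<in> P \<Longrightarrow> b \<delta> \<in> K"
  by (meson closure_subset image_subset_iff)

lemma K_sequence: "w \<in> K \<Longrightarrow> \<exists>c. (\<forall>n. c n \<in> P) \<and> (\<lambda>n. c n \<delta>) \<longlonglongrightarrow> w"
proof -
  assume "w \<in> K"
  then obtain v where v_in: "\<forall>n. v n \<in> (\<lambda>b. blinfun_apply b \<delta>) ` P" and v: "v \<longlonglongrightarrow> w"
    unfolding closure_sequential by auto
  then have "\<forall>n. \<exists>b. b \<in> P \<and> v n = blinfun_apply b \<delta>"
    by blast
  from choice[OF this] obtain c where c: "\<And>n. c n \<in> P" "\<And>n. v n = c n \<delta>"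
    by auto
  then have "v = (\<lambda>n. c n \<delta>)"
    by auto
  then show ?thesis
    using c v by blast
qed

lemma K_limit:
  assumes "u \<longlonglongrightarrow> l" "\<And>n. u n \<in> K" shows "l \<in> K"
  using closed_sequentially[of K u l] assms by simp

lemma K_diff: "u \<in> K \<Longrightarrow> v \<in> K \<Longrightarrow> u - v \<in> K"
proof -
  assume "u \<in> K" "v \<in> K"
  then obtain c d where c: "\<forall>n. c n \<in> P" "(\<lambda>n. c n \<delta>) \<longlonglongrightarrow> u"
    and d: "\<forall>n. d n \<in> P" "(\<lambda>n. d n \<delta>) \<longlonglongrightarrow> v"
    using K_sequence by meson
  have "(\<lambda>n. (c n + scaleC_op (-1) (d n)) \<delta>) \<longlonglongrightarrow> u - v"
    using tendsto_diff[OF c(2) d(2)]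
    by (simp add: blinfun.add_left scaleC_op_apply scaleC_minus_one)
  moreover have "(c n + scaleC_op (-1) (d n)) \<delta> \<in> K" for n
    using c d by (intro P_delta P_simps) auto
  ultimately show ?thesis
    by (rule K_limit)
qed

lemma K_eqI:
  assumes "u \<in> K" "v \<in> K" and eq: "\<And>b. b \<in> P \<Longrightarrow> cinner (b \<delta>) u = cinner (b \<delta>) v"
  shows "u = v"
proof -
  obtain c where c: "\<forall>n. c n \<in> P" "(\<lambda>n. c n \<delta>) \<longlonglongrightarrow> u - v"
    using K_sequence K_diff assms by meson
  have "(\<lambda>n. cinner (c n \<delta>) (u - v)) \<longlonglongrightarrow> cinner (u - v) (u - v)"
    using c(2) by (rule tendsto_cinner_left)
  moreover have "cinner (c n \<delta>) (u - v) = 0" for n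
    using c eq by (simp add: cinner_diff_right)
  ultimately have "cinner (u - v) (u - v) = 0"
    by (simp add: LIMSEQ_const_iff)
  then show ?thesis
    by (simp add: cinner_self_norm)
qed

lemma one_delta: "\<delta> \<in> K"
  using P_delta[OF P_simps(5)] by (simp add: ell2_proj_apply)

lemma e_K: "w \<in> K \<Longrightarrow> e w = w"
  by (rule K_eqI) (auto simp: e_in cinner_e P_delta)

lemma e_idem [simp]: "e (e f) = e f"
  by (simp add: e_K e_in)

lemma e_delta [simp]: "e \<delta> = \<delta>"
  by (simp add: e_K one_delta)

lemma e_selfadjoint: "cinner (e f) g = cinner f (e g)"
proof -
  have "cinner (e f) g = cinner (e f) (e g)"
    by (simp add: cinner_e e_in)
  also have "\<dots> = cnj (cinner (e g) (e f))"
    by (rule cinner_commute)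
  also have "\<dots> = cinner f (e g)"
    by (simp add: cinner_e e_in flip: cinner_commute)
  finally show ?thesis .
qed

lemma e_commute:
  assumes b: "b \<in> P" shows "e (b f) = b (e f)"
proof (rule K_eqI)
  obtain c where c: "\<forall>n. c n \<in> P" "(\<lambda>n. c n \<delta>) \<longlonglongrightarrow> e f"
    using K_sequence e_in by meson
  have "(\<lambda>n. (b o\<^sub>L c n) \<delta>) \<longlonglongrightarrow> b (e f)"
    using bounded_linear.tendsto[OF blinfun.bounded_linear_right c(2), of b] by simp
  moreover have "(b o\<^sub>L c n) \<delta> \<in> K" for n
    using c b by (intro P_delta P_simps) auto
  ultimately show "b (e f) \<in> K"
    by (rule K_limit)
  fix a assume a: "a \<in> P"
  have lin: "clinear b"
    by (simp add: M_clinear P_M b)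
  have "cinner (a \<delta>) (b (e f)) = cinner ((adj b o\<^sub>L a) \<delta>) (e f)"
    using lin by (simp add: cinner_adj_left)
  also have "\<dots> = cinner ((adj b o\<^sub>L a) \<delta>) f"
    using a b by (intro cinner_e P_delta P_simps)
  also have "\<dots> = cinner (a \<delta>) (e (b f))"
    using lin by (simp add: cinner_adj_left cinner_e P_delta a)
  finally show "cinner (a \<delta>) (e (b f)) = cinner (a \<delta>) (b (e f))" ..
qed (rule e_in)

lemma norm_e: "norm (e f) \<le> norm f"
proof -
  have "(norm (e f))\<^sup>2 = cmod (cinner (e f) (e f))"
    by (simp add: cinner_self_norm norm_power)
  also have "\<dots> \<le> norm (e f) * norm f"
    by (simp add: cinner_e e_in cmod_cinner_le)
  finally show ?thesis
    by (cases "norm (e f) = 0") (auto simp: power2_eq_square mult_le_cancel_left)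
qed

text \<open>
  The modular conjugation \<open>a \<delta> \<mapsto> a\<^sup>* \<delta>\<close> is isometric and preserves \<open>P \<delta>\<close>, so it commutes with \<open>e\<close>; and it maps
  \<open>\<delta>\<^sub>g\<^sub>-\<^sub>1\<close> to \<open>\<delta>\<^sub>g\<close>.
\<close>

lemma tendsto_adj_e_ket:
  assumes g: "g \<in> S" and c: "\<And>n. c n \<in> P" and lim: "(\<lambda>n. c n \<delta>) \<longlonglongrightarrow> e (ket (inv g))"
  shows "(\<lambda>n. adj (c n) \<delta>) \<longlonglongrightarrow> e (ket g)"
proof -
  have cM: "c n \<in> M" for n
    by (rule P_M[OF c])
  have "Cauchy (\<lambda>n. c n \<delta>)"
    using lim by (rule LIMSEQ_imp_Cauchy)
  then have "Cauchy (\<lambda>n. adj (c n) \<delta>)"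
    unfolding Cauchy_iff by (simp add: norm_adj_diff cM)
  then obtain k where k: "(\<lambda>n. adj (c n) \<delta>) \<longlonglongrightarrow> k"
    using Cauchy_convergent_iff convergent_def by blast
  have "k = e (ket g)"
  proof (rule K_eqI)
    have "adj (c n) \<delta> \<in> K" for n
      using c by (intro P_delta P_simps)
    with k show "k \<in> K"
      by (rule K_limit)
    fix b assume b: "b \<in> P"
    then have bM: "b \<in> M"
      by (rule P_M)
    have "cinner (b \<delta>) (adj (c n) \<delta>) = cnj (cinner (adj b \<delta>) (c n \<delta>))" for n
    proof -
      have "cinner (adj b \<delta>) (c n \<delta>) = cinner \<delta> (c n (b \<delta>))"
        using trace_commute[OF bM cM[of n]] by (simp add: vN_trace_def cinner_adj_left M_clinear bM)
      then show ?thesis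
        by (simp add: cinner_adj_right M_clinear cM flip: cinner_commute)
    qed
    moreover have "(\<lambda>n. cnj (cinner (adj b \<delta>) (c n \<delta>))) \<longlonglongrightarrow> cnj (cinner (adj b \<delta>) (e (ket (inv g))))"
      by (intro tendsto_cnj tendsto_cinner_right lim)
    ultimately have "cinner (b \<delta>) k = cnj (cinner (adj b \<delta>) (e (ket (inv g))))"
      using LIMSEQ_unique tendsto_cinner_right[OF k, of "b \<delta>"] by auto
    also have "\<dots> = cnj (cinner (adj b \<delta>) (ket (inv g)))"
      by (simp add: cinner_e P_delta P_simps b)
    also have "\<dots> = cinner (b \<delta>) (ket g)"
      using coord_adj[OF bM inv_closed[OF g]] g by (simp add: cinner_ket_right)
    also have "\<dots> = cinner (b \<delta>) (e (ket g))"
      by (simp add: cinner_e P_delta b)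
    finally show "cinner (b \<delta>) k = cinner (b \<delta>) (e (ket g))" .
  qed (rule e_in)
  with k show ?thesis
    by simp
qed

text \<open>
  The compressions to \<open>L\<^sup>2(P)\<close> of \<open>L(\<Gamma>)\<close> and of its commutant commute. With \<open>c\<^sub>n \<delta> \<longlonglongrightarrow> e \<delta>\<^sub>g\<^sub>-\<^sub>1\<close>, both
  sides have the matrix coefficient \<open>lim \<langle>a c\<^sub>n\<^sup>* b\<^sup>* \<delta>, x \<delta>\<rangle>\<close> at \<open>(a \<delta>, b \<delta>)\<close>.
\<close>

lemma compressions_commute_delta:
  assumes x: "x \<in> M" and g: "g \<in> S" and b: "b \<in> P"
  shows "e (x (e (R g (b \<delta>)))) = e (R g (e (x (b \<delta>))))"
proof (rule K_eqI)
  fix a assume a: "a \<in> P"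
  have M: "a \<in> M" "b \<in> M"
    using a b P_M by auto
  obtain c where c: "\<And>n. c n \<in> P" and lim: "(\<lambda>n. c n \<delta>) \<longlonglongrightarrow> e (ket (inv g))"
    using K_sequence[OF e_in] by blast
  have cM: "c n \<in> M" for n
    by (rule P_M[OF c])
  have lim': "(\<lambda>n. adj (c n) \<delta>) \<longlonglongrightarrow> e (ket g)"
    by (rule tendsto_adj_e_ket[OF g c lim])
  let ?q = "\<lambda>n. cinner (a (adj (c n) (adj b \<delta>))) (x \<delta>)"
  have "R g (b \<delta>) = b (ket (inv g))"
    using M_R[OF M(2) g, of \<delta>] g by (simp add: R_ket)
  then have "e (R g (b \<delta>)) = b (e (ket (inv g)))"
    by (simp add: e_commute b)
  then have "cinner (a \<delta>) (e (x (e (R g (b \<delta>))))) = cinner (a \<delta>) (x (b (e (ket (inv g)))))"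
    by (simp add: cinner_e P_delta a)
  moreover have "(\<lambda>n. cinner (a \<delta>) (x (b (c n \<delta>)))) \<longlonglongrightarrow> cinner (a \<delta>) (x (b (e (ket (inv g)))))"
    by (intro tendsto_cinner_right bounded_linear.tendsto[OF blinfun.bounded_linear_right] lim)
  moreover have "cinner (a \<delta>) (x (b (c n \<delta>))) = ?q n" for n
    using trace_shift[OF M(1) x M_closed(2)[OF M(2) cM[of n]]]
    by (simp add: adj_compose M_clinear M cM)
  ultimately have 1: "?q \<longlonglongrightarrow> cinner (a \<delta>) (e (x (e (R g (b \<delta>)))))"
    by simp
  have "R (inv g) (a \<delta>) = a (ket g)"
    using M_R[OF M(1) inv_closed[OF g], of \<delta>] g by (simp add: R_ket)
  then have "e (R (inv g) (a \<delta>)) = a (e (ket g))"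
    by (simp add: e_commute a)
  moreover have "cinner (a \<delta>) (e (R g (e (x (b \<delta>))))) = cinner (e (R (inv g) (a \<delta>))) (x (b \<delta>))"
    using cinner_adj_left[of "R g" "a \<delta>" "e (x (b \<delta>))"] g clinear_R[OF g]
    by (simp add: cinner_e P_delta a adj_R e_selfadjoint)
  ultimately have "cinner (a \<delta>) (e (R g (e (x (b \<delta>))))) = cinner (a (e (ket g))) (x (b \<delta>))"
    by simp
  moreover have "(\<lambda>n. cinner (a (adj (c n) \<delta>)) (x (b \<delta>))) \<longlonglongrightarrow> cinner (a (e (ket g))) (x (b \<delta>))"
    by (intro tendsto_cinner_left bounded_linear.tendsto[OF blinfun.bounded_linear_right] lim')
  moreover have "cinner (a (adj (c n) \<delta>)) (x (b \<delta>)) = ?q n" for n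
    using trace_shift[OF M_closed(2)[OF M(1) M_closed(4)[OF cM[of n]]] x M(2)] by simp
  ultimately have 2: "?q \<longlonglongrightarrow> cinner (a \<delta>) (e (R g (e (x (b \<delta>)))))"
    by simp
  show "cinner (a \<delta>) (e (x (e (R g (b \<delta>))))) = cinner (a \<delta>) (e (R g (e (x (b \<delta>)))))"
    by (rule LIMSEQ_unique[OF 1 2])
qed (rule e_in)+

lemma compressions_commute:
  assumes x: "x \<in> M" and g: "g \<in> S"
  shows "e (x (e (R g (e f)))) = e (R g (e (x (e f))))"
proof -
  obtain c where c: "\<And>n. c n \<in> P" and lim: "(\<lambda>n. c n \<delta>) \<longlonglongrightarrow> e f"
    using K_sequence[OF e_in] by blast
  have "(\<lambda>n. e (x (e (R g (c n \<delta>))))) \<longlonglongrightarrow> e (x (e (R g (e f))))"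
    by (intro bounded_linear.tendsto[OF blinfun.bounded_linear_right] lim)
  moreover have "(\<lambda>n. e (R g (e (x (c n \<delta>))))) \<longlonglongrightarrow> e (R g (e (x (e f))))"
    by (intro bounded_linear.tendsto[OF blinfun.bounded_linear_right] lim)
  ultimately show ?thesis
    using compressions_commute_delta[OF x g c] LIMSEQ_unique by simp
qed

text \<open>
  Right convolution by the finitely supported function \<open>\<Sum>\<^sub>t\<^sub>\<in>\<^sub>A c\<^sub>t \<delta>\<^sub>t\<close>, so that every finitely supported
  vector is \<open>D \<delta>\<close> for such an operator \<open>D\<close> in the commutant of \<open>L(\<Gamma>)\<close>.
\<close>

definition right_conv :: "'a set \<Rightarrow> ('a \<Rightarrow> complex) \<Rightarrow> 'a ell2_op" where
  "right_conv A c = (\<Sum>t\<in>A. scaleC_op (c t) (R (inv t)))"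

definition right_conv_adj :: "'a set \<Rightarrow> ('a \<Rightarrow> complex) \<Rightarrow> 'a ell2_op" where
  "right_conv_adj A c = (\<Sum>t\<in>A. scaleC_op (cnj (c t)) (R t))"

lemma right_conv_apply: "right_conv A c f = (\<Sum>t\<in>A. c t *\<^sub>C R (inv t) f)"
  and right_conv_adj_apply: "right_conv_adj A c f = (\<Sum>t\<in>A. cnj (c t) *\<^sub>C R t f)"
  by (simp_all add: right_conv_def right_conv_adj_def blinfun.sum_left scaleC_op_apply)

lemma right_conv_delta: "A \<subseteq> S \<Longrightarrow> right_conv A c \<delta> = (\<Sum>t\<in>A. c t *\<^sub>C ket t)"
  unfolding right_conv_apply by (intro sum.cong) (auto simp: R_ket)

lemma right_conv_clinear: "A \<subseteq> S \<Longrightarrow> clinear (right_conv A c)" "A \<subseteq> S \<Longrightarrow> clinear (right_conv_adj A c)"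
  by (auto simp: right_conv_def right_conv_adj_def clinear_R intro!: clinear_sum)

lemma cinner_right_conv_adj:
  assumes "A \<subseteq> S" shows "cinner (right_conv A c f) h = cinner f (right_conv_adj A c h)"
proof -
  have "cinner (R (inv t) f) h = cinner f (R t h)" if "t \<in> A" for t
    using that assms cinner_adj_left[of "R t" f h] by (auto simp: adj_R clinear_R)
  then show ?thesis
    unfolding right_conv_apply right_conv_adj_apply
    by (simp add: cinner_sum_left cinner_sum_right cinner_scaleC_left cinner_scaleC_right)
qed

text \<open>The compression \<open>e D\<^sup>* D e\<close>: it is positive and commutes with the compression \<open>e L(\<Gamma>) e\<close>.\<close>

definition conv_gram :: "'a set \<Rightarrow> ('a \<Rightarrow> complex) \<Rightarrow> 'a ell2_op" where
  "conv_gram A c = e o\<^sub>L right_conv_adj A c o\<^sub>L right_conv A c o\<^sub>L e"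

lemma conv_gram_apply: "conv_gram A c f = e (right_conv_adj A c (right_conv A c (e f)))"
  by (simp add: conv_gram_def)

lemma conv_gram_clinear: "A \<subseteq> S \<Longrightarrow> clinear (conv_gram A c)"
  by (simp add: conv_gram_def right_conv_clinear e_clinear)

lemma cinner_conv_gram: "A \<subseteq> S \<Longrightarrow> cinner f (conv_gram A c h) = cinner (right_conv A c (e f)) (right_conv A c (e h))"
  by (simp add: conv_gram_apply cinner_right_conv_adj e_selfadjoint)

lemma conv_gram_positive: "A \<subseteq> S \<Longrightarrow> positive_op (conv_gram A c)"
  by (simp add: positive_op_iff cinner_conv_gram Re_cinner_self) (simp add: cinner_self_norm flip: of_real_power)

lemma conv_gram_commute:
  assumes A: "A \<subseteq> S" and x: "x \<in> M"
  shows "conv_gram A c (e (x (e f))) = e (x (e (conv_gram A c f)))"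
proof -
  have conv_gram: "right_conv_adj A c (right_conv A c h) = (\<Sum>s\<in>A. \<Sum>t\<in>A. (cnj (c s) * c t) *\<^sub>C R (s \<otimes> inv t) h)" for h
  proof -
    have "R s (R (inv t) h) = R (s \<otimes> inv t) h" if "s \<in> A" "t \<in> A" for s t
      using that A R_R[of s "inv t"] by auto
    then show ?thesis
      unfolding right_conv_adj_apply right_conv_apply using A
      by (simp add: blinfun.sum_right clinearD clinear_R subset_iff scaleC_sum_right)
  qed
  have xl: "clinear x"
    using x by (rule M_clinear)
  have "e (x (e (R (s \<otimes> inv t) (e f)))) = e (R (s \<otimes> inv t) (e (x (e f))))" if "s \<in> A" "t \<in> A" for s t
    using that A by (intro compressions_commute[OF x]) auto
  then show ?thesis
    unfolding conv_gram_apply e_idem conv_gram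
    by (simp add: blinfun.sum_right clinearD e_clinear xl)
qed

text \<open>
  Both estimates are instances of the positivity of a product of commuting positive operators, one of
  which is \<open>e D\<^sup>* D e\<close>. The other is \<open>\<parallel>x\<parallel>\<^sup>2 e - (e x e)\<^sup>* (e x e)\<close> for boundedness of \<open>D \<delta> \<mapsto> D e x \<delta>\<close>,
  and \<open>e x e\<close> for positivity.
\<close>

lemma norm_right_conv_e_le:
  assumes A: "A \<subseteq> S" and x: "x \<in> M"
  shows "norm (right_conv A c (e (x \<delta>))) \<le> norm x * norm (right_conv A c \<delta>)"
proof -
  let ?C = "(norm x)\<^sup>2"
  have xl: "clinear x" and axM: "adj x \<in> M"
    using x by (auto simp: M_clinear M_closed)
  define y where "y = e o\<^sub>L x o\<^sub>L e"
  define y' where "y' = e o\<^sub>L adj x o\<^sub>L e"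
  have y: "y f = e (x (e f))" and y': "y' f = e (adj x (e f))" for f
    by (simp_all add: y_def y'_def)
  have yy': "cinner f (y' h) = cinner (y f) h" for f h
    by (simp add: y y' cinner_adj_right xl flip: e_selfadjoint)
  define w where "w = ?C *\<^sub>R e - (y' o\<^sub>L y)"
  have w: "w f = complex_of_real ?C *\<^sub>C e f - y' (y f)" for f
    by (simp add: w_def blinfun.diff_left blinfun.scaleR_left scaleR_scaleC)
  have w_lin: "clinear w"
    by (simp add: w_def y_def y'_def e_clinear xl clinear_adj)
  have "positive_op w"
    unfolding positive_op_iff
  proof
    fix f
    have "norm (y f) \<le> norm (x (e f))"
      unfolding y by (rule norm_e)
    also have "\<dots> \<le> norm x * norm (e f)"
      by (rule norm_blinfun)
    finally have le: "(norm (y f))\<^sup>2 \<le> ?C * (norm (e f))\<^sup>2"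
      by (metis norm_ge_zero power_mono power_mult_distrib)
    have "cinner f (e f) = cinner (e f) (e f)"
      by (simp add: cinner_e e_in e_selfadjoint)
    then have "cinner f (w f) = complex_of_real (?C * (norm (e f))\<^sup>2 - (norm (y f))\<^sup>2)"
      by (simp add: w cinner_diff_right cinner_scaleC_right yy' cinner_self_norm)
    then show "0 \<le> Re (cinner f (w f)) \<and> Im (cinner f (w f)) = 0"
      using le by simp
  qed
  moreover have gram_y: "conv_gram A c (y f) = y (conv_gram A c f)" "conv_gram A c (y' f) = y' (conv_gram A c f)"
    "conv_gram A c (e f) = e (conv_gram A c f)" for f
    unfolding y y' by (simp_all add: conv_gram_commute[OF A x] conv_gram_commute[OF A axM]) (simp add: conv_gram_apply)
  then have "conv_gram A c (w f) = w (conv_gram A c f)" for f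
    by (simp add: w blinfun.diff_right clinearD conv_gram_clinear[OF A])
  ultimately have "0 \<le> Re (cinner \<delta> (conv_gram A c (w \<delta>)))"
    using positive_op_compose[OF conv_gram_clinear[OF A, of c] conv_gram_positive[OF A, of c] w_lin]
    by (simp add: positive_op_iff)
  also have "cinner \<delta> (conv_gram A c (w \<delta>)) = complex_of_real ?C * cinner \<delta> (conv_gram A c \<delta>) - cinner (y \<delta>) (conv_gram A c (y \<delta>))"
    by (simp add: w blinfun.diff_right clinearD conv_gram_clinear[OF A] cinner_diff_right cinner_scaleC_right gram_y yy')
  also have "Re \<dots> = ?C * (norm (right_conv A c \<delta>))\<^sup>2 - (norm (right_conv A c (e (x \<delta>))))\<^sup>2"
    by (simp add: cinner_conv_gram[OF A] cinner_self_norm y flip: of_real_power of_real_mult)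
  finally have "(norm (right_conv A c (e (x \<delta>))))\<^sup>2 \<le> (norm x * norm (right_conv A c \<delta>))\<^sup>2"
    by (simp add: power_mult_distrib)
  then show ?thesis
    by (rule power2_le_imp_le) simp
qed

lemma cinner_right_conv_e_positive:
  assumes A: "A \<subseteq> S" and x: "x \<in> M" and pos: "positive_op x"
  shows "cinner (right_conv A c \<delta>) (right_conv A c (e (x \<delta>))) \<in> \<real>\<^sub>\<ge>\<^sub>0"
proof -
  let ?y = "e o\<^sub>L x o\<^sub>L e"
  have "cinner f (?y f) = cinner (e f) (x (e f))" for f
    by (simp add: e_selfadjoint)
  then have "positive_op ?y"
    using pos by (simp add: positive_op_def)
  moreover have "clinear ?y"
    by (simp add: e_clinear M_clinear x)
  ultimately have "positive_op (conv_gram A c o\<^sub>L ?y)"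
    using positive_op_compose[OF conv_gram_clinear[OF A, of c] conv_gram_positive[OF A, of c], of ?y]
      conv_gram_commute[OF A x] by simp
  then have "cinner \<delta> ((conv_gram A c o\<^sub>L ?y) \<delta>) \<in> \<real>\<^sub>\<ge>\<^sub>0"
    unfolding positive_op_def by blast
  then show ?thesis
    by (simp add: cinner_conv_gram[OF A])
qed

text \<open>
  The elements of \<open>P\<close> approximating \<open>y \<delta>\<close> need not be bounded in operator norm. Nevertheless \<open>y\<close>
  commutes with every \<open>T \<in> P'\<close>: each matrix coefficient of \<open>y T\<close> and \<open>T y\<close> is a limit of those of
  \<open>b\<^sub>n T = T b\<^sub>n\<close>, where the first uses \<open>b\<^sub>n\<^sup>* \<delta> \<longlonglongrightarrow> y\<^sup>* \<delta>\<close>.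
\<close>

lemma in_P_if_delta_in_K:
  assumes y: "y \<in> M" and "y \<delta> \<in> K"
  shows "y \<in> P"
proof -
  obtain b where b: "\<And>n. b n \<in> P" and lim: "(\<lambda>n. b n \<delta>) \<longlonglongrightarrow> y \<delta>"
    using K_sequence[OF assms(2)] by blast
  have bM: "b n \<in> M" for n
    by (rule P_M[OF b])
  have lim': "(\<lambda>n. adj (b n) \<delta>) \<longlonglongrightarrow> adj y \<delta>"
    by (rule tendsto_adj[OF bM y lim])
  have "y o\<^sub>L T = T o\<^sub>L y" if T: "T \<in> commutant S P" for T
  proof (rule bounded_ops_eq_on_kets)
    have Tb: "T \<in> bounded_ops S" and TP: "\<And>a f. a \<in> P \<Longrightarrow> T (a f) = a (T f)"
      using T by (auto simp: commutant_iff)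
    have yb: "y \<in> bounded_ops S"
      by (rule M_bounded_ops[OF y])
    show "y o\<^sub>L T \<in> bounded_ops S" "T o\<^sub>L y \<in> bounded_ops S"
      by (simp_all add: bounded_ops_closed yb Tb)
    fix t assume t: "t \<in> S"
    have "coord (y (T (ket t))) s = coord (T (y (ket t))) s" if s: "s \<in> S" for s
    proof (rule LIMSEQ_unique)
      have "(\<lambda>n. cinner (R (inv s) (adj (b n) \<delta>)) (T (ket t)))
          \<longlonglongrightarrow> cinner (R (inv s) (adj y \<delta>)) (T (ket t))"
        by (intro tendsto_cinner_left bounded_linear.tendsto[OF blinfun.bounded_linear_right] lim')
      moreover have "cinner (R (inv s) (adj a \<delta>)) h = coord (a h) s" if "a \<in> M" for a h
        unfolding M_ket[OF M_closed(4)[OF that] s, symmetric]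
        using that by (simp add: cinner_adj_left M_clinear cinner_ket_left)
      ultimately show "(\<lambda>n. coord (b n (T (ket t))) s) \<longlonglongrightarrow> coord (y (T (ket t))) s"
        using bM y by simp
      have "(\<lambda>n. cinner (ket s) (T (R (inv t) (b n \<delta>)))) \<longlonglongrightarrow> cinner (ket s) (T (R (inv t) (y \<delta>)))"
        by (intro tendsto_cinner_right bounded_linear.tendsto[OF blinfun.bounded_linear_right] lim)
      then show "(\<lambda>n. coord (b n (T (ket t))) s) \<longlonglongrightarrow> coord (T (y (ket t))) s"
        by (simp add: cinner_ket_left TP b M_ket[OF bM t, symmetric] M_ket[OF y t, symmetric])
    qed
    then show "(y o\<^sub>L T) (ket t) = (T o\<^sub>L y) (ket t)"
      using coord_bounded_ops_outside[OF yb] coord_bounded_ops_outside[OF Tb]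
      by (metis blinfun_apply_blinfun_compose coord_eqI)
  qed
  then have "y \<in> commutant S (commutant S P)"
    unfolding commutant_def[of S "commutant S P"] using M_bounded_ops[OF y] by blast
  then show ?thesis
    using Sub_vNa_D(7)[OF P] by simp
qed

text \<open>
  The conditional expectation of \<open>x\<close> is the operator of left convolution by \<open>e x \<delta>\<close>, determined by
  \<open>\<delta>\<^sub>t \<mapsto> R(t\<^sup>-\<^sup>1) e x \<delta>\<close>. It commutes with right translations and its vector lies in \<open>L\<^sup>2(P)\<close>.
\<close>

lemma ex_cond_exp_value:
  assumes x: "x \<in> M"
  shows "\<exists>y\<in>P. blinfun_apply y \<delta> = e (x \<delta>) \<and> (positive_op x \<longrightarrow> positive_op y)"
proof -
  let ?\<xi> = "e (x \<delta>)"
  let ?v = "\<lambda>t. if t \<in> S then R (inv t) ?\<xi> else 0"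
  have v_sum: "(\<Sum>t\<in>A. c t *\<^sub>C ?v t) = right_conv (A \<inter> S) c ?\<xi>" if "finite A" for A c
    unfolding right_conv_apply using that by (intro sum.mono_neutral_cong_right) auto
  have "norm (\<Sum>t\<in>A. c t *\<^sub>C ?v t) \<le> norm x * norm (\<Sum>t\<in>A. c t *\<^sub>C ket t)" if A: "finite A" for A c
  proof -
    have "(norm (\<Sum>t\<in>A \<inter> S. c t *\<^sub>C ket t))\<^sup>2 \<le> (norm (\<Sum>t\<in>A. c t *\<^sub>C ket t))\<^sup>2"
      using A by (simp add: norm_sum_kets sum_mono2)
    then have "norm (\<Sum>t\<in>A \<inter> S. c t *\<^sub>C ket t) \<le> norm (\<Sum>t\<in>A. c t *\<^sub>C ket t)"
      by (rule power2_le_imp_le) simp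
    then have "norm x * norm (right_conv (A \<inter> S) c \<delta>) \<le> norm x * norm (\<Sum>t\<in>A. c t *\<^sub>C ket t)"
      by (intro mult_left_mono) (simp_all add: right_conv_delta)
    then show ?thesis
      unfolding v_sum[OF A] using norm_right_conv_e_le[of "A \<inter> S" x c] x by simp
  qed
  from ex_op_of_columns[OF norm_ge_zero this]
  obtain y where y: "clinear y" "\<And>t. y (ket t) = ?v t"
    by blast
  have \<xi>: "restrict_ell2 S ?\<xi> = ?\<xi>"
    using e_commute[OF P_simps(5), of "x \<delta>"] bounded_ops_restrict(1)[OF M_bounded_ops[OF x], of \<delta>]
    by (simp add: ell2_proj_apply)
  have y\<delta>: "y \<delta> = ?\<xi>"
    by (simp add: y R_one ell2_proj_apply \<xi>)
  have yb: "y \<in> bounded_ops S"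
  proof (rule bounded_opsI)
    show "coord (y (ket t)) s = 0" if "t \<in> S" "s \<notin> S" for s t
      using coord_bounded_ops_outside[OF R_bounded_ops[of "inv t"] \<open>s \<notin> S\<close>] that by (simp add: y)
  qed (auto simp: y)
  have "y o\<^sub>L R g = R g o\<^sub>L y" if g: "g \<in> S" for g
  proof (rule bounded_ops_eq_on_kets)
    fix t assume t: "t \<in> S"
    have "R (inv (t \<otimes> inv g)) ?\<xi> = R g (R (inv t) ?\<xi>)"
      using R_R[of g "inv t"] g t by (simp add: inv_mult_group)
    then show "(y o\<^sub>L R g) (ket t) = (R g o\<^sub>L y) (ket t)"
      using g t by (simp add: R_ket y)
  qed (auto simp: bounded_ops_closed yb R_bounded_ops g)
  then have yM: "y \<in> M"
    unfolding group_vNa_eq_commutant_R using yb by (auto simp: commutant_def)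
  have "y \<in> P"
    by (rule in_P_if_delta_in_K[OF yM]) (simp add: y\<delta> e_in)
  moreover have "positive_op y" if pos: "positive_op x"
    unfolding positive_op_def
  proof
    fix f
    let ?f = "restrict_ell2 S f"
    let ?q = "\<lambda>A. cinner (restrict_ell2 A ?f) (y (restrict_ell2 A ?f))"
    have "?q A \<in> \<real>\<^sub>\<ge>\<^sub>0" if A: "finite A" for A
    proof -
      have r: "restrict_ell2 A ?f = (\<Sum>t\<in>A \<inter> S. coord f t *\<^sub>C ket t)"
        unfolding restrict_ell2_sum_ket[OF A] using A by (intro sum.mono_neutral_cong_right) auto
      then have "restrict_ell2 A ?f = right_conv (A \<inter> S) (coord f) \<delta>"
        by (simp add: right_conv_delta)
      moreover have "y (restrict_ell2 A ?f) = right_conv (A \<inter> S) (coord f) ?\<xi>"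
        unfolding r right_conv_apply by (simp add: blinfun.sum_right clinearD y)
      ultimately show ?thesis
        using cinner_right_conv_e_positive[OF _ x pos] by simp
    qed
    then have "eventually (\<lambda>A. ?q A \<in> \<real>\<^sub>\<ge>\<^sub>0) (finite_subsets_at_top UNIV)"
      by (rule eventually_finite_subsets_at_top_weakI)
    moreover have "(?q \<longlongrightarrow> cinner ?f (y ?f)) (finite_subsets_at_top UNIV)"
      by (intro tendsto_cinner bounded_linear.tendsto[OF blinfun.bounded_linear_right]
          tendsto_restrict_ell2)
    ultimately have "cinner ?f (y ?f) \<in> \<real>\<^sub>\<ge>\<^sub>0"
      by (intro Lim_in_closed_set[OF closed_nonneg_Reals_complex]) auto
    then show "cinner f (y f) \<in> \<real>\<^sub>\<ge>\<^sub>0"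
      using bounded_ops_restrict[OF yb] by (simp add: cinner_restrict)
  qed
  ultimately show ?thesis
    using y\<delta> by blast
qed

end

context discrete_group
begin

theorem ex_cond_exp:
  assumes P: "P \<in> Sub_vNa \<Gamma>" and x: "x \<in> M"
  shows "\<exists>y\<in>P. (\<forall>b\<in>P. cinner (blinfun_apply b \<delta>) (blinfun_apply y \<delta>) = cinner (blinfun_apply b \<delta>) (x \<delta>)) \<and> (positive_op x \<longrightarrow> positive_op y)"
proof -
  let ?V = "(\<lambda>b. blinfun_apply b \<delta>) ` P"
  have V_scale: "c *\<^sub>C f \<in> ?V" if f: "f \<in> ?V" for c f
  proof -
    obtain b where b: "b \<in> P" "f = blinfun_apply b \<delta>"
      using f by blast
    then have "scaleC_op c b \<in> P" "c *\<^sub>C f = scaleC_op c b \<delta>"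
      by (auto simp: Sub_vNa_D[OF P] scaleC_op_apply)
    then show ?thesis
      by blast
  qed
  have "subspace ?V"
  proof (rule subspaceI)
    show "f + g \<in> ?V" if fg: "f \<in> ?V" "g \<in> ?V" for f g
    proof -
      obtain a b where "a \<in> P" "f = blinfun_apply a \<delta>" "b \<in> P" "g = blinfun_apply b \<delta>"
        using fg by blast
      then have "a + b \<in> P" "f + g = (a + b) \<delta>"
        by (auto simp: Sub_vNa_D[OF P] blinfun.add_left)
      then show ?thesis
        by blast
    qed
    show "r *\<^sub>R f \<in> ?V" if "f \<in> ?V" for r f
      using V_scale[OF that, of "complex_of_real r"] unfolding scaleR_scaleC .
    have "ell2_proj S \<delta> \<in> ?V"
      using Sub_vNa_D(6)[OF P] by blast
    from V_scale[OF this, of 0] show "0 \<in> ?V"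
      by simp
  qed
  then have "subspace (closure ?V)"
    by (rule subspace_closure_normed)
  moreover have "c *\<^sub>C f \<in> closure ?V" if "f \<in> closure ?V" for c f
  proof -
    have "(*\<^sub>C) c ` closure ?V \<subseteq> closure ((*\<^sub>C) c ` ?V)"
      by (rule closure_bounded_linear_image_subset[OF bounded_linear_scaleC])
    also have "\<dots> \<subseteq> closure ?V"
      using V_scale by (intro closure_mono) blast
    finally show ?thesis
      using that by blast
  qed
  ultimately obtain e where "clinear e" "\<And>f. e f \<in> closure ?V"
      "\<And>f w. w \<in> closure ?V \<Longrightarrow> cinner w (e f) = cinner w f"
    using ex_projection_op[of "closure ?V"] closed_closure by metis
  then interpret projected_subalgebra \<Gamma> P e
    using P by unfold_locales auto
  obtain y where "y \<in> P" "y \<delta> = e (x \<delta>)" "positive_op x \<longrightarrow> positive_op y"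
    using ex_cond_exp_value[OF x] by blast
  then show ?thesis
    by (intro bexI[of _ y]) (auto simp: cinner_e P_delta)
qed

lemma L2_projection_unique:
  assumes P: "P \<in> Sub_vNa \<Gamma>" and y: "y \<in> P" "z \<in> P"
    and eq: "\<And>b. b \<in> P \<Longrightarrow> cinner (b \<delta>) (y \<delta>) = cinner (b \<delta>) (z \<delta>)"
  shows "y = z"
proof (rule M_eqI)
  have "y + scaleC_op (-1) z \<in> P"
    using y by (intro Sub_vNa_D[OF P])
  from eq[OF this] have "cinner (y \<delta> - z \<delta>) (y \<delta> - z \<delta>) = 0"
    by (simp add: blinfun.add_left scaleC_op_apply scaleC_minus_one cinner_diff_right)
  then show "y \<delta> = z \<delta>"
    by (simp add: cinner_self_norm)
qed (use y Sub_vNa_D(1)[OF P] in auto)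

text \<open>
  An expectation onto \<open>P\<close> satisfies \<open>\<tau>(b\<^sup>* E(x)) = \<tau>(E(b\<^sup>* x)) = \<tau>(b\<^sup>* x)\<close>, so on \<open>\<delta>\<close> it is the orthogonal
  projection onto \<open>L\<^sup>2(P)\<close> and hence unique. Conversely all the defining properties are read off from
  this orthogonality.
\<close>

theorem cond_exp:
  assumes P: "P \<in> Sub_vNa \<Gamma>" and x: "x \<in> M"
  shows cond_exp_in: "cond_exp \<Gamma> P x \<in> P"
    and cinner_cond_exp: "b \<in> P \<Longrightarrow> cinner (b \<delta>) (cond_exp \<Gamma> P x \<delta>) = cinner (b \<delta>) (x \<delta>)"
proof -
  let ?pr = "\<lambda>(x :: 'a ell2_op) (y :: 'a ell2_op). y \<in> P \<and>
    (\<forall>b\<in>P. cinner (blinfun_apply b \<delta>) (y \<delta>) = cinner (blinfun_apply b \<delta>) (x \<delta>))"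
  note PD = Sub_vNa_D[OF P]
  have uniq: "y = z" if "?pr x y" "?pr x z" for x y z
    using that by (intro L2_projection_unique[OF P]) auto
  define E where "E = (\<lambda>x\<in>M. SOME y. ?pr x y \<and> (positive_op x \<longrightarrow> positive_op y))"
  have E: "?pr x (E x)" "positive_op x \<Longrightarrow> positive_op (E x)" if "x \<in> M" for x
    using someI_ex[of "\<lambda>y. ?pr x y \<and> (positive_op x \<longrightarrow> positive_op y)"] ex_cond_exp[OF P that] that
    unfolding E_def by auto
  have EP: "E x \<in> P" if "x \<in> M" for x
    using E that by blast
  have E_eq: "E x = y" if "x \<in> M" "?pr x y" for x y
    by (rule uniq[OF E(1)[OF that(1)] that(2)])
  have isE: "is_cond_exp \<Gamma> P E"
    unfolding is_cond_exp_def
  proof (intro conjI ballI impI allI)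
    show "E ` M \<subseteq> P"
      using EP by blast
    show "E (x + y) = E x + E y" if "x \<in> M" "y \<in> M" for x y
      using that E by (intro E_eq) (auto simp: M_closed PD blinfun.add_left cinner_add_right)
    show "E (scaleC_op c x) = scaleC_op c (E x)" if "x \<in> M" for x c
      using that E by (intro E_eq) (auto simp: M_closed PD scaleC_op_apply cinner_scaleC_right)
    show "positive_op (E x)" if "x \<in> M" "positive_op x" for x
      using that E by blast
    show "E x = x" if "x \<in> P" for x
      using that PD by (intro E_eq) auto
    show "vN_trace \<Gamma> (E x) = vN_trace \<Gamma> x" if "x \<in> M" for x
      using E(1)[OF that] PD(6) unfolding vN_trace_def by (force simp: ell2_proj_apply)
    show "E (a o\<^sub>L x o\<^sub>L b) = a o\<^sub>L E x o\<^sub>L b" if x: "x \<in> M" and a: "a \<in> P" and b: "b \<in> P" for x a b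
    proof (rule E_eq)
      have shift: "cinner (c \<delta>) ((a o\<^sub>L z o\<^sub>L b) \<delta>) = cinner (((adj a o\<^sub>L c) o\<^sub>L adj b) \<delta>) (z \<delta>)"
        if "c \<in> P" "z \<in> M" for c z
        using trace_shift[of "adj a o\<^sub>L c" z b] that a b PD
        by (simp add: M_closed cinner_adj_left M_clinear)
      have "cinner (c \<delta>) ((a o\<^sub>L E x o\<^sub>L b) \<delta>) = cinner (c \<delta>) ((a o\<^sub>L x o\<^sub>L b) \<delta>)" if c: "c \<in> P" for c
      proof -
        have "(adj a o\<^sub>L c) o\<^sub>L adj b \<in> P"
          using a b c by (intro PD)
        then show ?thesis
          unfolding shift[OF c x] shift[OF c PD(1)[OF EP[OF x]]] using E(1)[OF x] by blast
      qed
      then show "?pr (a o\<^sub>L x o\<^sub>L b) (a o\<^sub>L E x o\<^sub>L b)"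
        using PD(3)[OF PD(3)[OF a EP[OF x]] b] by blast
    qed (use x a b PD(1) in \<open>auto simp: M_closed\<close>)
  qed
  have uniqE: "F = E" if F: "F \<in> extensional M" "is_cond_exp \<Gamma> P F" for F
  proof (rule extensionalityI[OF F(1)])
    have F_P: "F ` M \<subseteq> P"
      using F(2) unfolding is_cond_exp_def by (elim conjE) assumption
    have F_trace: "\<forall>x\<in>M. vN_trace \<Gamma> (F x) = vN_trace \<Gamma> x"
      using F(2) unfolding is_cond_exp_def by (elim conjE) assumption
    have F_bimodule: "\<forall>x\<in>M. \<forall>a\<in>P. \<forall>b\<in>P. F (a o\<^sub>L x o\<^sub>L b) = a o\<^sub>L F x o\<^sub>L b"
      using F(2) unfolding is_cond_exp_def by (elim conjE) assumption
    fix x assume x: "x \<in> M"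
    have "cinner (b \<delta>) (F x \<delta>) = cinner (b \<delta>) (x \<delta>)" if b: "b \<in> P" for b
    proof -
      have bl: "clinear b"
        using PD(1)[OF b] M_clinear by blast
      have "F (adj b o\<^sub>L x o\<^sub>L ell2_proj S) = adj b o\<^sub>L F x o\<^sub>L ell2_proj S"
        using F_bimodule x PD(5)[OF b] PD(6) by blast
      moreover have "adj b o\<^sub>L x o\<^sub>L ell2_proj S \<in> M"
        using x b PD by (simp add: M_closed)
      ultimately have "vN_trace \<Gamma> (adj b o\<^sub>L F x o\<^sub>L ell2_proj S) = vN_trace \<Gamma> (adj b o\<^sub>L x o\<^sub>L ell2_proj S)"
        using F_trace by metis
      then show ?thesis
        by (simp add: vN_trace_def ell2_proj_apply cinner_adj_right bl)
    qed
    moreover have "F x \<in> P"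
      by (rule subsetD[OF F_P imageI[OF x]])
    ultimately have "?pr x (F x)"
      by simp
    then show "F x = E x"
      by (rule E_eq[OF x, symmetric])
  qed (simp add: E_def)
  have "cond_exp \<Gamma> P = E"
    unfolding cond_exp_def
  proof (rule the_equality)
    show "E \<in> extensional M \<and> is_cond_exp \<Gamma> P E"
      using isE by (simp add: E_def)
  qed (rule uniqE; elim conjE; assumption)
  then show "cond_exp \<Gamma> P x \<in> P" "b \<in> P \<Longrightarrow> cinner (b \<delta>) (cond_exp \<Gamma> P x \<delta>) = cinner (b \<delta>) (x \<delta>)"
    using E(1)[OF x] by auto
qed

lemma cond_exp_eqI:
  assumes P: "P \<in> Sub_vNa \<Gamma>" and x: "x \<in> M" and y: "y \<in> P"
    and eq: "\<And>b. b \<in> P \<Longrightarrow> cinner (b \<delta>) (y \<delta>) = cinner (b \<delta>) (x \<delta>)"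
  shows "cond_exp \<Gamma> P x = y"
  using cond_exp[OF P x] y eq by (intro L2_projection_unique[OF P]) auto

end

section \<open>Automorphisms of \<open>\<Gamma>\<close> acting on \<open>L(\<Gamma>)\<close>\<close>

lemma autoD:
  assumes "\<phi> \<in> auto \<Gamma>"
  shows "bij_betw \<phi> (carrier \<Gamma>) (carrier \<Gamma>)"
    and "t \<in> carrier \<Gamma> \<Longrightarrow> \<phi> t \<in> carrier \<Gamma>"
    and "s \<in> carrier \<Gamma> \<Longrightarrow> t \<in> carrier \<Gamma> \<Longrightarrow> \<phi> (s \<otimes>\<^bsub>\<Gamma>\<^esub> t) = \<phi> s \<otimes>\<^bsub>\<Gamma>\<^esub> \<phi> t"
    and "\<phi> \<in> extensional (carrier \<Gamma>)"
  using assms by (auto simp: auto_def Bij_def hom_def)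

context discrete_group
begin

lemma auto_one: "\<phi> \<in> auto \<Gamma> \<Longrightarrow> \<phi> \<one> = \<one>"
  using hom_one[of \<phi> \<Gamma>] is_group by (auto simp: auto_def)

lemma auto_inv: "\<phi> \<in> auto \<Gamma> \<Longrightarrow> t \<in> S \<Longrightarrow> \<phi> (inv t) = inv (\<phi> t)"
  using autoD(3)[of \<phi> \<Gamma> "inv t" t] auto_one[of \<phi>] autoD(2)[of \<phi> \<Gamma>]
  by (simp add: inv_equality)

lemma auto_surjE:
  assumes "\<phi> \<in> auto \<Gamma>" "u \<in> S" obtains t where "t \<in> S" "u = \<phi> t"
proof -
  have "u \<in> \<phi> ` S"
    using bij_betw_imp_surj_on[OF autoD(1)[OF assms(1)]] assms(2) by simp
  then show ?thesis
    using that by blast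
qed

definition aut_op :: "('a \<Rightarrow> 'a) \<Rightarrow> 'a ell2_op" where
  "aut_op \<phi> = perm_op S \<phi>"

abbreviation "U \<equiv> aut_op"

lemma U_bounded_ops: "\<phi> \<in> auto \<Gamma> \<Longrightarrow> U \<phi> \<in> bounded_ops S"
  unfolding aut_op_def by (rule perm_op_bounded_ops[OF autoD(1)])

lemma U_ket: "\<phi> \<in> auto \<Gamma> \<Longrightarrow> t \<in> S \<Longrightarrow> U \<phi> (ket t) = ket (\<phi> t)"
  unfolding aut_op_def by (simp add: perm_op_ket bij_betw_imp_inj_on[OF autoD(1)])

lemma coord_U: "\<phi> \<in> auto \<Gamma> \<Longrightarrow> t \<in> S \<Longrightarrow> coord (U \<phi> f) (\<phi> t) = coord f t"
  unfolding aut_op_def by (rule coord_perm_op[OF autoD(1)])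

lemma U_clinear: "\<phi> \<in> auto \<Gamma> \<Longrightarrow> clinear (U \<phi>)"
  using U_bounded_ops bounded_ops_clinear by blast

lemma adj_U: "\<phi> \<in> auto \<Gamma> \<Longrightarrow> adj (U \<phi>) = perm_op S (inv_into S \<phi>)"
  unfolding aut_op_def
  by (rule adj_perm_op) (auto simp: autoD(1) bij_betw_inv_into[OF autoD(1)] bij_betw_inv_into_left[OF autoD(1)])

lemma U_adj_U:
  assumes "\<phi> \<in> auto \<Gamma>"
  shows "adj (U \<phi>) (U \<phi> f) = restrict_ell2 S f" and "U \<phi> (adj (U \<phi>) f) = restrict_ell2 S f"
proof -
  note \<phi> = autoD(1)[OF assms]
  have 1: "perm_op S (inv_into S \<phi>) o\<^sub>L perm_op S \<phi> = ell2_proj S"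
    by (subst perm_op_compose[OF bij_betw_inv_into[OF \<phi>] \<phi>])
      (rule perm_op_id, simp add: bij_betw_inv_into_left[OF \<phi>])
  have 2: "perm_op S \<phi> o\<^sub>L perm_op S (inv_into S \<phi>) = ell2_proj S"
    by (subst perm_op_compose[OF \<phi> bij_betw_inv_into[OF \<phi>]])
      (rule perm_op_id, simp add: bij_betw_inv_into_right[OF \<phi>])
  show "adj (U \<phi>) (U \<phi> f) = restrict_ell2 S f"
    unfolding adj_U[OF assms] unfolding aut_op_def ell2_proj_apply[symmetric] 1[symmetric] by simp
  show "U \<phi> (adj (U \<phi>) f) = restrict_ell2 S f"
    unfolding adj_U[OF assms] unfolding aut_op_def ell2_proj_apply[symmetric] 2[symmetric] by simp
qed

lemma U_R: "\<phi> \<in> auto \<Gamma> \<Longrightarrow> h \<in> S \<Longrightarrow> U \<phi> (R h f) = R (\<phi> h) (U \<phi> f)"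
proof -
  assume \<phi>: "\<phi> \<in> auto \<Gamma>" and h: "h \<in> S"
  have "U \<phi> o\<^sub>L R h = R (\<phi> h) o\<^sub>L U \<phi>"
    by (rule bounded_ops_eq_on_kets[where A = S])
      (auto simp: \<phi> h bounded_ops_closed U_bounded_ops R_bounded_ops autoD(2,3)[OF \<phi>] R_ket U_ket auto_inv)
  then show ?thesis
    by (metis blinfun_apply_blinfun_compose)
qed

lemma adj_U_R: "\<phi> \<in> auto \<Gamma> \<Longrightarrow> h \<in> S \<Longrightarrow> adj (U \<phi>) (R (\<phi> h) f) = R h (adj (U \<phi>) f)"
proof -
  assume \<phi>: "\<phi> \<in> auto \<Gamma>" and h: "h \<in> S"
  have "adj (U \<phi>) (R (\<phi> h) f) = adj (U \<phi>) (R (\<phi> h) (U \<phi> (adj (U \<phi>) f)))"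
    by (simp add: U_adj_U \<phi> bounded_ops_restrict[OF R_bounded_ops[OF autoD(2)[OF \<phi> h]]])
  also have "\<dots> = R h (adj (U \<phi>) f)"
    by (simp add: U_R[OF \<phi> h, symmetric] U_adj_U(1)[OF \<phi>] bounded_ops_restrict[OF R_bounded_ops[OF h]])
  finally show ?thesis .
qed

definition lift :: "('a \<Rightarrow> 'a) \<Rightarrow> 'a ell2_op \<Rightarrow> 'a ell2_op" where
  "lift \<phi> x = U \<phi> o\<^sub>L x o\<^sub>L adj (U \<phi>)"

lemma lift_in_M:
  assumes \<phi>: "\<phi> \<in> auto \<Gamma>" and x: "x \<in> M"
  shows "lift \<phi> x \<in> M"
  unfolding M_iff
proof (intro conjI ballI allI)
  show "lift \<phi> x \<in> bounded_ops S"
    unfolding lift_def by (intro bounded_ops_closed U_bounded_ops \<phi> M_bounded_ops x)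
  fix g f assume "g \<in> S"
  then obtain h where h: "h \<in> S" "g = \<phi> h"
    by (rule auto_surjE[OF \<phi>])
  show "lift \<phi> x (R g f) = R g (lift \<phi> x f)"
    unfolding lift_def h(2)
    by (simp add: adj_U_R[OF \<phi> h(1)] M_R[OF x h(1)] U_R[OF \<phi> h(1)])
qed

lemma lift_delta: "\<phi> \<in> auto \<Gamma> \<Longrightarrow> lift \<phi> x \<delta> = U \<phi> (x \<delta>)"
  using U_adj_U(1)[of \<phi> \<delta>] by (simp add: lift_def U_ket auto_one)

lemma lift_L:
  assumes \<phi>: "\<phi> \<in> auto \<Gamma>" and s: "s \<in> S" shows "lift \<phi> (L s) = L (\<phi> s)"
  by (rule M_eqI)
    (auto simp: lift_in_M L_in_M autoD(2)[OF \<phi>] \<phi> s lift_delta L_ket U_ket)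

lemma M_restrict: "x \<in> M \<Longrightarrow> x (restrict_ell2 S f) = x f" "x \<in> M \<Longrightarrow> restrict_ell2 S (x f) = x f"
  using bounded_ops_restrict[OF M_bounded_ops] by blast+

lemma lift_compose:
  "\<phi> \<in> auto \<Gamma> \<Longrightarrow> x \<in> M \<Longrightarrow> y \<in> M \<Longrightarrow> lift \<phi> (x o\<^sub>L y) = lift \<phi> x o\<^sub>L lift \<phi> y"
  by (rule blinfun_eqI) (simp add: lift_def U_adj_U M_restrict)

lemma adj_lift: "\<phi> \<in> auto \<Gamma> \<Longrightarrow> x \<in> M \<Longrightarrow> adj (lift \<phi> x) = lift \<phi> (adj x)"
  by (rule blinfun_eqI) (simp add: lift_def adj_compose adj_adj U_clinear M_clinear clinear_adj)

lemma M_sum: "finite I \<Longrightarrow> (\<And>i. i \<in> I \<Longrightarrow> x i \<in> M) \<Longrightarrow> sum x I \<in> M"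
proof (induction I rule: finite_induct)
  case empty
  have "(0 :: 'a ell2_op) = scaleC_op 0 (ell2_proj S)"
    by (rule blinfun_eqI) (simp add: scaleC_op_apply)
  then show ?case
    using M_closed(3)[OF M_closed(5), of 0] by simp
qed (auto simp: M_closed)

lemma bij_lift:
  assumes \<phi>: "\<phi> \<in> auto \<Gamma>" shows "bij_betw (lift \<phi>) M M"
proof (rule bij_betwI[where g = "lift (restrict (inv_into S \<phi>) S)"])
  let ?\<psi> = "restrict (inv_into S \<phi>) S"
  have \<psi>: "?\<psi> \<in> auto \<Gamma>"
    using \<phi> by (simp add: auto_def restrict_inv_into_hom restrict_inv_into_Bij)
  have U\<psi>: "U ?\<psi> = adj (U \<phi>)"
    unfolding adj_U[OF \<phi>] unfolding aut_op_def by (rule perm_op_cong) simp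
  have adjU\<psi>: "adj (U ?\<psi>) = U \<phi>"
    unfolding U\<psi> by (rule adj_adj[OF U_clinear[OF \<phi>]])
  show "lift \<phi> \<in> M \<rightarrow> M" "lift ?\<psi> \<in> M \<rightarrow> M"
    using lift_in_M \<phi> \<psi> by auto
  show "lift ?\<psi> (lift \<phi> x) = x" if "x \<in> M" for x
    unfolding lift_def[of ?\<psi>] adjU\<psi> unfolding U\<psi>
    by (rule blinfun_eqI) (simp add: lift_def U_adj_U \<phi> M_restrict that)
  show "lift \<phi> (lift ?\<psi> x) = x" if "x \<in> M" for x
    unfolding lift_def[of ?\<psi>] adjU\<psi> unfolding U\<psi>
    by (rule blinfun_eqI) (simp add: lift_def U_adj_U \<phi> M_restrict that)
qed

lemma trace_lift: "\<phi> \<in> auto \<Gamma> \<Longrightarrow> vN_trace \<Gamma> (lift \<phi> x) = vN_trace \<Gamma> x"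
  using coord_U[of \<phi> \<one> "x \<delta>"] by (simp add: vN_trace_def lift_delta cinner_ket_left auto_one)

text \<open>
  A trace-preserving automorphism that maps \<open>\<lambda>\<^sub>s\<close> to \<open>\<lambda>\<^sub>\<phi>\<^sub>(\<^sub>s\<^sub>)\<close> permutes the Fourier coefficients
  \<open>\<tau>(\<lambda>\<^sub>s\<^sup>* x)\<close>, hence is unique; conjugation by \<open>U\<^sub>\<phi>\<close> is one.
\<close>

lemma vNa_extension_eq:
  assumes \<phi>: "\<phi> \<in> auto \<Gamma>" and x: "x \<in> M"
  shows "vNa_extension \<Gamma> \<phi> x = lift \<phi> x"
proof -
  let ?Q = "\<lambda>\<alpha>. trace_preserving_automorphism \<Gamma> \<alpha> \<and> (\<forall>s\<in>S. \<alpha> (L s) = L (\<phi> s))"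
  have coords: "coord (\<alpha> x \<delta>) (\<phi> s) = coord (x \<delta>) s"
    if Q: "?Q \<alpha>" and x: "x \<in> M" and s: "s \<in> S" for \<alpha> x s
  proof -
    have mult: "\<forall>x\<in>M. \<forall>y\<in>M. \<alpha> (x + y) = \<alpha> x + \<alpha> y \<and> \<alpha> (x o\<^sub>L y) = \<alpha> x o\<^sub>L \<alpha> y"
      and star: "\<forall>x\<in>M. \<alpha> (adj x) = adj (\<alpha> x)"
      and tr: "\<forall>x\<in>M. vN_trace \<Gamma> (\<alpha> x) = vN_trace \<Gamma> x"
      using Q unfolding trace_preserving_automorphism_def by simp_all
    have Fourier: "coord (z \<delta>) t = vN_trace \<Gamma> (adj (L t) o\<^sub>L z)" if "t \<in> S"
      for z :: "'a ell2_op" and t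
      using that cinner_adj_right[OF M_clinear[OF L_in_M[OF that]], of \<delta> "z \<delta>"]
      by (simp add: vN_trace_def L_ket cinner_ket_left)
    have "adj (L (\<phi> s)) o\<^sub>L \<alpha> x = \<alpha> (adj (L s) o\<^sub>L x)"
      using Q mult star x s by (simp add: L_in_M M_closed)
    then show ?thesis
      using tr x s autoD(2)[OF \<phi> s] by (simp add: Fourier L_in_M M_closed)
  qed
  have lift: "?Q (restrict (lift \<phi>) M)"
    unfolding trace_preserving_automorphism_def
    using bij_lift[OF \<phi>] \<phi>
    by (auto simp: M_closed lift_compose adj_lift trace_lift lift_L L_in_M bij_betw_restrict_eq)
      (auto simp: lift_def blinfun_eq_pointwise blinfun.add_left blinfun.add_right scaleC_op_apply clinearD U_clinear)
  have uniq: "\<alpha> = restrict (lift \<phi>) M" if \<alpha>: "\<alpha> \<in> extensional M" "?Q \<alpha>" for \<alpha>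
  proof (rule extensionalityI[OF \<alpha>(1)])
    fix z assume z: "z \<in> M"
    have \<alpha>z: "\<alpha> z \<in> M"
      using \<alpha>(2) z unfolding trace_preserving_automorphism_def by (metis bij_betwE)
    have "coord (\<alpha> z \<delta>) t = coord (lift \<phi> z \<delta>) t" for t
    proof (cases "t \<in> S")
      case True
      then obtain s where "s \<in> S" "t = \<phi> s"
        by (rule auto_surjE[OF \<phi>])
      then show ?thesis
        using coords[OF \<alpha>(2) z] coords[OF lift z] z by simp
    qed (simp add: coord_bounded_ops_outside[OF M_bounded_ops[OF \<alpha>z]]
        coord_bounded_ops_outside[OF M_bounded_ops[OF lift_in_M[OF \<phi> z]]])
    then have "\<alpha> z = lift \<phi> z"
      by (intro M_eqI \<alpha>z lift_in_M \<phi> z coord_eqI)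
    then show "\<alpha> z = restrict (lift \<phi>) M z"
      using z by simp
  qed simp
  have "vNa_extension \<Gamma> \<phi> = restrict (lift \<phi>) M"
    unfolding vNa_extension_def
  proof (rule the_equality)
    show "restrict (lift \<phi>) M \<in> extensional M \<and> ?Q (restrict (lift \<phi>) M)"
      by (intro conjI[OF restrict_extensional] lift)
    show "\<alpha> = restrict (lift \<phi>) M" if \<alpha>: "\<alpha> \<in> extensional M \<and> ?Q \<alpha>" for \<alpha>
      by (rule uniq[OF conjunct1[OF \<alpha>] conjunct2[OF \<alpha>]])
  qed
  then show ?thesis
    using x by simp
qed

section \<open>Fixed-point algebras of finite groups of automorphisms\<close>

text \<open>
  Inverses are required pointwise on the carrier, which is easier to transport along conjugation than
  the inverse of \<^const>\<open>AutoGroup\<close>.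
\<close>

definition aut_group :: "('a \<Rightarrow> 'a) set \<Rightarrow> bool" where
  "aut_group K \<longleftrightarrow> finite K \<and> K \<noteq> {} \<and> K \<subseteq> auto \<Gamma> \<and>
    (\<forall>\<phi>\<in>K. \<forall>\<psi>\<in>K. compose S \<phi> \<psi> \<in> K) \<and>
    (\<forall>\<phi>\<in>K. \<exists>\<psi>\<in>K. \<forall>t\<in>S. \<psi> (\<phi> t) = t \<and> \<phi> (\<psi> t) = t)"

lemma aut_groupD:
  assumes "aut_group K"
  shows "finite K" "K \<noteq> {}" "\<phi> \<in> K \<Longrightarrow> \<phi> \<in> auto \<Gamma>"
    "\<phi> \<in> K \<Longrightarrow> \<psi> \<in> K \<Longrightarrow> compose S \<phi> \<psi> \<in> K"
    "\<phi> \<in> K \<Longrightarrow> \<exists>\<psi>\<in>K. \<forall>t\<in>S. \<psi> (\<phi> t) = t \<and> \<phi> (\<psi> t) = t"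
  using assms by (auto simp: aut_group_def)

lemma aut_group_subgroup:
  assumes G: "subgroup G (AutoGroup \<Gamma>)" and "finite G"
  shows "aut_group G"
proof -
  interpret A: group "AutoGroup \<Gamma>"
    by (rule AutoGroup)
  have sub: "G \<subseteq> auto \<Gamma>"
    using subgroup.subset[OF G] by (simp add: AutoGroup_def)
  have mult: "\<phi> \<otimes>\<^bsub>AutoGroup \<Gamma>\<^esub> \<psi> = compose S \<phi> \<psi>" if "\<phi> \<in> auto \<Gamma>" "\<psi> \<in> auto \<Gamma>" for \<phi> \<psi>
    using that by (simp add: AutoGroup_def BijGroup_def auto_def)
  have "\<exists>\<psi>\<in>G. \<forall>t\<in>S. \<psi> (\<phi> t) = t \<and> \<phi> (\<psi> t) = t" if \<phi>: "\<phi> \<in> G" for \<phi>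
  proof
    let ?\<psi> = "inv\<^bsub>AutoGroup \<Gamma>\<^esub> \<phi>"
    show \<psi>: "?\<psi> \<in> G"
      using subgroup.m_inv_closed[OF G \<phi>] .
    have "\<phi> \<in> carrier (AutoGroup \<Gamma>)"
      using \<phi> subgroup.subset[OF G] by blast
    then have "?\<psi> \<otimes>\<^bsub>AutoGroup \<Gamma>\<^esub> \<phi> = \<one>\<^bsub>AutoGroup \<Gamma>\<^esub>" "\<phi> \<otimes>\<^bsub>AutoGroup \<Gamma>\<^esub> ?\<psi> = \<one>\<^bsub>AutoGroup \<Gamma>\<^esub>"
      by (rule A.l_inv, rule A.r_inv)
    moreover have "\<one>\<^bsub>AutoGroup \<Gamma>\<^esub> = (\<lambda>t\<in>S. t)"
      by (simp add: AutoGroup_def BijGroup_def)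
    moreover have "\<phi> \<in> auto \<Gamma>" "?\<psi> \<in> auto \<Gamma>"
      using \<phi> \<psi> sub by blast+
    ultimately have "compose S ?\<psi> \<phi> = (\<lambda>t\<in>S. t)" "compose S \<phi> ?\<psi> = (\<lambda>t\<in>S. t)"
      by (simp_all only: mult)
    then show "\<forall>t\<in>S. ?\<psi> (\<phi> t) = t \<and> \<phi> (?\<psi> t) = t"
      by (metis compose_eq restrict_apply')
  qed
  moreover have "compose S \<phi> \<psi> \<in> G" if "\<phi> \<in> G" "\<psi> \<in> G" for \<phi> \<psi>
    using subgroup.m_closed[OF G that] mult[OF subsetD[OF sub that(1)] subsetD[OF sub that(2)]] by simp
  ultimately show ?thesis
    using assms sub subgroup.one_closed[OF G] by (auto simp: aut_group_def)
qed

text \<open>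
  Membership in the fixed-point algebra is a condition on the vector \<open>x \<delta>\<close> alone, since \<open>\<phi>(x) \<delta> = U\<^sub>\<phi> x \<delta>\<close>;
  it says that the Fourier coefficients of \<open>x\<close> are constant on orbits.
\<close>

lemma fixed_iff_U:
  assumes K: "aut_group K"
  shows "x \<in> fixed_vNa \<Gamma> K \<longleftrightarrow> x \<in> M \<and> (\<forall>\<phi>\<in>K. U \<phi> (x \<delta>) = x \<delta>)"
proof -
  have "vNa_extension \<Gamma> \<phi> x = x \<longleftrightarrow> U \<phi> (x \<delta>) = x \<delta>" if x: "x \<in> M" and "\<phi> \<in> K" for \<phi>
  proof -
    have \<phi>: "\<phi> \<in> auto \<Gamma>"
      by (rule aut_groupD(3)[OF K that(2)])
    have "lift \<phi> x = x \<longleftrightarrow> lift \<phi> x \<delta> = x \<delta>"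
      using M_eqI[OF lift_in_M[OF \<phi> x] x] by metis
    then show ?thesis
      unfolding vNa_extension_eq[OF \<phi> x] lift_delta[OF \<phi>] .
  qed
  then show ?thesis
    unfolding fixed_vNa_def mem_Collect_eq by (intro conj_cong ball_cong refl)
qed

lemma fixed_iff_coord:
  assumes K: "aut_group K"
  shows "x \<in> fixed_vNa \<Gamma> K \<longleftrightarrow> x \<in> M \<and> (\<forall>\<phi>\<in>K. \<forall>t\<in>S. coord (x \<delta>) (\<phi> t) = coord (x \<delta>) t)"
proof -
  have "U \<phi> (x \<delta>) = x \<delta> \<longleftrightarrow> (\<forall>t\<in>S. coord (x \<delta>) (\<phi> t) = coord (x \<delta>) t)"
    if x: "x \<in> M" and "\<phi> \<in> K" for \<phi>
  proof
    have \<phi>: "\<phi> \<in> auto \<Gamma>"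
      using aut_groupD[OF K] that by blast
    then show "U \<phi> (x \<delta>) = x \<delta> \<Longrightarrow> \<forall>t\<in>S. coord (x \<delta>) (\<phi> t) = coord (x \<delta>) t"
      using coord_U[OF \<phi>, of _ "x \<delta>"] by simp
    assume eq: "\<forall>t\<in>S. coord (x \<delta>) (\<phi> t) = coord (x \<delta>) t"
    show "U \<phi> (x \<delta>) = x \<delta>"
    proof (rule coord_eqI)
      fix u
      show "coord (U \<phi> (x \<delta>)) u = coord (x \<delta>) u"
      proof (cases "u \<in> S")
        case True
        then obtain t where "t \<in> S" "u = \<phi> t"
          by (rule auto_surjE[OF \<phi>])
        then show ?thesis
          using eq by (simp add: coord_U \<phi>)
      qed (simp add: coord_bounded_ops_outside[OF U_bounded_ops[OF \<phi>]]
          coord_bounded_ops_outside[OF M_bounded_ops[OF x]])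
    qed
  qed
  then show ?thesis
    unfolding fixed_iff_U[OF K] by blast
qed

text \<open>
  Here \<open>\<phi>(x) = U\<^sub>\<phi> x U\<^sub>\<phi>\<^sup>*\<close>, so being fixed means commuting with \<open>U\<^sub>\<phi>\<close>. This exhibits the fixed-point algebra
  as a von Neumann algebra.
\<close>

lemma fixed_eq_commutant:
  assumes K: "aut_group K"
  shows "fixed_vNa \<Gamma> K = commutant S (R ` S \<union> U ` K)"
proof -
  have "U \<phi> (x \<delta>) = x \<delta> \<longleftrightarrow> (\<forall>f. x (U \<phi> f) = U \<phi> (x f))" if x: "x \<in> M" and \<phi>: "\<phi> \<in> auto \<Gamma>" for x \<phi>
  proof
    assume "U \<phi> (x \<delta>) = x \<delta>"
    then have "lift \<phi> x = x"
      by (intro M_eqI lift_in_M x \<phi>) (simp add: lift_delta \<phi>)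
    moreover have "lift \<phi> x (U \<phi> f) = U \<phi> (x f)" for f
      by (simp add: lift_def U_adj_U \<phi> M_restrict x)
    ultimately show "\<forall>f. x (U \<phi> f) = U \<phi> (x f)"
      by simp
  next
    assume "\<forall>f. x (U \<phi> f) = U \<phi> (x f)"
    then show "U \<phi> (x \<delta>) = x \<delta>"
      using U_ket[OF \<phi> one_closed] by (simp add: auto_one \<phi>) metis
  qed
  then show ?thesis
    using aut_groupD(3)[OF K]
    by (auto simp: fixed_iff_U[OF K] group_vNa_eq_commutant_R commutant_iff)
qed

lemma adj_U_in:
  assumes K: "aut_group K" and \<phi>: "\<phi> \<in> K"
  shows "\<exists>\<psi>\<in>K. adj (U \<phi>) = U \<psi>"
proof -
  obtain \<psi> where \<psi>: "\<psi> \<in> K" "\<And>t. t \<in> S \<Longrightarrow> \<psi> (\<phi> t) = t"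
    using aut_groupD(5)[OF K \<phi>] by blast
  then have "adj (U \<phi>) = U \<psi>"
    unfolding aut_op_def using aut_groupD(3)[OF K] \<phi> by (intro adj_perm_op) (auto simp: autoD(1))
  then show ?thesis
    using \<psi> by blast
qed

theorem fixed_in_Sub_vNa:
  assumes K: "aut_group K"
  shows "fixed_vNa \<Gamma> K \<in> Sub_vNa \<Gamma>"
proof -
  have "von_neumann_algebra S (commutant S (R ` S \<union> U ` K))"
  proof (rule von_neumann_algebra_commutant)
    show "R ` S \<union> U ` K \<subseteq> bounded_ops S"
      using aut_groupD(3)[OF K] by (auto simp: R_bounded_ops U_bounded_ops)
    show "adj a \<in> R ` S \<union> U ` K" if "a \<in> R ` S \<union> U ` K" for a
      using that adj_U_in[OF K] by (auto simp: adj_R)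
  qed
  then show ?thesis
    by (auto simp: Sub_vNa_def fixed_eq_commutant[OF K, symmetric] fixed_vNa_def)
qed

lemma U_average:
  assumes K: "aut_group K" and \<psi>: "\<psi> \<in> K"
  shows "U \<psi> (\<Sum>\<phi>\<in>K. U \<phi> f) = (\<Sum>\<phi>\<in>K. U \<phi> f)"
proof -
  note KD = aut_groupD[OF K]
  have "inj_on (compose S \<psi>) K"
  proof (rule inj_onI)
    fix \<phi> \<phi>' assume \<phi>: "\<phi> \<in> K" "\<phi>' \<in> K" and eq: "compose S \<psi> \<phi> = compose S \<psi> \<phi>'"
    have "\<phi> t = \<phi>' t" if t: "t \<in> S" for t
    proof -
      have "\<psi> (\<phi> t) = \<psi> (\<phi>' t)"
        using fun_cong[OF eq, of t] t by (simp add: compose_eq)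
      then show ?thesis
        using bij_betw_imp_inj_on[OF autoD(1)[OF KD(3)[OF \<psi>]]] autoD(2)[OF KD(3)] \<phi> t
        by (auto dest: inj_onD)
    qed
    then show "\<phi> = \<phi>'"
      using autoD(4)[OF KD(3)] \<phi> by (blast intro: extensionalityI)
  qed
  then have bij: "bij_betw (compose S \<psi>) K K"
    using KD(1,4) \<psi> endo_inj_surj[of K "compose S \<psi>"] by (auto simp: bij_betw_def)
  have "U \<psi> (U \<phi> f) = U (compose S \<psi> \<phi>) f" if "\<phi> \<in> K" for \<phi>
  proof -
    have "U \<psi> o\<^sub>L U \<phi> = U (compose S \<psi> \<phi>)"
      unfolding aut_op_def using KD(3) \<psi> that
      by (subst perm_op_compose) (auto simp: autoD(1) compose_eq intro!: perm_op_cong)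
    then show ?thesis
      by (metis blinfun_apply_blinfun_compose)
  qed
  then have "U \<psi> (\<Sum>\<phi>\<in>K. U \<phi> f) = (\<Sum>\<phi>\<in>K. U (compose S \<psi> \<phi>) f)"
    by (simp add: blinfun.sum_right)
  also have "\<dots> = (\<Sum>\<phi>\<in>K. U \<phi> f)"
    by (rule sum.reindex_bij_betw[OF bij])
  finally show ?thesis .
qed

text \<open>
  The average lies in the fixed-point algebra, and for fixed \<open>b\<close> each term has the same inner product
  with \<open>b \<delta>\<close>, because \<open>U\<^sub>\<phi>\<^sup>* b \<delta> = b \<delta>\<close>.
\<close>

theorem cond_exp_fixed:
  assumes K: "aut_group K" and x: "x \<in> M"
  shows "cond_exp \<Gamma> (fixed_vNa \<Gamma> K) x \<delta> = (1 / of_nat (card K)) *\<^sub>C (\<Sum>\<phi>\<in>K. U \<phi> (x \<delta>))"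
proof -
  note KD = aut_groupD[OF K]
  let ?c = "1 / of_nat (card K) :: complex"
  have card: "?c * of_nat (card K) = 1"
    using KD(1,2) by (simp add: card_gt_0_iff)
  define y where "y = scaleC_op ?c (\<Sum>\<phi>\<in>K. lift \<phi> x)"
  have y\<delta>: "y \<delta> = ?c *\<^sub>C (\<Sum>\<phi>\<in>K. U \<phi> (x \<delta>))"
    unfolding y_def scaleC_op_apply blinfun.sum_left using KD(3) by (simp add: lift_delta)
  have yM: "y \<in> M"
    unfolding y_def using KD(1,3) x by (intro M_closed M_sum lift_in_M) auto
  have "y \<in> fixed_vNa \<Gamma> K"
    unfolding fixed_iff_U[OF K] using yM KD(3)
    by (simp add: y\<delta> clinearD U_clinear U_average[OF K])
  moreover have "cinner (b \<delta>) (y \<delta>) = cinner (b \<delta>) (x \<delta>)" if b: "b \<in> fixed_vNa \<Gamma> K" for b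
  proof -
    have "cinner (b \<delta>) (U \<phi> (x \<delta>)) = cinner (b \<delta>) (x \<delta>)" if \<phi>: "\<phi> \<in> K" for \<phi>
    proof -
      obtain \<psi> where "\<psi> \<in> K" "adj (U \<phi>) = U \<psi>"
        using adj_U_in[OF K \<phi>] by blast
      then have "adj (U \<phi>) (b \<delta>) = b \<delta>"
        using b by (simp add: fixed_iff_U[OF K])
      then show ?thesis
        using cinner_adj_left[OF U_clinear[OF KD(3)[OF \<phi>]], of "b \<delta>" "x \<delta>"] by simp
    qed
    then have "cinner (b \<delta>) (y \<delta>) = (?c * of_nat (card K)) * cinner (b \<delta>) (x \<delta>)"
      by (simp add: y\<delta> cinner_scaleC_right cinner_sum_right)
    then show ?thesis
      unfolding card by simp
  qed
  ultimately have "cond_exp \<Gamma> (fixed_vNa \<Gamma> K) x = y"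
    by (intro cond_exp_eqI fixed_in_Sub_vNa K x)
  then show ?thesis
    using y\<delta> by simp
qed

text \<open>
  \<open>Inn(s) \<phi> Inn(s)\<^sup>-\<^sup>1\<close>, extensional on the carrier like the elements of \<^const>\<open>auto\<close>. Since \<open>Ad(\<lambda>\<^sub>s)\<close> extends
  \<open>Inn(s)\<close>, the algebra \<open>\<lambda>\<^sub>s L(\<Gamma>)\<^sup>K \<lambda>\<^sub>s\<^sup>*\<close> is the fixed-point algebra of these conjugates.
\<close>

definition conj_aut :: "'a \<Rightarrow> ('a \<Rightarrow> 'a) \<Rightarrow> 'a \<Rightarrow> 'a" where
  "conj_aut s \<phi> = (\<lambda>t\<in>S. s \<otimes> \<phi> (inv s \<otimes> t \<otimes> s) \<otimes> inv s)"

lemma conj_cancel: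
  assumes "s \<in> S" "t \<in> S"
  shows "inv s \<otimes> (s \<otimes> t \<otimes> inv s) \<otimes> s = t" "s \<otimes> (inv s \<otimes> t \<otimes> s) \<otimes> inv s = t"
  using assms by (simp_all add: m_assoc) (simp_all add: m_assoc[symmetric])

lemma aut_group_conj:
  assumes K: "aut_group K" and s: "s \<in> S"
  shows "aut_group (conj_aut s ` K)"
proof -
  note KD = aut_groupD[OF K]
  let ?i = "\<lambda>t. inv s \<otimes> t \<otimes> s" and ?j = "\<lambda>t. s \<otimes> t \<otimes> inv s"
  have iS: "?i t \<in> S" "?j t \<in> S" if "t \<in> S" for t
    using s that by auto
  have app: "conj_aut s \<phi> t = ?j (\<phi> (?i t))" if "t \<in> S" for \<phi> t
    using that by (simp add: conj_aut_def)
  have in_S: "conj_aut s \<phi> t \<in> S" if "\<phi> \<in> K" "t \<in> S" for \<phi> t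
    using that iS autoD(2)[OF KD(3)] by (simp add: app)
  have comp: "conj_aut s \<phi> (conj_aut s \<psi> t) = ?j (\<phi> (\<psi> (?i t)))" if "\<phi> \<in> K" "\<psi> \<in> K" "t \<in> S" for \<phi> \<psi> t
    using that in_S[of \<psi> t] iS autoD(2)[OF KD(3)] by (simp add: app conj_cancel s)
  have inverse: "\<exists>\<psi>\<in>K. \<forall>t\<in>S. conj_aut s \<psi> (conj_aut s \<phi> t) = t \<and> conj_aut s \<phi> (conj_aut s \<psi> t) = t"
    if \<phi>: "\<phi> \<in> K" for \<phi>
  proof -
    obtain \<psi> where \<psi>: "\<psi> \<in> K" "\<forall>t\<in>S. \<psi> (\<phi> t) = t \<and> \<phi> (\<psi> t) = t"
      using KD(5)[OF \<phi>] by blast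
    then show ?thesis
      using \<phi> iS by (intro bexI[of _ \<psi>]) (auto simp: comp conj_cancel s)
  qed
  have "conj_aut s \<phi> \<in> auto \<Gamma>" if \<phi>: "\<phi> \<in> K" for \<phi>
  proof -
    have "conj_aut s \<phi> (t \<otimes> u) = conj_aut s \<phi> t \<otimes> conj_aut s \<phi> u" if t: "t \<in> S" and u: "u \<in> S" for t u
    proof -
      have cancel: "inv s \<otimes> (s \<otimes> z) = z" "s \<otimes> (inv s \<otimes> z) = z" if "z \<in> S" for z
        using that s by (simp_all flip: m_assoc)
      have "?i (t \<otimes> u) = ?i t \<otimes> ?i u"
        using s t u by (simp add: m_assoc cancel)
      then have "\<phi> (?i (t \<otimes> u)) = \<phi> (?i t) \<otimes> \<phi> (?i u)"
        using iS t u autoD(3)[OF KD(3)[OF \<phi>]] by simp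
      then show ?thesis
        using s t u iS autoD(2)[OF KD(3)[OF \<phi>]] by (simp add: app m_assoc cancel)
    qed
    moreover have "bij_betw (conj_aut s \<phi>) S S"
    proof -
      obtain \<psi> where "\<psi> \<in> K" "\<forall>t\<in>S. conj_aut s \<psi> (conj_aut s \<phi> t) = t \<and> conj_aut s \<phi> (conj_aut s \<psi> t) = t"
        using inverse[OF \<phi>] by blast
      then show ?thesis
        using in_S \<phi> by (intro bij_betwI[where g = "conj_aut s \<psi>"]) auto
    qed
    moreover have "conj_aut s \<phi> \<in> extensional S"
      by (simp add: conj_aut_def)
    ultimately show ?thesis
      using in_S[OF \<phi>] by (auto simp: auto_def Bij_def hom_def)
  qed
  moreover have "compose S (conj_aut s \<phi>) (conj_aut s \<psi>) = conj_aut s (compose S \<phi> \<psi>)"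
    if "\<phi> \<in> K" "\<psi> \<in> K" for \<phi> \<psi>
  proof (rule extensionalityI[where A = S])
    fix t assume t: "t \<in> S"
    then show "compose S (conj_aut s \<phi>) (conj_aut s \<psi>) t = conj_aut s (compose S \<phi> \<psi>) t"
      using that iS[of t] by (simp add: compose_eq comp) (simp add: compose_eq app)
  qed (auto simp: conj_aut_def compose_def)
  ultimately show ?thesis
    unfolding aut_group_def using KD(1,2,4) inverse by auto
qed

lemma conj_L_delta:
  assumes s: "s \<in> S" and x: "x \<in> M" and t: "t \<in> S"
  shows "coord ((L s o\<^sub>L x o\<^sub>L adj (L s)) \<delta>) t = coord (x \<delta>) (inv s \<otimes> t \<otimes> s)"
  using assms coord_M[OF x inv_closed[OF s], of "inv s \<otimes> t"]
  by (simp add: adj_L L_ket coord_L)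

lemma L_L: "g \<in> S \<Longrightarrow> h \<in> S \<Longrightarrow> L g (L h f) = L (g \<otimes> h) f"
  using L_compose[of g h] by (metis blinfun_apply_blinfun_compose)

theorem conj_fixed:
  assumes K: "aut_group K" and s: "s \<in> S"
  shows "conj_vNa \<Gamma> s (fixed_vNa \<Gamma> K) = fixed_vNa \<Gamma> (conj_aut s ` K)"
proof -
  note KD = aut_groupD[OF K] and K' = aut_group_conj[OF K s]
  have iS: "inv s \<otimes> t \<otimes> s \<in> S" "s \<otimes> t \<otimes> inv s \<in> S" if "t \<in> S" for t
    using s that by auto
  have conj_M: "L s o\<^sub>L x o\<^sub>L adj (L s) \<in> M" "adj (L s) o\<^sub>L x o\<^sub>L L s \<in> M" if "x \<in> M" for x
    using that s by (auto simp: M_closed L_in_M)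
  show ?thesis
  proof (intro equalityI subsetI)
    fix y assume "y \<in> conj_vNa \<Gamma> s (fixed_vNa \<Gamma> K)"
    then obtain x where x: "x \<in> fixed_vNa \<Gamma> K" and y: "y = L s o\<^sub>L x o\<^sub>L adj (L s)"
      by (auto simp: conj_vNa_def)
    have xM: "x \<in> M" and inv_coord: "\<And>\<phi> t. \<phi> \<in> K \<Longrightarrow> t \<in> S \<Longrightarrow> coord (x \<delta>) (\<phi> t) = coord (x \<delta>) t"
      using x by (auto simp: fixed_iff_coord[OF K])
    have "coord (y \<delta>) (conj_aut s \<phi> t) = coord (y \<delta>) t" if "\<phi> \<in> K" "t \<in> S" for \<phi> t
      unfolding y using that iS autoD(2)[OF KD(3)] s
      by (subst (1 2) conj_L_delta) (auto simp: xM conj_aut_def conj_cancel inv_coord)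
    then show "y \<in> fixed_vNa \<Gamma> (conj_aut s ` K)"
      unfolding fixed_iff_coord[OF K'] using conj_M(1)[OF xM] y by auto
  next
    fix y assume y: "y \<in> fixed_vNa \<Gamma> (conj_aut s ` K)"
    have yM: "y \<in> M" and inv_coord: "\<And>\<phi> t. \<phi> \<in> K \<Longrightarrow> t \<in> S \<Longrightarrow> coord (y \<delta>) (conj_aut s \<phi> t) = coord (y \<delta>) t"
      using y by (auto simp: fixed_iff_coord[OF K'])
    let ?x = "L (inv s) o\<^sub>L y o\<^sub>L adj (L (inv s))"
    have xM: "?x \<in> M"
      using yM s by (auto simp: M_closed L_in_M)
    have "coord (?x \<delta>) (\<phi> t) = coord (?x \<delta>) t" if "\<phi> \<in> K" "t \<in> S" for \<phi> t
    proof -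
      have "coord (?x \<delta>) u = coord (y \<delta>) (s \<otimes> u \<otimes> inv s)" if "u \<in> S" for u
        using conj_L_delta[OF inv_closed[OF s] yM that] s by simp
      then show ?thesis
        using inv_coord[OF that(1) iS(2)[OF that(2)]] that autoD(2)[OF KD(3)] iS
        by (simp add: conj_aut_def conj_cancel s)
    qed
    then have "?x \<in> fixed_vNa \<Gamma> K"
      unfolding fixed_iff_coord[OF K] using xM by blast
    moreover have "y = L s o\<^sub>L ?x o\<^sub>L adj (L s)"
    proof (rule blinfun_eqI)
      have LL: "L s (L (inv s) f) = restrict_ell2 S f" for f
        using L_L[OF s inv_closed[OF s]] s by (simp add: L_one ell2_proj_apply)
      show "y f = (L s o\<^sub>L ?x o\<^sub>L adj (L s)) f" for f
        using s by (simp add: adj_L LL M_restrict yM)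
    qed
    ultimately show "y \<in> conj_vNa \<Gamma> s (fixed_vNa \<Gamma> K)"
      unfolding conj_vNa_def by - (rule image_eqI[where x = ?x], assumption+)
  qed
qed

end

section \<open>Central sequences and centralizers\<close>

lemma norm_adj_apply_le: "clinear T \<Longrightarrow> norm (adj T f) \<le> norm T * norm f"
proof -
  assume T: "clinear T"
  have "(norm (adj T f))\<^sup>2 = cmod (cinner (adj T f) (adj T f))"
    by (simp add: cinner_self_norm norm_power)
  also have "\<dots> = cmod (cinner f (T (adj T f)))"
    by (simp only: cinner_adj_left[OF T])
  also have "\<dots> \<le> norm f * norm (T (adj T f))"
    by (rule cmod_cinner_le)
  also have "\<dots> \<le> norm f * (norm T * norm (adj T f))"
    by (intro mult_left_mono norm_blinfun) simp
  finally have "norm (adj T f) * norm (adj T f) \<le> norm (adj T f) * (norm T * norm f)"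
    by (simp add: power2_eq_square mult_ac)
  then show ?thesis
    by (cases "norm (adj T f) = 0") (auto simp: mult_le_cancel_left)
qed

context discrete_group
begin

lemma bounded_sequences_carrier:
  "x \<in> carrier (bounded_sequences \<Gamma> M) \<longleftrightarrow> (\<forall>n. x n \<in> M) \<and> (\<exists>K. \<forall>n. norm (x n) \<le> K)"
  by (auto simp: bounded_sequences_def bounded_iff)

lemma bounded_sequences_simps:
  "x \<otimes>\<^bsub>bounded_sequences \<Gamma> N\<^esub> y = (\<lambda>n. x n o\<^sub>L y n)"
  "x \<oplus>\<^bsub>bounded_sequences \<Gamma> N\<^esub> y = (\<lambda>n. x n + y n)"
  "\<one>\<^bsub>bounded_sequences \<Gamma> N\<^esub> = (\<lambda>_. ell2_proj S)"
  "\<zero>\<^bsub>bounded_sequences \<Gamma> N\<^esub> = (\<lambda>_. 0)"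
  by (simp_all add: bounded_sequences_def)

lemma M_zero: "0 \<in> M"
  using M_sum[of "{}"] by simp

lemma M_uminus: "x \<in> M \<Longrightarrow> - x \<in> M"
  using M_diff[OF M_zero, of x] by simp

lemma bounded_sequences_add:
  assumes "x \<in> carrier (bounded_sequences \<Gamma> M)" "y \<in> carrier (bounded_sequences \<Gamma> M)"
  shows "(\<lambda>n. x n + y n) \<in> carrier (bounded_sequences \<Gamma> M)"
proof -
  obtain B C where "\<forall>n. norm (x n) \<le> B" "\<forall>n. norm (y n) \<le> C"
    using assms unfolding bounded_sequences_carrier by blast
  then have "\<forall>n. norm (x n + y n) \<le> B + C"
    by (meson add_mono norm_triangle_le)
  then show ?thesis
    using assms unfolding bounded_sequences_carrier by (auto simp: M_closed)
qed

lemma bounded_sequences_mult: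
  assumes "x \<in> carrier (bounded_sequences \<Gamma> M)" "y \<in> carrier (bounded_sequences \<Gamma> M)"
  shows "(\<lambda>n. x n o\<^sub>L y n) \<in> carrier (bounded_sequences \<Gamma> M)"
proof -
  obtain B C where B: "\<forall>n. norm (x n) \<le> B" and C: "\<forall>n. norm (y n) \<le> C"
    using assms unfolding bounded_sequences_carrier by blast
  have "norm (x n o\<^sub>L y n) \<le> B * C" for n
    by (rule order_trans[OF norm_blinfun_compose])
      (use B C in \<open>meson mult_mono norm_ge_zero order_trans\<close>)
  then show ?thesis
    using assms unfolding bounded_sequences_carrier by (auto simp: M_closed)
qed

lemma bounded_sequences_uminus:
  "x \<in> carrier (bounded_sequences \<Gamma> M) \<Longrightarrow> (\<lambda>n. - x n) \<in> carrier (bounded_sequences \<Gamma> M)"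
  by (auto simp: bounded_sequences_carrier M_uminus)

lemma bounded_sequences_const: "a \<in> M \<Longrightarrow> (\<lambda>_. a) \<in> carrier (bounded_sequences \<Gamma> M)"
  unfolding bounded_sequences_carrier by blast

lemma M_one_compose: "x \<in> M \<Longrightarrow> ell2_proj S o\<^sub>L x = x" "x \<in> M \<Longrightarrow> x o\<^sub>L ell2_proj S = x"
  using M_bounded_ops by (auto simp: bounded_ops_def)

lemma ring_bounded_sequences: "ring (bounded_sequences \<Gamma> M)"
proof (rule ringI)
  let ?B = "bounded_sequences \<Gamma> M"
  show "abelian_group ?B"
  proof (rule abelian_groupI)
    show "\<zero>\<^bsub>?B\<^esub> \<in> carrier ?B"
      using bounded_sequences_const[OF M_zero] by (simp add: bounded_sequences_simps)
    show "\<exists>y\<in>carrier ?B. y \<oplus>\<^bsub>?B\<^esub> x = \<zero>\<^bsub>?B\<^esub>" if "x \<in> carrier ?B" for x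
      using bounded_sequences_uminus[OF that]
      by (intro bexI[of _ "\<lambda>n. - x n"]) (simp_all add: bounded_sequences_simps)
  qed (simp_all add: bounded_sequences_simps bounded_sequences_add add_ac)
  show "monoid ?B"
  proof (rule monoidI)
    show "\<one>\<^bsub>?B\<^esub> \<in> carrier ?B"
      using bounded_sequences_const[OF M_closed(5)] by (simp add: bounded_sequences_simps)
    show "x \<otimes>\<^bsub>?B\<^esub> y \<in> carrier ?B" if "x \<in> carrier ?B" "y \<in> carrier ?B" for x y
      using bounded_sequences_mult[OF that] by (simp add: bounded_sequences_simps)
  qed (simp_all add: bounded_sequences_simps bounded_sequences_carrier M_one_compose blinfun_eq_pointwise fun_eq_iff)
qed (auto simp: bounded_sequences_simps blinfun_eq_pointwise blinfun.add_left blinfun.add_right)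

lemma null_sequences_iff:
  "x \<in> null_sequences \<Gamma> \<omega> \<longleftrightarrow>
    x \<in> carrier (bounded_sequences \<Gamma> M) \<and> ((\<lambda>n. norm (x n \<delta>)) \<longlongrightarrow> 0) \<omega>"
proof -
  have "(\<lambda>n. norm2 \<Gamma> (x n)) = (\<lambda>n. norm (x n \<delta>))" if "x \<in> carrier (bounded_sequences \<Gamma> M)"
    using that by (auto simp: bounded_sequences_carrier norm2_eq)
  then show ?thesis
    unfolding null_sequences_def by auto
qed

text \<open>
  For bounded \<open>a\<close> and null \<open>x\<close>, the product \<open>a x\<close> is estimated by
  \<open>\<parallel>a x \<delta>\<parallel> \<le> \<parallel>a\<parallel> \<parallel>x \<delta>\<parallel>\<close>, and \<open>x a\<close> in the same way through \<open>\<parallel>y \<delta>\<parallel> = \<parallel>y\<^sup>* \<delta>\<parallel>\<close>.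
\<close>

lemma ideal_null_sequences: "ideal (null_sequences \<Gamma> \<omega>) (bounded_sequences \<Gamma> M)"
proof -
  let ?B = "bounded_sequences \<Gamma> M" and ?I = "null_sequences \<Gamma> \<omega>"
  interpret B: ring ?B
    by (rule ring_bounded_sequences)
  have null: "y \<in> ?I" if x: "x \<in> ?I" and y: "y \<in> carrier ?B" and le: "\<And>n. norm (y n \<delta>) \<le> C * norm (x n \<delta>)" for x y C
  proof -
    have "((\<lambda>n. C * norm (x n \<delta>)) \<longlongrightarrow> C * 0) \<omega>"
      using x by (intro tendsto_mult_left) (simp add: null_sequences_iff)
    then have lim: "((\<lambda>n. C * norm (x n \<delta>)) \<longlongrightarrow> 0) \<omega>"
      by simp
    have "((\<lambda>n. norm (y n \<delta>)) \<longlongrightarrow> 0) \<omega>"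
      by (rule Lim_null_comparison[OF _ lim]) (simp add: le)
    then show ?thesis
      using y by (simp add: null_sequences_iff)
  qed
  show ?thesis
  proof (rule idealI)
    show "ring ?B"
      by (rule ring_bounded_sequences)
    show "subgroup ?I (add_monoid ?B)"
    proof (rule group.subgroupI)
      show "group (add_monoid ?B)"
        by (rule B.add.is_group)
      show "?I \<subseteq> carrier (add_monoid ?B)"
        by (auto simp: null_sequences_iff)
      have "(\<lambda>_. 0) \<in> ?I"
        using bounded_sequences_const[OF M_zero] by (simp add: null_sequences_iff)
      then show "?I \<noteq> {}"
        by blast
      show "inv\<^bsub>add_monoid ?B\<^esub> x \<in> ?I" if x: "x \<in> ?I" for x
      proof -
        have xB: "x \<in> carrier ?B"
          using x by (simp add: null_sequences_iff)
        have "\<ominus>\<^bsub>?B\<^esub> x = (\<lambda>n. - x n)"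
          by (rule B.minus_equality) (auto simp: bounded_sequences_simps xB bounded_sequences_uminus)
        then have "inv\<^bsub>add_monoid ?B\<^esub> x = (\<lambda>n. - x n)"
          by (simp add: a_inv_def)
        moreover have "(\<lambda>n. - x n) \<in> ?I"
          by (rule null[OF x bounded_sequences_uminus[OF xB], of 1]) (simp add: blinfun.minus_left)
        ultimately show ?thesis
          by simp
      qed
      show "x \<otimes>\<^bsub>add_monoid ?B\<^esub> y \<in> ?I" if xy: "x \<in> ?I" "y \<in> ?I" for x y
      proof -
        have "((\<lambda>n. norm (x n \<delta>) + norm (y n \<delta>)) \<longlongrightarrow> 0 + 0) \<omega>"
          using xy by (intro tendsto_add) (auto simp: null_sequences_iff)
        then have lim: "((\<lambda>n. norm (x n \<delta>) + norm (y n \<delta>)) \<longlongrightarrow> 0) \<omega>"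
          by simp
        have "((\<lambda>n. norm ((x n + y n) \<delta>)) \<longlongrightarrow> 0) \<omega>"
          by (rule Lim_null_comparison[OF _ lim]) (simp add: blinfun.add_left norm_triangle_ineq)
        then show ?thesis
          using xy bounded_sequences_add by (simp add: null_sequences_iff bounded_sequences_simps)
      qed
    qed
    fix x a assume x: "x \<in> ?I" and a: "a \<in> carrier ?B"
    then have xB: "x \<in> carrier ?B"
      by (simp add: null_sequences_iff)
    obtain C where C: "\<And>n. norm (a n) \<le> C" and aM: "\<And>n. a n \<in> M" and xM: "\<And>n. x n \<in> M"
      using a xB unfolding bounded_sequences_carrier by blast
    have C_mult: "norm (a n) * r \<le> C * r" if "r \<ge> 0" for n r
      using C that by (rule mult_right_mono)
    have "norm ((a n o\<^sub>L x n) \<delta>) \<le> C * norm (x n \<delta>)" for n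
      using order_trans[OF norm_blinfun C_mult] by simp
    then show "a \<otimes>\<^bsub>?B\<^esub> x \<in> ?I"
      unfolding bounded_sequences_simps by (rule null[OF x bounded_sequences_mult[OF a xB]])
    have "norm ((x n o\<^sub>L a n) \<delta>) \<le> C * norm (x n \<delta>)" for n
    proof -
      have "norm ((x n o\<^sub>L a n) \<delta>) = norm (adj (a n) (adj (x n) \<delta>))"
        using norm_adj_delta[OF M_closed(2)[OF xM[of n] aM[of n]]] M_clinear aM xM
        by (simp add: adj_compose)
      also have "\<dots> \<le> norm (a n) * norm (adj (x n) \<delta>)"
        using norm_adj_apply_le M_clinear aM by blast
      also have "\<dots> \<le> C * norm (adj (x n) \<delta>)"
        by (rule C_mult) simp
      finally show ?thesis
        by (simp add: norm_adj_delta xM)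
    qed
    then show "x \<otimes>\<^bsub>?B\<^esub> a \<in> ?I"
      unfolding bounded_sequences_simps by (rule null[OF x bounded_sequences_mult[OF xB a]])
  qed
qed

lemma free_ultrafilter_le_sequentially: "free_ultrafilter \<omega> \<Longrightarrow> \<omega> \<le> sequentially"
proof (rule filter_leI)
  fix P assume \<omega>: "free_ultrafilter \<omega>" and "eventually P sequentially"
  then obtain N where N: "\<And>n. n \<ge> N \<Longrightarrow> P n"
    by (auto simp: eventually_sequentially)
  have "\<forall>\<^sub>F n in \<omega>. \<forall>m\<in>{..<N}. n \<noteq> m"
    using \<omega> by (intro eventually_ball_finite) (auto simp: free_ultrafilter_def)
  then show "eventually P \<omega>"
  proof (rule eventually_mono)
    fix n assume "\<forall>m\<in>{..<N}. n \<noteq> m"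
    then have "N \<le> n"
      by (intro leI) auto
    then show "P n"
      by (rule N)
  qed
qed

lemma norm_le_if_cinner_restrict:
  assumes "cinner h h = cinner f (restrict_ell2 A f)" shows "norm h \<le> norm f"
proof -
  have "(norm h)\<^sup>2 = cmod (cinner h h)"
    by (simp add: cinner_self_norm norm_power)
  also have "\<dots> \<le> norm f * norm (restrict_ell2 A f)"
    unfolding assms by (rule cmod_cinner_le)
  also have "\<dots> \<le> (norm f)\<^sup>2"
    unfolding power2_eq_square by (intro mult_left_mono norm_restrict_ell2) simp
  finally show ?thesis
    by (rule power2_le_imp_le) simp
qed

lemma norm_L_apply_le: "g \<in> S \<Longrightarrow> norm (L g f) \<le> norm f"
  using cinner_adj_right[OF M_clinear[OF L_in_M], of g f "L g f"]
  by (intro norm_le_if_cinner_restrict[where A = S]) (simp add: adj_L L_L L_one ell2_proj_apply)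

lemma norm_R_apply_le: "g \<in> S \<Longrightarrow> norm (R g f) \<le> norm f"
  using cinner_adj_right[OF clinear_R, of g f "R g f"]
  by (intro norm_le_if_cinner_restrict[where A = S]) (simp add: adj_R R_R R_one ell2_proj_apply)

text \<open>
  \<open>L\<^sub>g\<close> and \<open>R\<^bsub>inv g\<^esub>\<close> agree on \<open>\<delta>\<^sub>t\<close> as soon as \<open>g\<close> commutes with \<open>t\<close>, and a vector is finitely supported
  up to \<open>\<epsilon>/2\<close>. Applied to \<open>f = a \<delta>\<close> this is the norm of \<open>(\<lambda>\<^sub>g a - a \<lambda>\<^sub>g) \<delta>\<close>.
\<close>

lemma tendsto_commutator:
  assumes g: "\<And>n. g n \<in> S"
    and comm: "\<And>t. t \<in> S \<Longrightarrow> \<forall>\<^sub>F n in sequentially. g n \<otimes> t = t \<otimes> g n"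
  shows "(\<lambda>n. norm (L (g n) f - R (inv (g n)) f)) \<longlonglongrightarrow> 0"
proof (rule LIMSEQ_I)
  fix \<epsilon> :: real assume "\<epsilon> > 0"
  have "\<forall>\<^sub>F A in finite_subsets_at_top UNIV. dist (restrict_ell2 A f) f < \<epsilon> / 2"
    using tendstoD[OF tendsto_restrict_ell2[of f], of "\<epsilon> / 2"] \<open>\<epsilon> > 0\<close> by simp
  then obtain A where A: "finite A" "norm (restrict_ell2 A f - f) < \<epsilon> / 2"
    unfolding eventually_finite_subsets_at_top dist_norm by blast
  have "\<forall>\<^sub>F n in sequentially. \<forall>t\<in>A \<inter> S. g n \<otimes> t = t \<otimes> g n"
    using A(1) comm by (intro eventually_ball_finite) auto
  then obtain N where N: "\<And>n t. n \<ge> N \<Longrightarrow> t \<in> A \<inter> S \<Longrightarrow> g n \<otimes> t = t \<otimes> g n"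
    unfolding eventually_sequentially by blast
  have "norm (L (g n) f - R (inv (g n)) f) < \<epsilon>" if n: "n \<ge> N" for n
  proof -
    let ?f = "restrict_ell2 A f"
    have ginv: "inv (g n) \<in> S"
      using g by simp
    have "L (g n) (ket t) = R (inv (g n)) (ket t)" if "t \<in> A" for t
    proof (cases "t \<in> S")
      case True
      then show ?thesis
        using N[OF n, of t] that g by (simp add: L_ket R_ket)
    next
      case False
      then show ?thesis
        using bounded_ops_ket_outside[OF L_bounded_ops[OF g]] bounded_ops_ket_outside[OF R_bounded_ops[OF ginv]]
        by simp
    qed
    then have eq: "L (g n) ?f = R (inv (g n)) ?f"
      unfolding restrict_ell2_sum_ket[OF A(1)] blinfun.sum_right
      by (intro sum.cong) (simp_all add: clinearD M_clinear[OF L_in_M[OF g]] clinear_R[OF ginv])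
    have "L (g n) f - R (inv (g n)) f = R (inv (g n)) (?f - f) - L (g n) (?f - f)"
      by (simp add: blinfun.diff_right eq)
    also have "norm \<dots> \<le> norm (?f - f) + norm (?f - f)"
      by (rule order_trans[OF norm_triangle_ineq4 add_mono[OF norm_R_apply_le[OF ginv] norm_L_apply_le[OF g]]])
    finally show ?thesis
      using A(2) by simp
  qed
  then show "\<exists>N. \<forall>n\<ge>N. norm (norm (L (g n) f - R (inv (g n)) f) - 0) < \<epsilon>"
    by auto
qed

text \<open>
  The vector of a central element is constant on conjugacy classes. It takes the same value \<open>a\<close> at \<open>g\<close>
  and at a second conjugate of \<open>g\<close>, where \<open>\<lambda>\<^sub>g \<delta> = \<delta>\<^sub>g\<close> has the values \<open>1\<close> and \<open>0\<close>, and
  \<open>\<bar>1 - a\<bar>\<^sup>2 + \<bar>a\<bar>\<^sup>2 \<ge> 1/2\<close>.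
\<close>

lemma distance_to_center:
  assumes z: "z \<in> center_vNa \<Gamma>" and g: "g \<in> S" and t: "t \<in> S" and gt: "g \<otimes> t \<noteq> t \<otimes> g"
  shows "1 / 2 \<le> (norm (L g \<delta> - z \<delta>))\<^sup>2"
proof -
  let ?h = "t \<otimes> g \<otimes> inv t"
  have zM: "z \<in> M" and zL: "z (L t \<delta>) = L t (z \<delta>)"
    using z L_in_M[OF t] by (auto simp: center_vNa_def commutant_iff)
  have "coord (z (ket t)) (t \<otimes> g) = coord (L t (z \<delta>)) (t \<otimes> g)"
    using zL t by (simp add: L_ket)
  then have class_fun: "coord (z \<delta>) ?h = coord (z \<delta>) g"
    using g t coord_M[OF zM t, of "t \<otimes> g"] coord_L[OF t, of "t \<otimes> g" "z \<delta>"]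
    by (simp flip: m_assoc)
  have neq: "g \<noteq> ?h"
    using gt g t by (metis inv_solve_right m_closed)
  let ?a = "coord (z \<delta>) g"
  have "(\<Sum>u\<in>{g, ?h}. (cmod (coord (L g \<delta> - z \<delta>) u))\<^sup>2) \<le> (norm (L g \<delta> - z \<delta>))\<^sup>2"
    by (rule sum_coord_le_norm) simp
  then have le: "(cmod (1 - ?a))\<^sup>2 + (cmod ?a)\<^sup>2 \<le> (norm (L g \<delta> - z \<delta>))\<^sup>2"
    using neq class_fun g by (simp add: L_ket coord_ket)
  have "1 \<le> cmod (1 - ?a) + cmod ?a"
    using norm_triangle_ineq[of "1 - ?a" ?a] by simp
  then have "1 \<le> (cmod (1 - ?a) + cmod ?a)\<^sup>2"
    by (simp add: one_le_power)
  also have "\<dots> \<le> 2 * ((cmod (1 - ?a))\<^sup>2 + (cmod ?a)\<^sup>2)"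
    using sum_squares_bound[of "cmod (1 - ?a)" "cmod ?a"] by (simp add: power2_sum)
  finally show ?thesis
    using le by simp
qed

text \<open>
  Otherwise enumerate \<open>\<Gamma>\<close> and choose a non-central \<open>g\<^sub>n\<close> commuting with its first elements. Then
  \<open>(\<lambda>\<^bsub>g n\<^esub>)\<^sub>n\<close> commutes with \<open>L(\<Gamma>)\<close> in the ultrapower, hence is represented by a sequence of central
  elements, from which it has distance at least \<open>1/\<surd>2\<close>.
\<close>

theorem ex_finite_set_with_central_centralizer:
  assumes count: "countable S" and \<omega>: "free_ultrafilter \<omega>"
    and central: "commutant_in_ultrapower \<Gamma> \<omega> = ultrapower_of_center \<Gamma> \<omega>"
  shows "\<exists>F. finite F \<and> F \<subseteq> S \<and>
    (\<forall>g\<in>S. (\<forall>t\<in>F. g \<otimes> t = t \<otimes> g) \<longrightarrow> (\<forall>t\<in>S. g \<otimes> t = t \<otimes> g))"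
proof (rule ccontr)
  assume no: "\<not> ?thesis"
  let ?B = "bounded_sequences \<Gamma> M" and ?I = "null_sequences \<Gamma> \<omega>"
  interpret I: ideal ?I ?B
    by (rule ideal_null_sequences)
  let ?F = "\<lambda>n. from_nat_into S ` {..n::nat}"
  have S_ne: "S \<noteq> {}"
    using one_closed by blast
  have "\<exists>g\<in>S. (\<forall>t\<in>?F n. g \<otimes> t = t \<otimes> g) \<and> \<not> (\<forall>t\<in>S. g \<otimes> t = t \<otimes> g)" for n
  proof -
    have "finite (?F n)" "?F n \<subseteq> S"
      using from_nat_into[OF S_ne] by auto
    then show ?thesis
      using no by blast
  qed
  then obtain g where gS: "\<And>n. g n \<in> S" and gF: "\<And>n t. t \<in> ?F n \<Longrightarrow> g n \<otimes> t = t \<otimes> g n"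
    and noncentral: "\<And>n. \<exists>t\<in>S. g n \<otimes> t \<noteq> t \<otimes> g n"
    by metis
  have eventually_comm: "\<forall>\<^sub>F n in sequentially. g n \<otimes> t = t \<otimes> g n" if t: "t \<in> S" for t
  proof -
    have "t \<in> range (from_nat_into S)"
      using t range_from_nat_into[OF S_ne count] by simp
    then obtain k where "t = from_nat_into S k"
      by blast
    then have "g n \<otimes> t = t \<otimes> g n" if "n \<ge> k" for n
      using gF[of t n] that by blast
    then show ?thesis
      unfolding eventually_sequentially by blast
  qed
  define u where "u = (\<lambda>n. L (g n))"
  have "norm (u n) \<le> 1" for n
    unfolding u_def by (rule norm_blinfun_bound) (auto simp: norm_L_apply_le gS)
  then have uB: "u \<in> carrier ?B"
    unfolding bounded_sequences_carrier u_def using gS L_in_M by blast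
  have class_in: "ultra_class \<Gamma> \<omega> u \<in> carrier (ultrapower \<Gamma> \<omega>)"
    unfolding ultrapower_def ultra_class_def FactRing_def
    using I.a_rcosetsI[OF I.a_subset uB] by simp
  have class_mult: "ultra_class \<Gamma> \<omega> x \<otimes>\<^bsub>ultrapower \<Gamma> \<omega>\<^esub> ultra_class \<Gamma> \<omega> y = ultra_class \<Gamma> \<omega> (\<lambda>n. x n o\<^sub>L y n)"
    if "x \<in> carrier ?B" "y \<in> carrier ?B" for x y
    using I.rcoset_mult_add[OF that]
    by (simp add: ultrapower_def ultra_class_def FactRing_def bounded_sequences_simps)
  have "ultra_class \<Gamma> \<omega> (\<lambda>n. u n o\<^sub>L a) = ultra_class \<Gamma> \<omega> (\<lambda>n. a o\<^sub>L u n)" if a: "a \<in> M" for a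
  proof -
    have aB: "(\<lambda>_. a) \<in> carrier ?B"
      by (rule bounded_sequences_const[OF a])
    let ?ua = "\<lambda>n. u n o\<^sub>L a" and ?au = "\<lambda>n. a o\<^sub>L u n"
    have uaB: "?ua \<in> carrier ?B" and auB: "?au \<in> carrier ?B"
      using bounded_sequences_mult[OF uB aB] bounded_sequences_mult[OF aB uB] by simp_all
    let ?h = "\<lambda>n. ?ua n + - ?au n"
    have "?h \<in> carrier ?B"
      by (rule bounded_sequences_add[OF uaB bounded_sequences_uminus[OF auB]])
    moreover have "?h n \<delta> = L (g n) (a \<delta>) - R (inv (g n)) (a \<delta>)" for n
      using M_ket[OF a gS[of n]] gS[of n] by (simp add: u_def blinfun.diff_left L_ket)
    then have "(\<lambda>n. norm (?h n \<delta>)) \<longlonglongrightarrow> 0"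
      using tendsto_commutator[of g "a \<delta>"] gS eventually_comm by simp
    then have "((\<lambda>n. norm (?h n \<delta>)) \<longlongrightarrow> 0) \<omega>"
      by (rule tendsto_mono[OF free_ultrafilter_le_sequentially[OF \<omega>]])
    ultimately have hI: "?h \<in> ?I"
      by (simp only: null_sequences_iff)
    have "?ua \<in> ?I +>\<^bsub>?B\<^esub> ?au"
      unfolding a_r_coset_def' using hI by (intro UN_I[of ?h]) (auto simp: bounded_sequences_simps)
    then show ?thesis
      unfolding ultra_class_def using I.a_repr_independence'[OF _ auB] by metis
  qed
  then have "ultra_class \<Gamma> \<omega> u \<in> commutant_in_ultrapower \<Gamma> \<omega>"
    unfolding commutant_in_ultrapower_def
    using class_in class_mult uB bounded_sequences_const by simp
  then obtain z where z: "z \<in> carrier (bounded_sequences \<Gamma> (center_vNa \<Gamma>))"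
      and eq: "ultra_class \<Gamma> \<omega> u = ultra_class \<Gamma> \<omega> z"
    unfolding central ultrapower_of_center_def by blast
  have "u \<in> ?I +>\<^bsub>?B\<^esub> z"
    using I.a_rcos_self[OF uB] eq unfolding ultra_class_def by simp
  then obtain h where h: "h \<in> ?I" "u = (\<lambda>n. h n + z n)"
    unfolding a_r_coset_def' by (auto simp: bounded_sequences_simps)
  have "((\<lambda>n. norm (h n \<delta>)) \<longlongrightarrow> 0) \<omega>"
    using h(1) by (simp add: null_sequences_iff)
  then have "((\<lambda>n. (norm (h n \<delta>))\<^sup>2) \<longlongrightarrow> 0\<^sup>2) \<omega>"
    by (rule tendsto_power)
  then have "\<forall>\<^sub>F n in \<omega>. (norm (h n \<delta>))\<^sup>2 < 1 / 2"
    by (rule order_tendstoD) simp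
  then obtain n where n: "(norm (h n \<delta>))\<^sup>2 < 1 / 2"
    using \<omega> eventually_happens' unfolding free_ultrafilter_def by blast
  obtain t where t: "t \<in> S" "g n \<otimes> t \<noteq> t \<otimes> g n"
    using noncentral by blast
  have "z n \<in> center_vNa \<Gamma>"
    using z by (auto simp: bounded_sequences_def)
  then have "1 / 2 \<le> (norm (L (g n) \<delta> - z n \<delta>))\<^sup>2"
    by (rule distance_to_center[OF _ gS t])
  moreover have "h n \<delta> = L (g n) \<delta> - z n \<delta>"
    using fun_cong[OF h(2), of n] by (simp add: u_def blinfun.add_left)
  ultimately show False
    using n by simp
qed

section \<open>Rigidity of conjugates of a finite automorphism group\<close>

text \<open>
  This formula reads \<open>Inn(s) \<phi> Inn(s)\<^sup>-\<^sup>1 = Inn(s \<phi>(s)\<^sup>-\<^sup>1) \<phi>\<close>: for fixed \<open>\<phi>\<close> only an inner automorphism varies.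
\<close>

lemma conj_aut_eq:
  assumes \<phi>: "\<phi> \<in> auto \<Gamma>" and s: "s \<in> S" and t: "t \<in> S"
  shows "conj_aut s \<phi> t = (s \<otimes> inv (\<phi> s)) \<otimes> \<phi> t \<otimes> inv (s \<otimes> inv (\<phi> s))"
  using s t autoD(2)[OF \<phi>]
  by (simp add: conj_aut_def autoD(3)[OF \<phi>] auto_inv[OF \<phi>] inv_mult_group m_assoc)

text \<open>
  If only central elements commute with \<open>F\<close>, the same holds for \<open>\<phi>(F)\<close>. Hence the values on \<open>F\<close> determine
  the cocycle \<open>s \<phi>(s)\<^sup>-\<^sup>1\<close> modulo the centre.
\<close>

lemma conj_aut_determines_cocycle:
  assumes F: "F \<subseteq> S"
    and central: "\<And>g. g \<in> S \<Longrightarrow> \<forall>t\<in>F. g \<otimes> t = t \<otimes> g \<Longrightarrow> \<forall>t\<in>S. g \<otimes> t = t \<otimes> g"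
    and \<phi>: "\<phi> \<in> auto \<Gamma>" and s: "s \<in> S" "s' \<in> S"
    and eq: "\<And>t. t \<in> F \<Longrightarrow> conj_aut s \<phi> t = conj_aut s' \<phi> t"
    and u: "u \<in> S"
  shows "inv (s' \<otimes> inv (\<phi> s')) \<otimes> (s \<otimes> inv (\<phi> s)) \<otimes> u = u \<otimes> (inv (s' \<otimes> inv (\<phi> s')) \<otimes> (s \<otimes> inv (\<phi> s)))"
proof -
  note \<phi>S = autoD(2)[OF \<phi>]
  define c where "c = s \<otimes> inv (\<phi> s)"
  define c' where "c' = s' \<otimes> inv (\<phi> s')"
  have cS: "c \<in> S" "c' \<in> S"
    using s \<phi>S by (auto simp: c_def c'_def)
  define d where "d = inv c' \<otimes> c"
  have dS: "d \<in> S"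
    using cS by (simp add: d_def)
  have conj_comm: "inv c' \<otimes> c \<otimes> x = x \<otimes> (inv c' \<otimes> c)"
    if "c \<otimes> x \<otimes> inv c = c' \<otimes> x \<otimes> inv c'" "x \<in> S" for x
  proof -
    have cancel: "inv c' \<otimes> (c' \<otimes> y) = y" if "y \<in> S" for y
      using that cS by (simp flip: m_assoc)
    have "c \<otimes> x = (c \<otimes> x \<otimes> inv c) \<otimes> c"
      using that(2) cS by (simp add: m_assoc)
    also have "\<dots> = c' \<otimes> (x \<otimes> (inv c' \<otimes> c))"
      unfolding that(1) using that(2) cS by (simp add: m_assoc)
    finally have "inv c' \<otimes> (c \<otimes> x) = x \<otimes> (inv c' \<otimes> c)"
      using that(2) cS by (simp add: cancel)
    then show ?thesis
      using that(2) cS by (simp add: m_assoc)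
  qed
  obtain d0 where d0: "d0 \<in> S" "d = \<phi> d0"
    using auto_surjE[OF \<phi> dS] .
  have inj: "x = y" if "\<phi> x = \<phi> y" "x \<in> S" "y \<in> S" for x y
    using bij_betw_imp_inj_on[OF autoD(1)[OF \<phi>]] that by (auto dest: inj_onD)
  have "d0 \<otimes> t = t \<otimes> d0" if t: "t \<in> F" for t
  proof (rule inj)
    have tS: "t \<in> S"
      using t F by blast
    then have "c \<otimes> \<phi> t \<otimes> inv c = c' \<otimes> \<phi> t \<otimes> inv c'"
      using eq[OF t] conj_aut_eq[OF \<phi> _ tS] s by (simp add: c_def c'_def)
    then have "d \<otimes> \<phi> t = \<phi> t \<otimes> d"
      unfolding d_def using \<phi>S[OF tS] by (rule conj_comm)
    then show "\<phi> (d0 \<otimes> t) = \<phi> (t \<otimes> d0)"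
      using d0 tS by (simp add: autoD(3)[OF \<phi>])
  qed (use d0 t F in auto)
  then have comm: "\<forall>t\<in>S. d0 \<otimes> t = t \<otimes> d0"
    by (intro central d0) blast
  obtain t where t: "t \<in> S" "u = \<phi> t"
    using auto_surjE[OF \<phi> u] .
  have "d \<otimes> u = u \<otimes> d"
    using comm d0 t autoD(3)[OF \<phi>] by metis
  then show ?thesis
    by (simp add: d_def c_def c'_def)
qed

lemma conj_aut_determined:
  assumes F: "F \<subseteq> S"
    and central: "\<And>g. g \<in> S \<Longrightarrow> \<forall>t\<in>F. g \<otimes> t = t \<otimes> g \<Longrightarrow> \<forall>t\<in>S. g \<otimes> t = t \<otimes> g"
    and \<phi>: "\<phi> \<in> auto \<Gamma>" and s: "s \<in> S" "s' \<in> S"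
    and eq: "\<And>t. t \<in> F \<Longrightarrow> conj_aut s \<phi> t = conj_aut s' \<phi> t"
  shows "conj_aut s \<phi> = conj_aut s' \<phi>"
proof (rule extensionalityI[where A = S])
  fix t assume t: "t \<in> S"
  define c where "c = s \<otimes> inv (\<phi> s)"
  define c' where "c' = s' \<otimes> inv (\<phi> s')"
  have S: "c \<in> S" "c' \<in> S" "\<phi> t \<in> S"
    using s t autoD(2)[OF \<phi>] by (auto simp: c_def c'_def)
  have comm: "inv c' \<otimes> c \<otimes> \<phi> t = \<phi> t \<otimes> (inv c' \<otimes> c)"
    unfolding c_def c'_def by (rule conj_aut_determines_cocycle[OF F central \<phi> s eq S(3)])
  have cancel: "c' \<otimes> (inv c' \<otimes> x) = x" if "x \<in> S" for x
    using that S by (simp flip: m_assoc)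
  have "c \<otimes> \<phi> t = c' \<otimes> (inv c' \<otimes> c \<otimes> \<phi> t)"
    using S by (simp add: m_assoc cancel)
  also have "\<dots> = c' \<otimes> \<phi> t \<otimes> inv c' \<otimes> c"
    unfolding comm using S by (simp add: m_assoc)
  finally have "c \<otimes> \<phi> t \<otimes> inv c = c' \<otimes> \<phi> t \<otimes> inv c'"
    using S by (simp add: m_assoc)
  then show "conj_aut s \<phi> t = conj_aut s' \<phi> t"
    unfolding conj_aut_eq[OF \<phi> s(1) t] conj_aut_eq[OF \<phi> s(2) t] c_def c'_def .
qed (auto simp: conj_aut_def)

section \<open>The Effros-Marechal topology\<close>

lemma topspace_EM: "topspace (EM_topology \<Gamma>) = Sub_vNa \<Gamma>"
proof -
  have "Sub_vNa \<Gamma> = {N \<in> Sub_vNa \<Gamma>. blinfun_apply (cond_exp \<Gamma> N 0) \<delta> \<in> UNIV}"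
    by simp
  then have "Sub_vNa \<Gamma> \<in> {{N \<in> Sub_vNa \<Gamma>. blinfun_apply (cond_exp \<Gamma> N x) \<delta> \<in> V} | x V. x \<in> M \<and> open V}"
    using M_zero by blast
  then show ?thesis
    unfolding EM_topology_def topology_generated_by_topspace by blast
qed

lemma openin_EM:
  "x \<in> M \<Longrightarrow> open V \<Longrightarrow> openin (EM_topology \<Gamma>) {N \<in> Sub_vNa \<Gamma>. blinfun_apply (cond_exp \<Gamma> N x) \<delta> \<in> V}"
  unfolding EM_topology_def by (rule topology_generated_by_Basis) blast

lemma cond_exp_id: "P \<in> Sub_vNa \<Gamma> \<Longrightarrow> x \<in> P \<Longrightarrow> cond_exp \<Gamma> P x = x"
  using Sub_vNa_D(1)[of P x] by (intro cond_exp_eqI) auto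

text \<open>
  A subalgebra is the fixed-point set of its expectation, and the expectation of \<open>x\<close> is determined by
  its vector; so distinct subalgebras are separated by one of the defining maps of the topology.
\<close>

lemma t1_space_EM: "t1_space (EM_topology \<Gamma>)"
  unfolding t1_space_def topspace_EM
proof (intro ballI impI)
  fix P Q assume P: "P \<in> Sub_vNa \<Gamma>" and Q: "Q \<in> Sub_vNa \<Gamma>" and "P \<noteq> Q"
  obtain x where x: "x \<in> M" "cond_exp \<Gamma> P x \<delta> \<noteq> cond_exp \<Gamma> Q x \<delta>"
  proof -
    have eq: "cond_exp \<Gamma> P x = cond_exp \<Gamma> Q x" if "x \<in> M" "cond_exp \<Gamma> P x \<delta> = cond_exp \<Gamma> Q x \<delta>" for x
      using that cond_exp_in[OF P] cond_exp_in[OF Q] Sub_vNa_D(1)[OF P] Sub_vNa_D(1)[OF Q] M_eqI by blast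
    consider x where "x \<in> P" "x \<notin> Q" | x where "x \<in> Q" "x \<notin> P"
      using \<open>P \<noteq> Q\<close> by blast
    then show ?thesis
    proof cases
      case 1
      then have "x \<in> M" "cond_exp \<Gamma> P x \<noteq> cond_exp \<Gamma> Q x"
        using Sub_vNa_D(1)[OF P] cond_exp_id[OF P] cond_exp_in[OF Q] by metis+
      then show ?thesis
        using that eq by blast
    next
      case 2
      then have "x \<in> M" "cond_exp \<Gamma> P x \<noteq> cond_exp \<Gamma> Q x"
        using Sub_vNa_D(1)[OF Q] cond_exp_id[OF Q] cond_exp_in[OF P] by metis+
      then show ?thesis
        using that eq by blast
    qed
  qed
  let ?U = "{N \<in> Sub_vNa \<Gamma>. blinfun_apply (cond_exp \<Gamma> N x) \<delta> \<in> - {cond_exp \<Gamma> Q x \<delta>}}"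
  have "openin (EM_topology \<Gamma>) ?U"
    using x(1) by (rule openin_EM) (simp add: open_Compl)
  moreover have "P \<in> ?U" "Q \<notin> ?U"
    using P x(2) by auto
  ultimately show "\<exists>U. openin (EM_topology \<Gamma>) U \<and> P \<in> U \<and> Q \<notin> U"
    by blast
qed

section \<open>The orbit of the fixed-point algebra under conjugation\<close>

text \<open>
  The vector of \<open>E(\<lambda>\<^sub>t)\<close> is \<open>1/\<bar>K\<bar> \<Sum>\<delta>\<^bsub>\<phi> t\<^esub>\<close>: its coefficients count coincidences and are at least \<open>1/\<bar>K\<bar>\<close>
  on the orbit of \<open>t\<close>, without cancellation.
\<close>

lemma coord_cond_exp_fixed:
  assumes K: "aut_group K" and \<phi>: "\<phi> \<in> K" and t: "t \<in> S"
  shows "1 / real (card K) \<le> cmod (coord (cond_exp \<Gamma> (fixed_vNa \<Gamma> K) (L t) \<delta>) (\<phi> t))"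
proof -
  note KD = aut_groupD[OF K]
  have "coord (cond_exp \<Gamma> (fixed_vNa \<Gamma> K) (L t) \<delta>) (\<phi> t)
      = (1 / of_nat (card K)) * (\<Sum>\<psi>\<in>K. if \<phi> t = \<psi> t then 1 else 0)"
    unfolding cond_exp_fixed[OF K L_in_M[OF t]] using KD(3) t
    by (simp add: L_ket U_ket coord_ket)
  also have "\<dots> = complex_of_real (real (card {\<psi>\<in>K. \<phi> t = \<psi> t}) / real (card K))"
    using KD(1) by (simp add: sum.If_cases Int_def)
  finally have eq: "coord (cond_exp \<Gamma> (fixed_vNa \<Gamma> K) (L t) \<delta>) (\<phi> t)
      = complex_of_real (real (card {\<psi>\<in>K. \<phi> t = \<psi> t}) / real (card K))" .
  have "1 \<le> card {\<psi>\<in>K. \<phi> t = \<psi> t}"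
    using \<phi> KD(1) by (auto simp: Suc_le_eq card_gt_0_iff)
  then have "1 / real (card K) \<le> real (card {\<psi>\<in>K. \<phi> t = \<psi> t}) / real (card K)"
    by (intro divide_right_mono) auto
  then show ?thesis
    unfolding eq norm_of_real by linarith
qed

lemma conj_vNa_conj_vNa:
  assumes "g \<in> S" "s \<in> S"
  shows "conj_vNa \<Gamma> g (conj_vNa \<Gamma> s N) = conj_vNa \<Gamma> (g \<otimes> s) N"
proof -
  have "L g o\<^sub>L (L s o\<^sub>L x o\<^sub>L adj (L s)) o\<^sub>L adj (L g) = L (g \<otimes> s) o\<^sub>L x o\<^sub>L adj (L (g \<otimes> s))" for x
    using assms by (intro blinfun_eqI) (simp add: adj_L L_L inv_mult_group)
  then show ?thesis
    unfolding conj_vNa_def image_image by simp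
qed

text \<open>\<open>f\<close> factors through \<open>h\<close> on \<open>A\<close>.\<close>

lemma finite_image_factor:
  assumes "finite (h ` A)" and "\<And>a b. a \<in> A \<Longrightarrow> b \<in> A \<Longrightarrow> h a = h b \<Longrightarrow> f a = f b"
  shows "finite (f ` A)"
proof -
  have "f ` A \<subseteq> (\<lambda>v. f (SOME a. a \<in> A \<and> h a = v)) ` (h ` A)"
  proof
    fix y assume "y \<in> f ` A"
    then obtain a where a: "a \<in> A" "y = f a"
      by blast
    let ?b = "SOME b. b \<in> A \<and> h b = h a"
    have "?b \<in> A \<and> h ?b = h a"
      by (rule someI[of _ a]) (simp add: a)
    then have "y = f ?b"
      using a assms(2) by metis
    then show "y \<in> (\<lambda>v. f (SOME a. a \<in> A \<and> h a = v)) ` (h ` A)"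
      using a by blast
  qed
  then show ?thesis
    using assms(1) finite_surj by blast
qed

end

text \<open>
  A finite group \<open>G\<close> of automorphisms and a finite set \<open>F\<close> whose centralizer is the centre. \<open>N s\<close> is the
  point \<open>\<lambda>\<^sub>s L(\<Gamma>)\<^sup>G \<lambda>\<^sub>s\<^sup>*\<close> of the orbit and \<open>E P t\<close> the \<open>L\<^sup>2\<close>-vector of \<open>E\<^sub>P(\<lambda>\<^sub>t)\<close>.
\<close>

locale finite_automorphism_group = discrete_group +
  fixes G :: "('a \<Rightarrow> 'a) set" and F :: "'a set"
  assumes G: "aut_group G" and finite_F: "finite F" and F_S: "F \<subseteq> S"
    and central: "\<And>g. g \<in> S \<Longrightarrow> \<forall>t\<in>F. g \<otimes> t = t \<otimes> g \<Longrightarrow> \<forall>t\<in>S. g \<otimes> t = t \<otimes> g"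
begin

lemmas GD = aut_groupD[OF G]

abbreviation N :: "'a \<Rightarrow> 'a ell2_op set" where
  "N s \<equiv> conj_vNa \<Gamma> s (fixed_vNa \<Gamma> G)"

abbreviation E :: "'a ell2_op set \<Rightarrow> 'a \<Rightarrow> 'a ell2" where
  "E P t \<equiv> blinfun_apply (cond_exp \<Gamma> P (L t)) \<delta>"

lemma N_Sub: "s \<in> S \<Longrightarrow> N s \<in> Sub_vNa \<Gamma>"
  by (simp add: conj_fixed G fixed_in_Sub_vNa aut_group_conj)

lemma card_G: "card G > 0"
  using GD(1,2) by (simp add: card_gt_0_iff)

lemma coord_E_N:
  assumes s: "s \<in> S" and t: "t \<in> S" and \<phi>: "\<phi> \<in> G"
  shows "1 / real (card G) \<le> cmod (coord (E (N s) t) (conj_aut s \<phi> t))"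
proof -
  let ?K = "conj_aut s ` G"
  have K: "aut_group ?K"
    by (rule aut_group_conj[OF G s])
  have "card ?K \<le> card G" "card ?K > 0"
    using GD(1,2) by (auto simp: card_image_le card_gt_0_iff)
  then have "1 / real (card G) \<le> 1 / real (card ?K)"
    by (simp add: frac_le)
  also have "\<dots> \<le> cmod (coord (E (N s) t) (conj_aut s \<phi> t))"
    unfolding conj_fixed[OF G s] using \<phi> by (intro coord_cond_exp_fixed[OF K _ t]) blast
  finally show ?thesis .
qed

text \<open>The finite data that determine the point \<open>N s\<close> of the orbit.\<close>

definition values_on_F :: "'a \<Rightarrow> ('a \<Rightarrow> 'a) \<times> 'a \<Rightarrow> 'a" where
  "values_on_F s = (\<lambda>(\<phi>, t)\<in>G \<times> F. conj_aut s \<phi> t)"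

lemma finite_values_on_F:
  assumes D: "\<And>t. t \<in> F \<Longrightarrow> finite (D t)"
    and in_D: "\<And>s \<phi> t. s \<in> A \<Longrightarrow> \<phi> \<in> G \<Longrightarrow> t \<in> F \<Longrightarrow> conj_aut s \<phi> t \<in> D t"
  shows "finite (values_on_F ` A)"
proof (rule finite_subset)
  show "values_on_F ` A \<subseteq> (\<Pi>\<^sub>E p\<in>G \<times> F. D (snd p))"
    using in_D by (auto simp: values_on_F_def split: if_splits)
  show "finite (\<Pi>\<^sub>E p\<in>G \<times> F. D (snd p))"
    using GD(1) finite_F D by (intro finite_PiE) auto
qed

lemma values_on_F_eqD:
  assumes "values_on_F s = values_on_F s'" "\<phi> \<in> G" "t \<in> F"
  shows "conj_aut s \<phi> t = conj_aut s' \<phi> t"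
  using fun_cong[OF assms(1), of "(\<phi>, t)"] assms(2,3) by (simp add: values_on_F_def)

lemma N_determined:
  assumes s: "s \<in> S" "s' \<in> S" and eq: "values_on_F s = values_on_F s'"
  shows "N s = N s'"
proof -
  have "conj_aut s \<phi> = conj_aut s' \<phi>" if "\<phi> \<in> G" for \<phi>
    using that by (intro conj_aut_determined[OF F_S central GD(3) s] values_on_F_eqD[OF eq]) auto
  then have "conj_aut s ` G = conj_aut s' ` G"
    by simp
  then show ?thesis
    using s by (simp add: conj_fixed G)
qed

abbreviation "orbit \<equiv> {N s | s. s \<in> S}"

text \<open>
  The neighbourhood requires the vectors of \<open>E(\<lambda>\<^sub>t)\<close>, \<open>t \<in> F\<close>, to be within \<open>1/(2\<bar>G\<bar>)\<close> of those for \<open>P\<close>. For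
  \<open>N s\<close> in it, the points \<open>conj_aut s \<phi> t\<close> then carry weight at least \<open>1/(2\<bar>G\<bar>)\<close> in a fixed
  square-summable vector, which leaves finitely many values, hence finitely many \<open>N s\<close>.
\<close>

lemma ex_neighbourhood_meeting_orbit_finitely:
  assumes P: "P \<in> Sub_vNa \<Gamma>"
  obtains V where "openin (EM_topology \<Gamma>) V" "P \<in> V" "finite (orbit \<inter> V)"
proof -
  define \<epsilon> where "\<epsilon> = 1 / (2 * real (card G))"
  have \<epsilon>: "\<epsilon> > 0" "1 / real (card G) = 2 * \<epsilon>"
    using card_G by (auto simp: \<epsilon>_def)
  let ?W = "\<lambda>t. {Q \<in> Sub_vNa \<Gamma>. E Q t \<in> ball (E P t) \<epsilon>}"
  let ?V = "(\<Inter>t\<in>F. ?W t) \<inter> topspace (EM_topology \<Gamma>)"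
  have "openin (EM_topology \<Gamma>) ?V"
    using finite_F F_S L_in_M by (intro openin_INT openin_EM) auto
  moreover have "P \<in> ?V"
    using P \<epsilon> by (auto simp: topspace_EM)
  moreover have "finite (orbit \<inter> ?V)"
  proof -
    let ?A = "{s \<in> S. N s \<in> ?V}"
    let ?D = "\<lambda>t. {u. \<epsilon> \<le> cmod (coord (E P t) u)}"
    have "conj_aut s \<phi> t \<in> ?D t" if s: "s \<in> ?A" and \<phi>: "\<phi> \<in> G" and t: "t \<in> F" for s \<phi> t
    proof -
      let ?u = "conj_aut s \<phi> t"
      have "N s \<in> ?W t"
        using s t by blast
      then have "norm (E P t - E (N s) t) < \<epsilon>"
        by (simp add: dist_norm)
      then have "cmod (coord (E P t) ?u - coord (E (N s) t) ?u) < \<epsilon>"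
        using cmod_coord_le[of "E P t - E (N s) t" ?u] by simp
      moreover have "2 * \<epsilon> \<le> cmod (coord (E (N s) t) ?u)"
        using coord_E_N[of s t \<phi>] s t F_S \<phi> \<epsilon>(2) by auto
      moreover have "cmod (coord (E (N s) t) ?u)
          \<le> cmod (coord (E P t) ?u) + cmod (coord (E P t) ?u - coord (E (N s) t) ?u)"
        using norm_triangle_ineq4[of "coord (E P t) ?u" "coord (E P t) ?u - coord (E (N s) t) ?u"] by simp
      ultimately show ?thesis
        by simp
    qed
    then have "finite (values_on_F ` ?A)"
      using finite_large_coords[OF \<epsilon>(1)] by (intro finite_values_on_F[where D = ?D]) auto
    then have "finite (N ` ?A)"
    proof (rule finite_image_factor)
      show "N a = N b" if "a \<in> ?A" "b \<in> ?A" "values_on_F a = values_on_F b" for a b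
        using that by (intro N_determined) simp_all
    qed
    moreover have "orbit \<inter> ?V \<subseteq> N ` ?A"
      by blast
    ultimately show ?thesis
      by (rule finite_subset[rotated])
  qed
  ultimately show thesis
    by (rule that)
qed

text \<open>
  A set without accumulation points is closed and discrete. Minimality is automatic for a single orbit.
\<close>

theorem discrete_URA_orbit: "discrete_URA \<Gamma> orbit"
proof -
  let ?T = "EM_topology \<Gamma>"
  have sub: "orbit \<subseteq> topspace ?T"
    using N_Sub by (auto simp: topspace_EM)
  have "?T derived_set_of orbit = {}"
  proof -
    have "P \<notin> ?T derived_set_of orbit" if "P \<in> Sub_vNa \<Gamma>" for P
      using ex_neighbourhood_meeting_orbit_finitely[OF that] t1_space_EM
      unfolding t1_space_derived_set_of_infinite_openin by blast
    then show ?thesis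
      using derived_set_of_subset_topspace[of ?T orbit] unfolding topspace_EM by blast
  qed
  then have closed: "closedin ?T orbit" and discrete: "subtopology ?T orbit = discrete_topology orbit"
    using sub by (auto simp: closedin_contains_derived_set subtopology_eq_discrete_topology_eq)
  have invariant: "conj_vNa \<Gamma> g Q \<in> orbit" if "g \<in> S" "Q \<in> orbit" for g Q
    using that conj_vNa_conj_vNa m_closed by blast
  have minimal: "Z = orbit" if Z: "Z \<subseteq> orbit" "Z \<noteq> {}" and inv: "\<forall>s\<in>S. \<forall>z\<in>Z. conj_vNa \<Gamma> s z \<in> Z" for Z
  proof -
    obtain s where s: "s \<in> S" "N s \<in> Z"
      using Z by blast
    have "N t \<in> Z" if t: "t \<in> S" for t
    proof -
      have "conj_vNa \<Gamma> (t \<otimes> inv s) (N s) \<in> Z"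
        using inv s t by simp
      then show ?thesis
        using s t by (simp add: conj_vNa_conj_vNa m_assoc)
    qed
    then show ?thesis
      using Z by blast
  qed
  have nonempty: "orbit \<noteq> {}"
    using one_closed by blast
  have "URA \<Gamma> orbit"
    unfolding URA_def minimal_closed_invariant_def Let_def
  proof (intro conjI ballI allI impI)
    show "Z = orbit"
      if "Z \<subseteq> orbit \<and> Z \<noteq> {} \<and> closedin ?T Z \<and> (\<forall>s\<in>S. \<forall>z\<in>Z. conj_vNa \<Gamma> s z \<in> Z)" for Z
      using that by (elim conjE) (rule minimal)
  qed (fact nonempty closed | (rule invariant; assumption))+
  then show ?thesis
    using discrete by (simp add: discrete_URA_def)
qed

text \<open>
  If the two algebras were equal, \<open>\<lambda>\<^sub>h\<close> would be fixed for \<open>h \<in> H\<close>, so \<open>\<phi>\<close> would fix \<open>H\<close> pointwise. But elements of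
  \<open>L(H)\<close> are supported on \<open>H\<close>, and \<open>E(\<lambda>\<^sub>t)\<close> is not zero at \<open>\<phi>(t)\<close>; thus \<open>\<phi>(t) \<in> H\<close> is fixed, which
  forces \<open>\<phi>(t) = t\<close>.
\<close>

lemma fixed_ne_subgroup_vNa:
  assumes H: "subgroup H \<Gamma>" and \<phi>: "\<phi> \<in> G" and t: "t \<in> S" "\<phi> t \<noteq> t"
  shows "fixed_vNa \<Gamma> G \<noteq> subgroup_vNa \<Gamma> H"
proof
  assume eq: "fixed_vNa \<Gamma> G = subgroup_vNa \<Gamma> H"
  have HS: "H \<subseteq> S"
    by (rule subgroup.subset[OF H])
  have \<phi>t: "\<phi> t \<in> S"
    by (rule autoD(2)[OF GD(3)[OF \<phi>] t(1)])
  have fixed: "\<phi> h = h" if h: "h \<in> H" for h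
  proof -
    have "L h \<in> subgroup_vNa \<Gamma> H"
      unfolding subgroup_vNa_def using subset_double_commutant[of "L ` H" S] L_bounded_ops HS h by blast
    then have "coord (L h \<delta>) (\<phi> h) = coord (L h \<delta>) h"
      unfolding eq[symmetric] fixed_iff_coord[OF G] using \<phi> h HS by blast
    then show ?thesis
      using h HS by (auto simp: L_ket coord_ket split: if_splits)
  qed
  have proj: "ell2_proj H \<in> commutant S (L ` H)"
    unfolding commutant_def
  proof (clarsimp, intro conjI ballI)
    show pb: "ell2_proj H \<in> bounded_ops S"
      using HS by (intro bounded_opsI) (auto simp: ell2_proj_apply coord_ket intro!: coord_eqI)
    fix h assume h: "h \<in> H"
    then have hS: "h \<in> S"
      using HS by blast
    show "ell2_proj H o\<^sub>L L h = L h o\<^sub>L ell2_proj H"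
    proof (rule bounded_ops_eq_on_kets[where A = S])
      fix u assume u: "u \<in> S"
      have "h \<otimes> u \<in> H \<longleftrightarrow> u \<in> H"
        using H h u hS by (metis inv_solve_left subgroup.m_closed subgroup.m_inv_closed m_closed)
      moreover have "restrict_ell2 H (ket x) = (if x \<in> H then ket x else 0)" for x
        by (intro coord_eqI) (auto simp: coord_ket)
      ultimately show "(ell2_proj H o\<^sub>L L h) (ket u) = (L h o\<^sub>L ell2_proj H) (ket u)"
        using hS u by (simp add: ell2_proj_apply L_ket)
    qed (auto simp: bounded_ops_closed pb L_bounded_ops hS)
  qed
  have supp: "coord (y \<delta>) u = 0" if y: "y \<in> subgroup_vNa \<Gamma> H" and u: "u \<notin> H" for y u
  proof -
    have "y (ell2_proj H \<delta>) = ell2_proj H (y \<delta>)"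
      using y proj unfolding subgroup_vNa_def commutant_iff[of y] by blast
    moreover have "ell2_proj H \<delta> = \<delta>"
      using subgroup.one_closed[OF H] by (intro coord_eqI) (auto simp: ell2_proj_apply coord_ket)
    ultimately have "y \<delta> = restrict_ell2 H (y \<delta>)"
      by (simp add: ell2_proj_apply)
    then show ?thesis
      using u by (metis coord_restrict)
  qed
  have "cond_exp \<Gamma> (fixed_vNa \<Gamma> G) (L t) \<in> subgroup_vNa \<Gamma> H"
    using cond_exp_in[OF fixed_in_Sub_vNa[OF G] L_in_M[OF t(1)]] unfolding eq .
  then have "\<phi> t \<in> H"
    using coord_cond_exp_fixed[OF G \<phi> t(1)] supp card_G by fastforce
  then have "\<phi> (\<phi> t) = \<phi> t"
    by (rule fixed)
  then have "\<phi> t = t"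
    using bij_betw_imp_inj_on[OF autoD(1)[OF GD(3)[OF \<phi>]]] \<phi>t t(1) by (auto dest: inj_onD)
  then show False
    using t(2) by blast
qed

lemma conj_one: "N \<one> = fixed_vNa \<Gamma> G"
proof -
  have "conj_aut \<one> \<phi> = \<phi>" if "\<phi> \<in> G" for \<phi>
    using autoD(2,4)[OF GD(3)[OF that]]
    by (intro extensionalityI[where A = S]) (auto simp: conj_aut_def)
  then show ?thesis
    by (simp add: conj_fixed G)
qed

theorem exotic_URA_orbit:
  assumes \<phi>: "\<phi> \<in> G" and t: "t \<in> S" "\<phi> t \<noteq> t"
  shows "exotic_URA \<Gamma> orbit"
  unfolding exotic_URA_def
proof
  show "URA \<Gamma> orbit"
    using discrete_URA_orbit by (simp add: discrete_URA_def)
  show "\<not> (\<exists>Y. URS \<Gamma> Y \<and> orbit = {subgroup_vNa \<Gamma> H | H. H \<in> Y})"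
  proof clarify
    fix Y assume Y: "URS \<Gamma> Y" and eq: "orbit = {subgroup_vNa \<Gamma> H | H. H \<in> Y}"
    have "closedin (chabauty_topology \<Gamma>) Y"
      using Y unfolding URS_def minimal_closed_invariant_def Let_def by blast
    then have "Y \<subseteq> topspace (chabauty_topology \<Gamma>)"
      by (rule closedin_subset)
    then have Y_subgroups: "subgroup H \<Gamma>" if "H \<in> Y" for H
      using that unfolding chabauty_topology_def topspace_pullback_topology by blast
    have "fixed_vNa \<Gamma> G \<in> orbit"
      using conj_one one_closed by blast
    then obtain H where "H \<in> Y" "fixed_vNa \<Gamma> G = subgroup_vNa \<Gamma> H"
      unfolding eq by blast
    then show False
      using fixed_ne_subgroup_vNa[OF Y_subgroups \<phi> t] by blast
  qed
qed

text \<open>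
  If the orbit is finite and the centre is trivial, the cocycle \<open>s \<mapsto> s \<phi>(s)\<^sup>-\<^sup>1\<close> takes finitely many
  values; the conjugacy class of \<open>t\<^sup>-\<^sup>1 \<phi>(t)\<close> then consists of quotients of such values.
\<close>

theorem infinite_orbit:
  assumes icc: "icc \<Gamma>" and \<phi>: "\<phi> \<in> G" and t: "t \<in> S" "\<phi> t \<noteq> t"
  shows "infinite orbit"
proof
  assume fin: "finite orbit"
  note \<phi>A = GD(3)[OF \<phi>]
  note \<phi>S = autoD(2)[OF \<phi>A]
  let ?r = "1 / real (card G)"
  let ?D = "\<lambda>t. \<Union>Q\<in>orbit. {u. ?r \<le> cmod (coord (E Q t) u)}"
  let ?c = "\<lambda>s. s \<otimes> inv (\<phi> s)"
  have "finite (values_on_F ` S)"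
  proof (rule finite_values_on_F)
    show "finite (?D t)" for t
      using fin card_G by (intro finite_UN_I finite_large_coords) auto
    show "conj_aut s \<phi> t \<in> ?D t" if "s \<in> S" "\<phi> \<in> G" "t \<in> F" for s \<phi> t
      using coord_E_N[of s t \<phi>] that F_S by blast
  qed
  then have fin_c: "finite (?c ` S)"
  proof (rule finite_image_factor)
    fix s s' assume s: "s \<in> S" "s' \<in> S" and eq: "values_on_F s = values_on_F s'"
    have cS: "?c s \<in> S" "?c s' \<in> S"
      using s \<phi>S by auto
    let ?d = "inv (?c s') \<otimes> ?c s"
    have dS: "?d \<in> S"
      using cS by simp
    have "?d \<otimes> u = u \<otimes> ?d" if "u \<in> S" for u
      using that \<phi> by (intro conj_aut_determines_cocycle[OF F_S central \<phi>A s] values_on_F_eqD[OF eq])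
    then have "u \<otimes> ?d \<otimes> inv u = ?d" if "u \<in> S" for u
      using that dS by (metis inv_solve_right m_closed)
    then have "{u \<otimes> ?d \<otimes> inv u | u. u \<in> S} \<subseteq> {?d}"
      by blast
    then have "finite {u \<otimes> ?d \<otimes> inv u | u. u \<in> S}"
      by (rule finite_subset) simp
    then have "?d = \<one>"
      using icc dS unfolding icc_def by blast
    then show "?c s = ?c s'"
      using cS by (metis inv_closed inv_equality inv_inv)
  qed
  let ?g = "inv t \<otimes> \<phi> t"
  have gS: "?g \<in> S"
    using t \<phi>S by simp
  have "?g \<noteq> \<one>"
    using t \<phi>S by (metis inv_closed inv_equality inv_inv)
  then have "infinite {u \<otimes> ?g \<otimes> inv u | u. u \<in> S}"
    using icc gS unfolding icc_def by blast
  moreover have "{u \<otimes> ?g \<otimes> inv u | u. u \<in> S} \<subseteq> (\<lambda>(a, b). a \<otimes> inv b) ` (?c ` S \<times> ?c ` S)"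
  proof clarify
    fix u assume u: "u \<in> S"
    \<comment> \<open>\<open>u t\<^sup>-\<^sup>1 \<phi>(t) u\<^sup>-\<^sup>1 = (u t\<^sup>-\<^sup>1) \<phi>(u t\<^sup>-\<^sup>1)\<^sup>-\<^sup>1 \<cdot> \<phi>(u) u\<^sup>-\<^sup>1\<close>\<close>
    have "?c (u \<otimes> inv t) \<otimes> inv (?c u) = u \<otimes> ?g \<otimes> inv u"
    proof -
      have cancel: "inv (\<phi> u) \<otimes> (\<phi> u \<otimes> x) = x" if "x \<in> S" for x
        using that u \<phi>S by (simp flip: m_assoc)
      show ?thesis
        using u t \<phi>S by (simp add: autoD(3)[OF \<phi>A] auto_inv[OF \<phi>A] inv_mult_group m_assoc cancel)
    qed
    moreover have "u \<otimes> inv t \<in> S"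
      using u t by simp
    ultimately show "u \<otimes> ?g \<otimes> inv u \<in> (\<lambda>(a, b). a \<otimes> inv b) ` (?c ` S \<times> ?c ` S)"
      using u by (intro image_eqI[where x = "(?c (u \<otimes> inv t), ?c u)"]) auto
  qed
  ultimately show False
    using fin_c finite_subset by blast
qed

end

theorem corollary6p25:
  fixes \<Gamma> :: "('a, 'b) monoid_scheme" and \<omega> :: "nat filter" and G :: "('a \<Rightarrow> 'a) set"
  assumes "group \<Gamma>" and "countable (carrier \<Gamma>)"
    and "free_ultrafilter \<omega>"
    and "commutant_in_ultrapower \<Gamma> \<omega> = ultrapower_of_center \<Gamma> \<omega>"
    and "subgroup G (AutoGroup \<Gamma>)" and "finite G" and "G \<noteq> {\<one>\<^bsub>AutoGroup \<Gamma>\<^esub>}"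
  shows "let U = {conj_vNa \<Gamma> s (fixed_vNa \<Gamma> G) | s. s \<in> carrier \<Gamma>} in
    (discrete_URA \<Gamma> U \<and> exotic_URA \<Gamma> U) \<and>
    (icc \<Gamma> \<longrightarrow> infinite U)"
proof -
  interpret discrete_group \<Gamma>
    using assms(1) by (rule discrete_group.intro)
  obtain F where F: "finite F" "F \<subseteq> carrier \<Gamma>"
    "\<And>g. g \<in> carrier \<Gamma> \<Longrightarrow> \<forall>t\<in>F. g \<otimes>\<^bsub>\<Gamma>\<^esub> t = t \<otimes>\<^bsub>\<Gamma>\<^esub> g \<Longrightarrow> \<forall>t\<in>carrier \<Gamma>. g \<otimes>\<^bsub>\<Gamma>\<^esub> t = t \<otimes>\<^bsub>\<Gamma>\<^esub> g"
    using ex_finite_set_with_central_centralizer[OF assms(2-4)] by blast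
  interpret finite_automorphism_group \<Gamma> G F
    by unfold_locales (use F aut_group_subgroup[OF assms(5,6)] in blast)+
  have "\<one>\<^bsub>AutoGroup \<Gamma>\<^esub> \<in> G"
    by (rule subgroup.one_closed[OF assms(5)])
  then obtain \<phi> where \<phi>: "\<phi> \<in> G" "\<phi> \<noteq> \<one>\<^bsub>AutoGroup \<Gamma>\<^esub>"
    using assms(7) by blast
  have one: "\<one>\<^bsub>AutoGroup \<Gamma>\<^esub> = (\<lambda>t\<in>carrier \<Gamma>. t)"
    by (simp add: AutoGroup_def BijGroup_def)
  obtain t where t: "t \<in> carrier \<Gamma>" "\<phi> t \<noteq> t"
  proof -
    have "\<exists>t\<in>carrier \<Gamma>. \<phi> t \<noteq> t"
    proof (rule ccontr)
      assume "\<not> ?thesis"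
      then have "\<phi> = (\<lambda>t\<in>carrier \<Gamma>. t)"
        using autoD(4)[OF GD(3)[OF \<phi>(1)]] by (intro extensionalityI[where A = "carrier \<Gamma>"]) auto
      then show False
        using \<phi>(2) one by simp
    qed
    then show ?thesis
      using that by blast
  qed
  show ?thesis
    unfolding Let_def
    by (intro conjI impI discrete_URA_orbit exotic_URA_orbit[OF \<phi>(1) t] infinite_orbit[OF _ \<phi>(1) t])
qed

end
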